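(* Let $h$ be a boundary function. Suppose that (Poly-$R_1$) holds with $\beta_2<1$ and that $\Phi(r)\simeq\Psi(r)$ for $r\in(0,R_1)$. (i) If $\mathbf{HK}^h_B$ holds, then for every $T>0$ the following estimates hold for all $(t,x,y)\in(0,T]\times D\times D$: (1) If $\psi(\rho(x,y))\le t$, then $\displaystyle q(t,x,y)\simeq\frac{h(\phi^{-1}(1/t)^{-1},x,y)}{V(x,\psi^{-1}(t))}.$ (2) If $\psi(\rho(x,y))\ge t$, then $$q(t,x,y)\simeq\frac{t}{V(x,\rho(x,y))}\times\begin{cases}\dfrac{h(\Phi(\rho(x,y)),x,y)}{\psi(\rho(x,y))} & \text{when } C_0=0,\\[10pt] \dfrac{\mathcal{B}_h(t,x,y)}{\Phi(\rho(x,y))} & \text{when } C_0=1,\end{cases}$$ where $\mathcal{B}_h(t,x,y):=\int_{2\phi^{-1}(1/t)^{-1}}^{4\Phi(\rho(x,y))}h(s,x,y)\,w(s)\,ds$. (ii) If $R_1=\infty$ and $\mathbf{HK}^h_U$ holds, then (1) and (2) above hold for all $(t,x,y)\in(0,\infty)\times D\times D$.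
   Context: Notation: $a\wedge b=\min$, $a\vee b=\max$; $f\simeq g$ means $c_1g\le f\le c_2g$ on the specified range for some constants $c_1,c_2>0$. $\phi^{-1}(1/t)^{-1}=1/\phi^{-1}(1/t)$. Quotients $c/0$ with $c>0$ are $+\infty$. Subordinator: $S=(S_t)_{t\ge0}$ is a driftless subordinator (non-decreasing pure-jump Lévy process, $S_0=0$) with Laplace exponent $\phi(\lambda)=-\log\mathbb{E}e^{-\lambda S_1}=\int_0^\infty(1-e^{-\lambda s})\nu(ds)$ and $w(r):=\nu(r,\infty)$. Condition (Poly-$R_1$), $R_1\in(0,\infty]$: there are constants $c_1,c_2>0$, $\beta_2\ge\beta_1>0$ with $c_1(R/r)^{\beta_1}\le w(r)/w(R)\le c_2(R/r)^{\beta_2}$ for all $0<r\le R<R_1$. Space and process: $(E,\rho)$ is a locally compact separable metric space in which all bounded closed sets are compact, $m$ is a positive Radon measure on $E$ with full support, $B(x,r)$ is the open ball, $V(x,r)=m(B(x,r))$. There are $R_E\in(0,\infty]$ and $d_2\ge d_1>0$ such that for every $a\ge1$ there is $C_V\ge1$ with $C_V^{-1}(R/r)^{d_1}\le V(x,R)/V(x,r)\le C_V(R/r)^{d_2}$ for all $x\in E$, $0<r\le R<aR_E$. $D\subset E$ is a proper open subset. $Y^D$ is a Hunt process in $D$ independent of $S$ whose semigroup has a density (heat kernel) $p_D(t,x,y)$ with respect to $m$; $X_t=Y^D_{S_t}$ has heat kernel $q(t,x,y)=\int_0^\infty p_D(s,x,y)\mathbb{P}(S_t\in ds)$. Scale functions: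 $\Phi,\Psi:[0,\infty)\to[0,\infty)$ are strictly increasing, $\Psi\ge\Phi$, and for some constants $\alpha_1,\dots,\alpha_4,c_1,\dots,c_4>0$ and all $R\ge r>0$: $c_1(R/r)^{\alpha_1}\le\Phi(R)/\Phi(r)\le c_2(R/r)^{\alpha_2}$ and $c_3(R/r)^{\alpha_3}\le\Psi(R)/\Psi(r)\le c_4(R/r)^{\alpha_4}$. Set $\psi(r)=1/\phi(1/\Phi(r))$ for $r>0$, $\psi(0)=0$; thus $\psi^{-1}(t)=\Phi^{-1}(\phi^{-1}(1/t)^{-1})$. If $D$ is unbounded, $\Phi(\mathrm{diam}(D))$ is read as $\infty$. Boundary function: $h:(0,\infty)\times D\times D\to[0,1]$ such that (H1) $s\mapsto h(s,x,y)$ is non-increasing for all $x,y\in D$; (H2) there are $c_1>0$, $\gamma\ge0$ with $s^\gamma h(s,x,y)\le c_1t^\gamma h(t,x,y)$ for $0<s\le t<4\Phi(\mathrm{diam}(D))+1$, $x,y\in D$. Heat kernel conditions: for $C_0\in\{0,1\}$ and $c>0$ put $$I_{c}(t,x,y)=\frac1{V(x,\Phi^{-1}(t))}\wedge\Big(\frac{C_0t}{V(x,\rho(x,y))\Psi(\rho(x,y))}+\frac1{V(x,\Phi^{-1}(t))}\exp\Big(-\frac{c\,\rho(x,y)^2}{\Phi^{-1}(t)^2}\Big)\Big)$$ (the first summand is absent if $C_0=0$). $\mathbf{HK}^h_B$: $D$ is bounded; (i) there are $C_0\in\{0,1\}$ and $c_1,c_2,c_3,c_4>0$ with $c_1h(t,x,y)I_{c_2}(t,x,y)\le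 p_D(t,x,y)\le c_3h(t,x,y)I_{c_4}(t,x,y)$ for all $(t,x,y)\in(0,1]\times D\times D$; (ii) there is $\lambda_D>0$ with $p_D(t,x,y)\simeq e^{-\lambda_Dt}h(1,x,y)$ for $(t,x,y)\in[1,\infty)\times D\times D$. $\mathbf{HK}^h_U$: $R_E=\infty$ and the two-sided estimate in (i) holds for all $(t,x,y)\in(0,\infty)\times D\times D$. The constant $C_0$ in the claim is the one in these conditions. Standing convention: when (Poly-$R_1$) and $\mathbf{HK}^h_B$ hold, $\Phi$ is normalized (by multiplication by a constant) so that $\Phi(\mathrm{diam}(D))<R_1/8$.
   Formalization: For bounded D, estimate (1) can fail once φ^{-1}(1/t)^{-1} leaves the range of (H2); it is proved here assuming the inequality in (H2) for times in (0, φ^{-1}(1/T)^{-1}] in (i) and in (0,∞) in (ii). For unbounded D this is automatic; (2) is unchanged. *)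

theory Defs
  imports "HOL-Probability.Probability"
begin

section \<open>Generalities\<close>

text \<open>
  \<open>f \<simeq> g\<close> on \<open>A\<close>. Values are in \<^typ>\<open>ennreal\<close>, where \<open>c / 0 = \<infinity>\<close> for \<open>c > 0\<close> and \<open>0 / 0 = 0\<close>.
\<close>

definition comparable_on :: "'b set \<Rightarrow> ('b \<Rightarrow> ennreal) \<Rightarrow> ('b \<Rightarrow> ennreal) \<Rightarrow> bool" where
  "comparable_on A f g \<longleftrightarrow>
    (\<exists>c1>0. \<exists>c2>0. \<forall>z\<in>A. ennreal c1 * g z \<le> f z \<and> f z \<le> ennreal c2 * g z)"

text \<open>
  Inverse of an increasing function on \<open>[0,\<infinity>)\<close>. The scale functions below are not assumed to be
  continuous; \<open>gen_inv f\<close> is the ordinary inverse on the range of a strictly increasing \<open>f\<close>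
  and the right-continuous inverse at levels that \<open>f\<close> jumps over.
\<close>

definition gen_inv :: "(real \<Rightarrow> real) \<Rightarrow> real \<Rightarrow> real" where
  "gen_inv f t = Inf {s. 0 \<le> s \<and> t < f s}"

lemma gen_inv_eq_inverse:
  assumes "strict_mono_on {0..} f" "0 \<le> s"
  shows "gen_inv f (f s) = s"
proof -
  have "{u. 0 \<le> u \<and> f s < f u} = {s<..}"
    using assms by (auto simp: strict_mono_on_def)
      (metis linorder_neqE_linordered_idom order_less_asym)
  then show ?thesis by (simp add: gen_inv_def)
qed

section \<open>The space\<close>

definition radon_measure :: "'a::metric_space measure \<Rightarrow> bool" where
  "radon_measure m \<longleftrightarrow> sets m = sets borel \<and>
    (\<forall>K. compact K \<longrightarrow> emeasure m K < \<infinity>) \<and>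
    (\<forall>A\<in>sets borel. emeasure m A = (SUP K\<in>{K. compact K \<and> K \<subseteq> A}. emeasure m K))"

definition full_support :: "'a::metric_space measure \<Rightarrow> bool" where
  "full_support m \<longleftrightarrow> (\<forall>U. open U \<and> U \<noteq> {} \<longrightarrow> 0 < emeasure m U)"

definition vol :: "'a::metric_space measure \<Rightarrow> 'a \<Rightarrow> real \<Rightarrow> ennreal" where
  "vol m x r = emeasure m (ball x r)"

definition volume_scaling :: "'a::metric_space measure \<Rightarrow> ereal \<Rightarrow> bool" where
  "volume_scaling m R_E \<longleftrightarrow>
    (\<exists>d1 d2. 0 < d1 \<and> d1 \<le> d2 \<and>
      (\<forall>a\<ge>1. \<exists>C_V\<ge>1. \<forall>x r R. 0 < r \<and> r \<le> R \<and> ereal R < ereal a * R_E \<longrightarrow>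
        ennreal (inverse C_V * (R / r) powr d1) \<le> vol m x R / vol m x r \<and>
        vol m x R / vol m x r \<le> ennreal (C_V * (R / r) powr d2)))"

definition scale_function :: "(real \<Rightarrow> real) \<Rightarrow> bool" where
  "scale_function f \<longleftrightarrow> (\<forall>r\<ge>0. 0 \<le> f r) \<and> strict_mono_on {0..} f \<and>
    (\<exists>a1>0. \<exists>a2>0. \<exists>c1>0. \<exists>c2>0. \<forall>r R. 0 < r \<and> r \<le> R \<longrightarrow>
      c1 * (R / r) powr a1 \<le> f R / f r \<and> f R / f r \<le> c2 * (R / r) powr a2)"

section \<open>The subordinator\<close>

definition subordinator_levy_measure :: "real measure \<Rightarrow> bool" where
  "subordinator_levy_measure \<nu> \<longleftrightarrow> sets \<nu> = sets borel \<and> emeasure \<nu> {..0} = 0 \<and>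
    (\<integral>\<^sup>+ s. ennreal (min 1 s) \<partial>\<nu>) < \<infinity>"

definition laplace_exponent :: "real measure \<Rightarrow> real \<Rightarrow> real" where
  "laplace_exponent \<nu> l = (LINT s|\<nu>. 1 - exp (- l * s))"

definition levy_tail :: "real measure \<Rightarrow> real \<Rightarrow> real" where
  "levy_tail \<nu> r = measure \<nu> {r<..}"

text \<open>
  The absence of a drift and of a Gaussian part is expressed by the form of the Laplace exponent.
  Path properties are only required almost surely.
\<close>

definition driftless_subordinator ::
    "'w measure \<Rightarrow> real measure \<Rightarrow> (real \<Rightarrow> 'w \<Rightarrow> real) \<Rightarrow> bool" where
  "driftless_subordinator N \<nu> S \<longleftrightarrow>
    prob_space N \<and> subordinator_levy_measure \<nu> \<and>
    (\<forall>t\<ge>0. S t \<in> borel_measurable N) \<and>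
    (AE \<omega> in N. S 0 \<omega> = 0 \<and>
      (\<forall>s t. 0 \<le> s \<and> s \<le> t \<longrightarrow> S s \<omega> \<le> S t \<omega>) \<and>
      (\<forall>t\<ge>0. continuous (at_right t) (\<lambda>s. S s \<omega>))) \<and>
    (\<forall>(t::nat \<Rightarrow> real) n. 0 \<le> t 0 \<and> incseq t \<longrightarrow>
      prob_space.indep_vars N (\<lambda>_. borel) (\<lambda>i \<omega>. S (t (Suc i)) \<omega> - S (t i) \<omega>) {..<n}) \<and>
    (\<forall>s t. 0 \<le> s \<and> s \<le> t \<longrightarrow>
      distr N borel (\<lambda>\<omega>. S t \<omega> - S s \<omega>) = distr N borel (S (t - s))) \<and>
    (\<forall>l\<ge>0. - ln (LINT \<omega>|N. exp (- l * S 1 \<omega>)) = laplace_exponent \<nu> l)"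

definition poly_tail :: "real measure \<Rightarrow> ereal \<Rightarrow> real \<Rightarrow> real \<Rightarrow> bool" where
  "poly_tail \<nu> R1 b1 b2 \<longleftrightarrow> 0 < b1 \<and> b1 \<le> b2 \<and>
    (\<exists>c1>0. \<exists>c2>0. \<forall>r R. 0 < r \<and> r \<le> R \<and> ereal R < R1 \<longrightarrow>
      c1 * (R / r) powr b1 \<le> levy_tail \<nu> r / levy_tail \<nu> R \<and>
      levy_tail \<nu> r / levy_tail \<nu> R \<le> c2 * (R / r) powr b2)"

text \<open>\<open>\<phi>\<inverse>(1/t)\<inverse>\<close>\<close>

definition sub_time :: "real measure \<Rightarrow> real \<Rightarrow> real" where
  "sub_time \<nu> t = 1 / gen_inv (laplace_exponent \<nu>) (1 / t)"

definition sub_scale :: "real measure \<Rightarrow> (real \<Rightarrow> real) \<Rightarrow> real \<Rightarrow> real" where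
  "sub_scale \<nu> \<Phi> r = (if r = 0 then 0 else 1 / laplace_exponent \<nu> (1 / \<Phi> r))"

section \<open>Hunt processes\<close>

text \<open>
  The state space is the one-point compactification of \<open>D\<close>; the cemetery is \<^term>\<open>None\<close>. Time runs
  through \<open>[0,\<infinity>]\<close>, so that stopping times may be infinite. The strong Markov property is the
  identity \<open>P z (Y (\<sigma> + u) \<in> B | F\<^sub>\<sigma>) = P (Y \<sigma>) (Y u \<in> B)\<close>, integrated over the events of \<open>F\<^sub>\<sigma>\<close>; on
  \<open>{\<sigma> = \<infinity>}\<close> it is trivial, because \<open>Y \<infinity>\<close> is the cemetery.
\<close>

definition cemetery_top :: "'a::metric_space set \<Rightarrow> 'a option topology" where
  "cemetery_top D = Alexandroff_compactification (top_of_set D)"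

definition cemetery_borel :: "'a::metric_space set \<Rightarrow> 'a option measure" where
  "cemetery_borel D = sigma (topspace (cemetery_top D)) {U. openin (cemetery_top D) U}"

locale hunt_process = filtration "space M" F
  for M :: "'w measure" and F :: "ennreal \<Rightarrow> 'w measure" +
  fixes D :: "'a::metric_space set"
    and P :: "'a option \<Rightarrow> 'w measure"
    and Y :: "ennreal \<Rightarrow> 'w \<Rightarrow> 'a option"
  assumes F_subalgebra: "\<And>t. sets (F t) \<subseteq> sets M"
    and F_right_continuous: "\<And>t. t < \<infinity> \<Longrightarrow> sets (F t) = (\<Inter>s\<in>{t<..}. sets (F s))"
    and prob_P: "\<And>z. z \<in> topspace (cemetery_top D) \<Longrightarrow> prob_space (P z) \<and> sets (P z) = sets M"
    and adapted: "\<And>t. Y t \<in> F t \<rightarrow>\<^sub>M cemetery_borel D"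
    and kernel: "\<And>t B. B \<in> sets (cemetery_borel D) \<Longrightarrow>
      (\<lambda>z. emeasure (P z) {\<omega> \<in> space M. Y t \<omega> \<in> B}) \<in> borel_measurable (cemetery_borel D)"
    and normal: "\<And>z. z \<in> topspace (cemetery_top D) \<Longrightarrow> AE \<omega> in P z. Y 0 \<omega> = z"
    and cemetery_at_infinity: "\<And>\<omega>. \<omega> \<in> space M \<Longrightarrow> Y \<infinity> \<omega> = None"
    and cemetery_absorbing:
      "\<And>\<omega> s t. \<omega> \<in> space M \<Longrightarrow> s \<le> t \<Longrightarrow> Y s \<omega> = None \<Longrightarrow> Y t \<omega> = None"
    and shift: "\<And>t. \<exists>\<theta>\<in>space M \<rightarrow> space M. \<forall>s. \<forall>\<omega>\<in>space M. Y s (\<theta> \<omega>) = Y (s + t) \<omega>"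
    and right_continuous: "\<And>\<omega> t. \<omega> \<in> space M \<Longrightarrow> t < \<infinity> \<Longrightarrow>
      limitin (cemetery_top D) (\<lambda>s. Y s \<omega>) (Y t \<omega>) (at_right t)"
    and left_limits: "\<And>\<omega> t. \<omega> \<in> space M \<Longrightarrow> 0 < t \<Longrightarrow> t < \<infinity> \<Longrightarrow>
      \<exists>z. limitin (cemetery_top D) (\<lambda>s. Y s \<omega>) z (at_left t)"
    and strong_markov: "\<And>z \<sigma> A u B. z \<in> topspace (cemetery_top D) \<Longrightarrow> stopping_time F \<sigma> \<Longrightarrow>
      A \<in> sets (pre_sigma \<sigma>) \<Longrightarrow> B \<in> sets (cemetery_borel D) \<Longrightarrow>
      emeasure (P z) {\<omega> \<in> A. Y (\<sigma> \<omega> + u) \<omega> \<in> B} =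
        (\<integral>\<^sup>+ \<omega>\<in>A. emeasure (P (Y (\<sigma> \<omega>) \<omega>)) {\<omega>' \<in> space M. Y u \<omega>' \<in> B} \<partial>P z)"
    and quasi_left_continuous: "\<And>z \<sigma>. z \<in> topspace (cemetery_top D) \<Longrightarrow>
      (\<And>n::nat. stopping_time F (\<sigma> n)) \<Longrightarrow> (\<And>\<omega>. \<omega> \<in> space M \<Longrightarrow> incseq (\<lambda>n. \<sigma> n \<omega>)) \<Longrightarrow>
      AE \<omega> in P z. (SUP n. \<sigma> n \<omega>) < \<infinity> \<longrightarrow>
        limitin (cemetery_top D) (\<lambda>n. Y (\<sigma> n \<omega>) \<omega>) (Y (SUP n. \<sigma> n \<omega>) \<omega>) sequentially"

definition process_events ::
    "'w measure \<Rightarrow> 't set \<Rightarrow> 's measure \<Rightarrow> ('t \<Rightarrow> 'w \<Rightarrow> 's) \<Rightarrow> 'w set set" where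
  "process_events M I N Z =
    sigma_sets (space M) (\<Union>t\<in>I. {Z t -` A \<inter> space M | A. A \<in> sets N})"

text \<open>
  The subordinator lives on the same sample space as the Hunt process; under every starting
  point in \<open>D\<close> it has the law determined by \<open>\<nu>\<close> and is independent of the Hunt process.
\<close>

definition independent_subordinator :: "'w measure \<Rightarrow> 'a::metric_space set \<Rightarrow>
    ('a option \<Rightarrow> 'w measure) \<Rightarrow> (ennreal \<Rightarrow> 'w \<Rightarrow> 'a option) \<Rightarrow>
    real measure \<Rightarrow> (real \<Rightarrow> 'w \<Rightarrow> real) \<Rightarrow> bool" where
  "independent_subordinator M D P Y \<nu> S \<longleftrightarrow>
    (\<forall>x\<in>D. driftless_subordinator (P (Some x)) \<nu> S \<and>
      prob_space.indep_set (P (Some x))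
        (process_events M UNIV (cemetery_borel D) Y) (process_events M {0..} borel S))"

text \<open>
  Joint measurability in \<open>(t,y)\<close> is what makes the subordinated kernel below well defined and a
  density of the subordinate process.
\<close>

definition heat_kernel :: "'w measure \<Rightarrow> 'a::{metric_space,second_countable_topology} set \<Rightarrow>
    ('a option \<Rightarrow> 'w measure) \<Rightarrow> (ennreal \<Rightarrow> 'w \<Rightarrow> 'a option) \<Rightarrow>
    'a measure \<Rightarrow> (real \<Rightarrow> 'a \<Rightarrow> 'a \<Rightarrow> real) \<Rightarrow> bool" where
  "heat_kernel M D P Y m p \<longleftrightarrow>
    (\<forall>t>0. \<forall>x\<in>D. \<forall>y\<in>D. 0 \<le> p t x y) \<and>
    (\<forall>x\<in>D. (\<lambda>(t, y). p t x y) \<in> borel_measurable (restrict_space borel ({0<..} \<times> D))) \<and>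
    (\<forall>t>0. \<forall>x\<in>D. \<forall>A\<in>sets borel. A \<subseteq> D \<longrightarrow>
      emeasure (P (Some x)) {\<omega> \<in> space M. Y (ennreal t) \<omega> \<in> Some ` A} =
        (\<integral>\<^sup>+ y\<in>A. ennreal (p t x y) \<partial>m))"

text \<open>
  The heat kernel of \<open>Y (S t)\<close>. The law of \<open>S t\<close> is the same under all \<open>P (Some x)\<close>.
\<close>

definition subordinate_kernel :: "('a option \<Rightarrow> 'w measure) \<Rightarrow> (real \<Rightarrow> 'w \<Rightarrow> real) \<Rightarrow>
    (real \<Rightarrow> 'a \<Rightarrow> 'a \<Rightarrow> real) \<Rightarrow> real \<Rightarrow> 'a \<Rightarrow> 'a \<Rightarrow> ennreal" where
  "subordinate_kernel P S p t x y =
    (\<integral>\<^sup>+ s\<in>{0<..}. ennreal (p s x y) \<partial>distr (P (Some x)) borel (S t))"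

section \<open>Boundary functions and heat kernel conditions\<close>

definition power_decay_on ::
    "real set \<Rightarrow> 'a set \<Rightarrow> (real \<Rightarrow> 'a \<Rightarrow> 'a \<Rightarrow> real) \<Rightarrow> bool" where
  "power_decay_on J D h \<longleftrightarrow>
    (\<exists>c>0. \<exists>\<gamma>\<ge>0. \<forall>s\<in>J. \<forall>t\<in>J. s \<le> t \<longrightarrow> (\<forall>x\<in>D. \<forall>y\<in>D.
      s powr \<gamma> * h s x y \<le> c * (t powr \<gamma> * h t x y)))"

definition boundary_function ::
    "'a::metric_space set \<Rightarrow> (real \<Rightarrow> real) \<Rightarrow> (real \<Rightarrow> 'a \<Rightarrow> 'a \<Rightarrow> real) \<Rightarrow> bool" where
  "boundary_function D \<Phi> h \<longleftrightarrow>
    (\<forall>s>0. \<forall>x\<in>D. \<forall>y\<in>D. 0 \<le> h s x y \<and> h s x y \<le> 1) \<and>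
    (\<forall>x\<in>D. \<forall>y\<in>D. \<forall>s t. 0 < s \<and> s \<le> t \<longrightarrow> h t x y \<le> h s x y) \<and>
    power_decay_on {t. 0 < t \<and> (bounded D \<longrightarrow> t < 4 * \<Phi> (diameter D) + 1)} D h"

text \<open>
  The near-diagonal estimate evaluates \<open>h\<close> at \<open>sub_time \<nu> t\<close>, which tends to \<open>\<infinity>\<close> with \<open>t\<close>. For bounded
  \<open>D\<close> these times leave the range in which a boundary function has controlled decay (it may even
  vanish beyond it), so there the estimate needs \<^const>\<open>power_decay_on\<close> on the times in question.
  For unbounded \<open>D\<close>, and for times below \<open>4 * \<Phi> (diameter D) + 1\<close>, it is automatic.
\<close>

lemma power_decay_on_subset: "power_decay_on J D h \<Longrightarrow> K \<subseteq> J \<Longrightarrow> power_decay_on K D h"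
  unfolding power_decay_on_def by (meson subsetD)

lemma boundary_function_power_decay_unbounded:
  assumes "boundary_function D \<Phi> h" "\<not> bounded D"
  shows "power_decay_on {0<..} D h"
  using assms unfolding boundary_function_def by (auto elim: power_decay_on_subset)

lemma boundary_function_power_decay_bounded:
  assumes "boundary_function D \<Phi> h" "T < 4 * \<Phi> (diameter D) + 1"
  shows "power_decay_on {0<..T} D h"
  using assms unfolding boundary_function_def by (auto elim: power_decay_on_subset)

text \<open>
  For \<open>C0 = 0\<close> the first summand vanishes also on the diagonal, where it reads \<open>0 / 0\<close>;
  for \<open>C0 = 1\<close> it is \<open>\<infinity>\<close> there.
\<close>

definition hk_profile :: "'a::metric_space measure \<Rightarrow> (real \<Rightarrow> real) \<Rightarrow> (real \<Rightarrow> real) \<Rightarrow>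
    real \<Rightarrow> real \<Rightarrow> real \<Rightarrow> 'a \<Rightarrow> 'a \<Rightarrow> ennreal" where
  "hk_profile m \<Phi> \<Psi> C0 c t x y =
    min (1 / vol m x (gen_inv \<Phi> t))
      (ennreal (C0 * t) / (vol m x (dist x y) * ennreal (\<Psi> (dist x y))) +
       1 / vol m x (gen_inv \<Phi> t) * ennreal (exp (- (c * (dist x y)\<^sup>2 / (gen_inv \<Phi> t)\<^sup>2))))"

definition hk_two_sided :: "real set \<Rightarrow> 'a::metric_space measure \<Rightarrow> 'a set \<Rightarrow>
    (real \<Rightarrow> real) \<Rightarrow> (real \<Rightarrow> real) \<Rightarrow> (real \<Rightarrow> 'a \<Rightarrow> 'a \<Rightarrow> real) \<Rightarrow>
    real \<Rightarrow> (real \<Rightarrow> 'a \<Rightarrow> 'a \<Rightarrow> real) \<Rightarrow> bool" where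
  "hk_two_sided J m D \<Phi> \<Psi> h C0 p \<longleftrightarrow> C0 \<in> {0, 1} \<and>
    (\<exists>c1>0. \<exists>c2>0. \<exists>c3>0. \<exists>c4>0. \<forall>t\<in>J. \<forall>x\<in>D. \<forall>y\<in>D.
      ennreal (c1 * h t x y) * hk_profile m \<Phi> \<Psi> C0 c2 t x y \<le> ennreal (p t x y) \<and>
      ennreal (p t x y) \<le> ennreal (c3 * h t x y) * hk_profile m \<Phi> \<Psi> C0 c4 t x y)"

definition HK_B :: "'a::metric_space measure \<Rightarrow> 'a set \<Rightarrow>
    (real \<Rightarrow> real) \<Rightarrow> (real \<Rightarrow> real) \<Rightarrow> (real \<Rightarrow> 'a \<Rightarrow> 'a \<Rightarrow> real) \<Rightarrow>
    real \<Rightarrow> (real \<Rightarrow> 'a \<Rightarrow> 'a \<Rightarrow> real) \<Rightarrow> bool" where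
  "HK_B m D \<Phi> \<Psi> h C0 p \<longleftrightarrow> bounded D \<and> hk_two_sided {0<..1} m D \<Phi> \<Psi> h C0 p \<and>
    (\<exists>l>0. comparable_on ({1..} \<times> D \<times> D)
      (\<lambda>(t, x, y). ennreal (p t x y)) (\<lambda>(t, x, y). ennreal (exp (- l * t) * h 1 x y)))"

definition HK_U :: "ereal \<Rightarrow> 'a::metric_space measure \<Rightarrow> 'a set \<Rightarrow>
    (real \<Rightarrow> real) \<Rightarrow> (real \<Rightarrow> real) \<Rightarrow> (real \<Rightarrow> 'a \<Rightarrow> 'a \<Rightarrow> real) \<Rightarrow>
    real \<Rightarrow> (real \<Rightarrow> 'a \<Rightarrow> 'a \<Rightarrow> real) \<Rightarrow> bool" where
  "HK_U R_E m D \<Phi> \<Psi> h C0 p \<longleftrightarrow> R_E = \<infinity> \<and> hk_two_sided {0<..} m D \<Phi> \<Psi> h C0 p"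

section \<open>The two estimates\<close>

definition jump_integral :: "real measure \<Rightarrow> (real \<Rightarrow> real) \<Rightarrow>
    (real \<Rightarrow> 'a::metric_space \<Rightarrow> 'a \<Rightarrow> real) \<Rightarrow> real \<Rightarrow> 'a \<Rightarrow> 'a \<Rightarrow> ennreal" where
  "jump_integral \<nu> \<Phi> h t x y =
    (\<integral>\<^sup>+ s\<in>{2 * sub_time \<nu> t .. 4 * \<Phi> (dist x y)}. ennreal (h s x y * levy_tail \<nu> s) \<partial>lborel)"

definition near_diagonal_estimate :: "real set \<Rightarrow> 'a::metric_space measure \<Rightarrow> 'a set \<Rightarrow>
    real measure \<Rightarrow> (real \<Rightarrow> real) \<Rightarrow> (real \<Rightarrow> 'a \<Rightarrow> 'a \<Rightarrow> real) \<Rightarrow>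
    (real \<Rightarrow> 'a \<Rightarrow> 'a \<Rightarrow> ennreal) \<Rightarrow> bool" where
  "near_diagonal_estimate J m D \<nu> \<Phi> h q \<longleftrightarrow>
    comparable_on {(t, x, y). t \<in> J \<and> x \<in> D \<and> y \<in> D \<and> sub_scale \<nu> \<Phi> (dist x y) \<le> t}
      (\<lambda>(t, x, y). q t x y)
      (\<lambda>(t, x, y). ennreal (h (sub_time \<nu> t) x y) / vol m x (gen_inv (sub_scale \<nu> \<Phi>) t))"

definition off_diagonal_estimate :: "real set \<Rightarrow> 'a::metric_space measure \<Rightarrow> 'a set \<Rightarrow>
    real measure \<Rightarrow> (real \<Rightarrow> real) \<Rightarrow> (real \<Rightarrow> 'a \<Rightarrow> 'a \<Rightarrow> real) \<Rightarrow> real \<Rightarrow>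
    (real \<Rightarrow> 'a \<Rightarrow> 'a \<Rightarrow> ennreal) \<Rightarrow> bool" where
  "off_diagonal_estimate J m D \<nu> \<Phi> h C0 q \<longleftrightarrow>
    comparable_on {(t, x, y). t \<in> J \<and> x \<in> D \<and> y \<in> D \<and> t \<le> sub_scale \<nu> \<Phi> (dist x y)}
      (\<lambda>(t, x, y). q t x y)
      (\<lambda>(t, x, y). ennreal t / vol m x (dist x y) *
        (if C0 = 0
         then ennreal (h (\<Phi> (dist x y)) x y) / ennreal (sub_scale \<nu> \<Phi> (dist x y))
         else jump_integral \<nu> \<Phi> h t x y / ennreal (\<Phi> (dist x y))))"

end

theory Submission
  imports Defs
begin

text \<open>
  The kernel of the subordinate process is the mean of \<open>p (S t) x y\<close>. Write \<open>\<tau> = \<phi>\<inverse>(1/t)\<inverse>\<close> for the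
  typical size of \<open>S t\<close> and \<open>R = \<Phi> (dist x y)\<close> for the time that the original process needs to
  travel from \<open>x\<close> to \<open>y\<close>. The condition \<open>\<psi> (dist x y) \<le> t\<close> says \<open>R \<le> \<tau>\<close>. Everything is decided
  by where \<open>S t\<close> lies relative to \<open>\<tau>\<close> and \<open>R\<close>.

  Three facts about the law of \<open>S t\<close> are needed, and all of them come from its Laplace transform
  \<open>exp (- t \<phi>)\<close>. The truncated mean and the upper tail are bounded by \<open>t \<phi> (1/r)\<close>
  (\<open>law_truncated_mean\<close>, \<open>law_tail_le\<close>). All negative moments of \<open>S t / \<tau>\<close> are bounded
  (\<open>law_negative_moment\<close>). If \<open>t \<phi> (1/R) \<le> 1\<close>, then \<open>S t\<close> falls into a block \<open>{a R<..R}\<close> with probability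
  at least a constant times \<open>t \<phi> (1/R)\<close> (\<open>law_block_ge\<close>). The last fact rests on \<open>\<beta>2 < 1\<close>, which
  enters twice: it makes \<open>\<phi> (1/r)\<close> comparable with the tail of the Levy measure, and it lets the tail
  of \<open>S t\<close> be read off from the Laplace transform by a Tauberian argument. The block ends exactly at
  \<open>R\<close>, so that in the lower bounds the boundary function is evaluated at no time later than \<open>R\<close>.

  Near the diagonal, the block below \<open>\<tau>\<close> gives the lower bound. For the upper bound, times after
  \<open>\<tau>\<close> contribute at most the value at \<open>\<tau>\<close>, and times before \<open>\<tau>\<close> lose only a power of \<open>\<tau> / s\<close>, which the
  negative moments absorb.

  Off the diagonal with \<open>C0 = 0\<close>, the Gaussian factor beats every power of \<open>R / s\<close>. Hence the kernel at
  time \<open>s\<close> is at most \<open>min 1 (s/R)\<close> times its size at \<open>R\<close>, and the truncated mean finishes the proof.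
  With \<open>C0 = 1\<close>, the kernel at times \<open>s \<le> 4 R\<close> is comparable with \<open>h(s) s / (R V)\<close>, so the mean of
  \<open>h(S) S\<close> over \<open>{S \<le> 4 R}\<close> has to be computed. Since \<open>h\<close> is non-increasing, \<open>h(s) s\<close> can be replaced by the
  integral of \<open>h\<close> over an interval of length comparable with \<open>s\<close>. Tonelli's theorem then turns the mean into the
  integral of \<open>h(u)\<close> against the probability that \<open>S t\<close> is of size \<open>u\<close>, which is comparable with \<open>t w(u)\<close>.

  For bounded \<open>D\<close> the kernel is known only up to time 1 and after time 1 separately. On a bounded time
  interval the exponential decay is invisible, and the two regimes merge into one two-sided estimate
  (\<open>HK_B_finite_horizon\<close>).
\<close>

section \<open>Elementary inequalities\<close>

lemma power_div_fact_le_exp: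
  fixes x :: real
  assumes "0 \<le> x"
  shows "x ^ n / fact n \<le> exp x"
proof -
  have "sum (\<lambda>k. x ^ k /\<^sub>R fact k) {n} \<le> (\<Sum>k. x ^ k /\<^sub>R fact k)"
    using assms by (intro sum_le_suminf summable_exp_generic) auto
  then show ?thesis by (simp add: exp_def field_simps)
qed

lemma exp_neg_powr_le_powr:
  fixes c b M :: real
  assumes "0 < c" "0 < b"
  obtains C where "0 < C" "\<And>z. 1 \<le> z \<Longrightarrow> exp (- (c * z powr b)) \<le> C * z powr (- M)"
proof -
  \<comment> \<open>one term of the exponential series, of an order that beats \<open>M\<close>\<close>
  define n where "n = nat \<lceil>M / b\<rceil>"
  have "M / b \<le> real n" unfolding n_def by linarith
  then have Mn: "M \<le> b * real n" using assms by (simp add: field_simps)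
  show ?thesis
  proof (rule that)
    show "0 < fact n / c ^ n" using assms by simp
  next
    fix z :: real assume z: "1 \<le> z"
    define x where "x = c * z powr b"
    have x: "0 < x" using z assms by (simp add: x_def)
    have "exp (- x) = 1 / exp x" by (simp add: exp_minus field_simps)
    also have "\<dots> \<le> 1 / (x ^ n / fact n)"
      using power_div_fact_le_exp[of x n] x by (intro divide_left_mono mult_pos_pos) auto
    also have "\<dots> = fact n / c ^ n * z powr (- (b * real n))"
      using z by (simp add: x_def power_mult_distrib powr_minus divide_simps powr_powr
          flip: powr_realpow)
    also have "\<dots> \<le> fact n / c ^ n * z powr (- M)"
      using Mn z assms by (intro mult_left_mono powr_mono) auto
    finally show "exp (- (c * z powr b)) \<le> fact n / c ^ n * z powr (- M)" by (simp add: x_def)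
  qed
qed

lemma one_minus_exp_lower:
  fixes x :: real
  assumes "0 \<le> x" "x \<le> 1"
  shows "x / 2 \<le> 1 - exp (- x)"
proof -
  have "exp (- x) * (1 + x) \<le> 1"
    using exp_ge_add_one_self[of x] assms by (simp add: exp_minus field_simps)
  then have "exp (- x) \<le> 1 / (1 + x)" using assms by (simp add: field_simps)
  also have "\<dots> \<le> 1 - x / 2" using assms by (simp add: field_simps power2_eq_square) (smt (verit) mult_left_le)
  finally show ?thesis by simp
qed

lemma min_one_le_one_minus_exp:
  fixes x :: real
  assumes "0 \<le> x"
  shows "min 1 x \<le> 2 * (1 - exp (- x))"
proof (cases "x \<le> 1")
  case True
  then show ?thesis using one_minus_exp_lower[of x] assms by simp
next
  case False
  then have "exp (-x) \<le> exp (-1)" by simp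
  moreover have "1/2 \<le> 1 - exp (-1::real)" using one_minus_exp_lower[of 1] by simp
  ultimately have "1 / 2 \<le> 1 - exp (- x)"
    using order_trans[of "1 / 2" "1 - exp (- 1)" "1 - exp (- x)"] by simp
  then have "1 \<le> 2 * (1 - exp (- x))" by simp
  then show ?thesis using False by simp
qed

section \<open>The Laplace exponent\<close>

context
  fixes \<nu> :: "real measure"
  assumes levy: "subordinator_levy_measure \<nu>"
begin

lemma sets_levy [measurable_cong]: "sets \<nu> = sets borel"
  using levy by (simp add: subordinator_levy_measure_def)

lemma AE_levy_pos: "AE s in \<nu>. 0 < s"
proof (rule AE_I)
  show "{s \<in> space \<nu>. \<not> 0 < s} \<subseteq> {..0}" by auto
  show "emeasure \<nu> {..0} = 0" using levy by (simp add: subordinator_levy_measure_def)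
  show "{..0} \<in> sets \<nu>" by (simp add: sets_levy)
qed

lemma integrable_min_levy: "integrable \<nu> (\<lambda>s. min 1 \<bar>s\<bar>)"
proof (rule integrableI_bounded)
  have "(\<integral>\<^sup>+ s. ennreal (norm (min 1 \<bar>s\<bar>)) \<partial>\<nu>) = (\<integral>\<^sup>+ s. ennreal (min 1 s) \<partial>\<nu>)"
    by (rule nn_integral_cong_AE) (use AE_levy_pos in eventually_elim, auto)
  then show "(\<integral>\<^sup>+ s. ennreal (norm (min 1 \<bar>s\<bar>)) \<partial>\<nu>) < \<infinity>"
    using levy by (simp add: subordinator_levy_measure_def)
qed measurable

lemma one_minus_exp_le_min: "0 \<le> l \<Longrightarrow> 0 \<le> s \<Longrightarrow> 1 - exp (- l * s) \<le> max 1 l * min 1 (s::real)"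
proof -
  assume a: "0 \<le> l" "0 \<le> s"
  have "1 - exp (- l * s) \<le> l * s" using exp_ge_add_one_self[of "- l * s"] by simp
  moreover have "1 - exp (- l * s) \<le> 1" by simp
  moreover have "l * s \<le> max 1 l * s" using a by (intro mult_right_mono) auto
  moreover have "1 \<le> max 1 l" by simp
  ultimately show ?thesis by (cases "s \<le> 1") (simp_all only: min_absorb1 min_absorb2 linorder_not_le mult_1_right less_imp_le)
qed

lemma integrable_one_minus_exp: "0 \<le> l \<Longrightarrow> integrable \<nu> (\<lambda>s. 1 - exp (- l * s))"
proof (rule Bochner_Integration.integrable_bound)
  assume l: "0 \<le> l"
  show "integrable \<nu> (\<lambda>s. max 1 l * min 1 \<bar>s\<bar>)"
    using integrable_min_levy by (intro integrable_mult_right)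
  show "AE s in \<nu>. norm (1 - exp (- l * s)) \<le> norm (max 1 l * min 1 \<bar>s\<bar>)"
    using AE_levy_pos by eventually_elim (use one_minus_exp_le_min[OF l] l in auto)
qed measurable

lemma levy_tail_finite:
  assumes "0 < r"
  shows "emeasure \<nu> {r<..} < \<infinity>"
proof -
  have "emeasure \<nu> {r<..} = (\<integral>\<^sup>+ s. indicator {r<..} s \<partial>\<nu>)" by (simp add: sets_levy)
  also have "\<dots> \<le> (\<integral>\<^sup>+ s. ennreal (inverse (min 1 r)) * ennreal (min 1 s) \<partial>\<nu>)"
    using assms by (intro nn_integral_mono)
      (auto simp: indicator_def field_simps ennreal_mult[symmetric] one_ennreal_def[symmetric] min_def
          simp flip: ennreal_1 intro!: ennreal_leI)
  also have "\<dots> = ennreal (inverse (min 1 r)) * (\<integral>\<^sup>+ s. ennreal (min 1 s) \<partial>\<nu>)"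
    by (rule nn_integral_cmult) measurable
  also have "\<dots> < \<infinity>"
    using levy by (simp add: subordinator_levy_measure_def ennreal_mult_less_top)
  finally show ?thesis .
qed

lemma integrable_levy_indicator: "0 < r \<Longrightarrow> integrable \<nu> (indicator {r<..} :: real \<Rightarrow> real)"
  using levy_tail_finite[of r] by (simp add: integrable_indicator_iff sets_levy)

lemma levy_tail_eq: "levy_tail \<nu> r = (LINT s|\<nu>. indicator {r<..} s)"
  by (simp add: levy_tail_def sets_levy)

lemma levy_tail_nonneg: "0 \<le> levy_tail \<nu> r"
  by (simp add: levy_tail_def)

lemma levy_tail_antimono: "0 < r \<Longrightarrow> r \<le> r' \<Longrightarrow> levy_tail \<nu> r' \<le> levy_tail \<nu> r"
  unfolding levy_tail_eq
  by (intro integral_mono integrable_levy_indicator) (auto simp: indicator_def)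

lemma laplace_exponent_mono: "0 \<le> l \<Longrightarrow> l \<le> l' \<Longrightarrow> laplace_exponent \<nu> l \<le> laplace_exponent \<nu> l'"
  unfolding laplace_exponent_def
  using AE_levy_pos by (intro integral_mono_AE integrable_one_minus_exp) (auto elim!: AE_mp)

lemma laplace_exponent_0: "laplace_exponent \<nu> 0 = 0"
  by (simp add: laplace_exponent_def)

text \<open>
  A jump larger than \<open>r\<close> contributes at least \<open>1 - 1/e\<close> to the Laplace exponent at \<open>1/r\<close>.
\<close>

lemma levy_tail_le_laplace_exponent:
  assumes "0 < r"
  shows "levy_tail \<nu> r \<le> 2 * laplace_exponent \<nu> (1 / r)"
proof -
  have "levy_tail \<nu> r \<le> (LINT s|\<nu>. 2 * (1 - exp (- (1 / r) * s)))"
    unfolding levy_tail_eq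
  proof (intro integral_mono_AE integrable_levy_indicator integrable_mult_right integrable_one_minus_exp assms)
    show "AE s in \<nu>. indicator {r<..} s \<le> 2 * (1 - exp (- (1 / r) * s))"
      using AE_levy_pos
    proof eventually_elim
      case (elim s)
      then show ?case using min_one_le_one_minus_exp[of "s / r"] assms
        by (auto simp: indicator_def min_def field_simps split: if_splits)
    qed
  qed (use assms in auto)
  also have "\<dots> = 2 * laplace_exponent \<nu> (1 / r)"
    unfolding laplace_exponent_def by (rule integral_mult_right_zero)
  finally show ?thesis .
qed

lemma continuous_laplace_exponent: "continuous_on {0..} (laplace_exponent \<nu>)"
  unfolding continuous_on_sequentially
proof (intro allI ballI impI, elim conjE)
  fix x and a assume x: "\<forall>n. x n \<in> {0::real..}" and a: "a \<in> {0..}" and lim: "x \<longlonglongrightarrow> a"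
  obtain L where L: "\<And>n. \<bar>x n\<bar> \<le> L"
    using lim convergent_imp_Bseq[of x] by (auto simp: convergent_def Bseq_def)
  have L0: "0 \<le> L" using L[of 0] by linarith
  show "(laplace_exponent \<nu> \<circ> x) \<longlonglongrightarrow> laplace_exponent \<nu> a"
    unfolding laplace_exponent_def o_def
  proof (rule integral_dominated_convergence[where w = "\<lambda>s. max 1 L * min 1 \<bar>s\<bar>"])
    show "integrable \<nu> (\<lambda>s. max 1 L * min 1 \<bar>s\<bar>)"
      using integrable_min_levy by (intro integrable_mult_right)
    show "AE s in \<nu>. (\<lambda>n. 1 - exp (- x n * s)) \<longlonglongrightarrow> 1 - exp (- a * s)"
      by (intro AE_I2 tendsto_intros lim)
    show "AE s in \<nu>. norm (1 - exp (- x n * s)) \<le> max 1 L * min 1 \<bar>s\<bar>" for n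
      using AE_levy_pos
    proof eventually_elim
      case (elim s)
      have "norm (1 - exp (- x n * s)) = 1 - exp (- x n * s)" using elim x by auto
      also have "\<dots> \<le> max 1 (x n) * min 1 s" using one_minus_exp_le_min[of "x n" s] x elim by auto
      also have "\<dots> \<le> max 1 L * min 1 s" using L[of n] elim by (intro mult_right_mono) auto
      finally show ?case using elim by simp
    qed
  qed measurable
qed

context
  assumes tail_pos: "\<exists>r>0. 0 < levy_tail \<nu> r"
begin

lemma laplace_exponent_strict_mono: "strict_mono_on {0..} (laplace_exponent \<nu>)"
proof (rule strict_mono_onI)
  fix l l' :: real assume l: "l \<in> {0..}" "l' \<in> {0..}" "l < l'"
  obtain r where r: "0 < r" "0 < levy_tail \<nu> r" using tail_pos by auto
  show "laplace_exponent \<nu> l < laplace_exponent \<nu> l'"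
  proof (rule ccontr)
    let ?d = "\<lambda>s. (1 - exp (- l' * s)) - (1 - exp (- l * s))"
    assume "\<not> ?thesis"
    then have "laplace_exponent \<nu> l' - laplace_exponent \<nu> l = 0"
      using laplace_exponent_mono[of l l'] l by auto
    then have "(LINT s|\<nu>. ?d s) = 0"
      unfolding laplace_exponent_def using l
      using integrable_one_minus_exp[of l] integrable_one_minus_exp[of l']
      by (subst Bochner_Integration.integral_diff) auto
    moreover have "integrable \<nu> ?d"
      using l by (intro Bochner_Integration.integrable_diff integrable_one_minus_exp) auto
    moreover have "AE s in \<nu>. 0 \<le> ?d s"
      using AE_levy_pos by eventually_elim (use l in auto)
    ultimately have "AE s in \<nu>. ?d s = 0"
      by (simp add: integral_nonneg_eq_0_iff_AE)
    then have "AE s in \<nu>. s \<notin> {r<..}"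
      using AE_levy_pos by eventually_elim (use l in auto)
    then have "emeasure \<nu> {s \<in> space \<nu>. s \<in> {r<..}} = 0"
      by (rule emeasure_eq_0_AE)
    moreover have "{s \<in> space \<nu>. s \<in> {r<..}} = {r<..}"
      using sets_eq_imp_space_eq[OF sets_levy] by auto
    ultimately have "emeasure \<nu> {r<..} = 0" by simp
    then show False using r by (simp add: levy_tail_def measure_def)
  qed
qed

lemma laplace_exponent_pos: "0 < l \<Longrightarrow> 0 < laplace_exponent \<nu> l"
  using strict_mono_onD[OF laplace_exponent_strict_mono, of 0 l] laplace_exponent_0 by simp

lemma laplace_exponent_less_iff:
  "0 \<le> l \<Longrightarrow> 0 \<le> l' \<Longrightarrow> laplace_exponent \<nu> l < laplace_exponent \<nu> l' \<longleftrightarrow> l < l'"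
  using laplace_exponent_strict_mono
  by (auto simp: strict_mono_on_def) (metis linorder_neqE_linordered_idom order_less_asym)

text \<open>
  The Laplace exponent maps \<open>{0<..}\<close> continuously and strictly increasingly onto \<open>{0<..}\<close>, so
  \<^const>\<open>gen_inv\<close> is its true inverse and \<open>sub_time \<nu> t\<close> is the only solution \<open>u\<close> of \<open>t \<phi> (1/u) = 1\<close>.
\<close>

lemma sub_time_unique:
  assumes "0 < t" "0 < u" "t * laplace_exponent \<nu> (1 / u) = 1"
  shows "sub_time \<nu> t = u"
proof -
  have "1 / t = laplace_exponent \<nu> (1 / u)" using assms by (simp add: field_simps)
  then show ?thesis
    unfolding sub_time_def
    using gen_inv_eq_inverse[OF laplace_exponent_strict_mono, of "1/u"] assms by simp
qed

lemma sub_time: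
  assumes unbdd: "\<And>b. \<exists>l>0. b < laplace_exponent \<nu> l" and t: "0 < t"
  shows "0 < sub_time \<nu> t" "t * laplace_exponent \<nu> (1 / sub_time \<nu> t) = 1"
proof -
  obtain L where L: "0 < L" "1 / t < laplace_exponent \<nu> L" using unbdd by blast
  have "\<exists>l\<ge>0. l \<le> L \<and> laplace_exponent \<nu> l = 1 / t"
    using L t laplace_exponent_0
    by (intro IVT' continuous_on_subset[OF continuous_laplace_exponent]) auto
  then obtain l where l: "0 \<le> l" "laplace_exponent \<nu> l = 1 / t" by auto
  have "l \<noteq> 0" using l t laplace_exponent_0 by auto
  then have lp: "0 < l" using l by simp
  have "sub_time \<nu> t = 1 / l" using l lp t by (intro sub_time_unique) auto
  then show "0 < sub_time \<nu> t" "t * laplace_exponent \<nu> (1 / sub_time \<nu> t) = 1"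
    using l lp t by auto
qed

end

end

section \<open>Weak scaling of the Laplace exponent\<close>

lemma exists_dyadic_block:
  fixes r s :: real
  assumes "0 < s" "s \<le> r"
  obtains k :: nat where "r / 2 ^ Suc k < s" "s \<le> r / 2 ^ k"
proof -
  have ex: "\<exists>k::nat. r / 2 ^ Suc k < s"
  proof -
    obtain n :: nat where n: "(1 / 2) ^ n < s / r"
      using real_arch_pow_inv[of "s / r" "1 / 2"] assms by auto
    then have "r / 2 ^ n < s" using assms by (simp add: field_simps power_divide)
    moreover have "r / 2 ^ Suc n \<le> r / 2 ^ n" using assms by (intro divide_left_mono) auto
    ultimately show ?thesis by (intro exI[of _ n]) linarith
  qed
  define k where "k = (LEAST k. r / 2 ^ Suc k < s)"
  have k1: "r / 2 ^ Suc k < s" unfolding k_def using ex by (rule LeastI_ex)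
  have k2: "s \<le> r / 2 ^ k"
  proof (cases k)
    case 0
    then show ?thesis using assms by simp
  next
    case (Suc j)
    then have "\<not> r / 2 ^ Suc j < s" unfolding k_def by (intro not_less_Least) simp
    then show ?thesis using Suc by simp
  qed
  show ?thesis using that k1 k2 by blast
qed

lemma le_suminf_ennreal: "f k \<le> (\<Sum>k. f k :: ennreal)"
  using sum_le_suminf[of f "{k}"] by simp

text \<open>
  Cut the jumps below \<open>r\<close> into dyadic blocks. The block between \<open>r / 2^(k+1)\<close> and \<open>r / 2^k\<close> contributes at most
  \<open>2^-k w(r / 2^(k+1))\<close>, and the scaling of \<open>w\<close> bounds this by \<open>w(r)\<close> times a constant multiple of
  \<open>2^(- k (1 - \<beta>2))\<close>. The series converges exactly because \<open>\<beta>2 < 1\<close>.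
\<close>

lemma laplace_exponent_le_levy_tail:
  assumes levy: "subordinator_levy_measure \<nu>" and poly: "poly_tail \<nu> R1 b1 b2" and "b2 < 1"
  obtains C where "0 < C" "\<And>r. 0 < r \<Longrightarrow> ereal r < R1 \<Longrightarrow>
    0 < levy_tail \<nu> r \<and> laplace_exponent \<nu> (1 / r) \<le> C * levy_tail \<nu> r"
proof -
  note [measurable_cong] = sets_levy[OF levy]
  obtain c1 c2 where c: "0 < c1" "0 < c2"
    and tail: "\<And>r R. 0 < r \<Longrightarrow> r \<le> R \<Longrightarrow> ereal R < R1 \<Longrightarrow>
      c1 * (R / r) powr b1 \<le> levy_tail \<nu> r / levy_tail \<nu> R \<and>
      levy_tail \<nu> r / levy_tail \<nu> R \<le> c2 * (R / r) powr b2"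
    using poly unfolding poly_tail_def by metis
  define q where "q = 2 powr (b2 - 1)"
  have q: "0 < q" "q < 1" using \<open>b2 < 1\<close> by (auto simp: q_def powr_less_one)
  define a where "a = (\<lambda>k::nat. c2 * 2 powr b2 * q ^ k)"
  have suma: "summable a" unfolding a_def using q by (intro summable_mult summable_geometric) auto
  have a0: "0 \<le> a k" for k using c q by (simp add: a_def)
  show ?thesis
  proof (rule that)
    show "0 < 1 + suminf a" using suminf_nonneg[OF suma a0] by simp
  next
    fix r assume r: "0 < r" "ereal r < R1"
    let ?w = "levy_tail \<nu>"
    have "0 < c1 * (r / r) powr b1" using c r by simp
    then have "0 < ?w r / ?w r" using tail[of r r] r by (meson order_less_le_trans order_refl)
    then have wpos: "0 < ?w r" using levy_tail_nonneg[OF levy, of r] by (auto simp: less_le)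
    have blk: "(1 / 2 ^ k) * ?w (r / 2 ^ Suc k) \<le> a k * ?w r" for k
    proof -
      have "?w (r / 2 ^ Suc k) / ?w r \<le> c2 * (r / (r / 2 ^ Suc k)) powr b2"
        using tail[of "r / 2 ^ Suc k" r] r
        by (auto simp: field_simps simp del: power_Suc)
      also have "r / (r / 2 ^ Suc k) = 2 powr (real (Suc k))"
        using r by (simp only: powr_realpow[OF zero_less_numeral]) simp
      also have "(2 powr (real (Suc k))) powr b2 = 2 powr b2 * 2 powr (b2 * real k)"
        unfolding powr_powr powr_add[symmetric] by (simp add: algebra_simps)
      finally have "?w (r / 2 ^ Suc k) \<le> c2 * (2 powr b2 * 2 powr (b2 * real k)) * ?w r"
        using wpos by (simp add: field_simps)
      then have "(1 / 2 ^ k) * ?w (r / 2 ^ Suc k) \<le> (1 / 2 ^ k) * (c2 * (2 powr b2 * 2 powr (b2 * real k)) * ?w r)"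
        by (intro mult_left_mono) auto
      also have "\<dots> = a k * ?w r"
      proof -
        have "q ^ k = 2 powr (b2 * real k) / 2 ^ k"
          by (simp add: q_def powr_diff power_divide flip: powr_realpow) (simp add: powr_powr powr_realpow)
        then show ?thesis by (simp add: a_def)
      qed
      finally show ?thesis .
    qed
    have "ennreal (laplace_exponent \<nu> (1 / r)) = (\<integral>\<^sup>+ s. ennreal (1 - exp (- (1 / r) * s)) \<partial>\<nu>)"
      unfolding laplace_exponent_def
    proof (rule nn_integral_eq_integral[symmetric])
      show "integrable \<nu> (\<lambda>s. 1 - exp (- (1 / r) * s))"
        using integrable_one_minus_exp[OF levy, of "1/r"] r by simp
      show "AE s in \<nu>. 0 \<le> 1 - exp (- (1 / r) * s)"
        using AE_levy_pos[OF levy] by eventually_elim (use r in auto)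
    qed
    also have "\<dots> \<le> (\<integral>\<^sup>+ s. indicator {r<..} s +
        (\<Sum>k. ennreal (1 / 2 ^ k) * indicator {r / 2 ^ Suc k<..} s) \<partial>\<nu>)"
    proof (rule nn_integral_mono_AE)
      show "AE s in \<nu>. ennreal (1 - exp (- (1 / r) * s)) \<le> indicator {r<..} s +
        (\<Sum>k. ennreal (1 / 2 ^ k) * indicator {r / 2 ^ Suc k<..} s)"
        using AE_levy_pos[OF levy]
      proof eventually_elim
        case (elim s)
        show ?case
        proof (cases "r < s")
          case True
          have "ennreal (1 - exp (- (1 / r) * s)) \<le> 1" by (simp add: ennreal_le_1)
          then show ?thesis using True by (simp add: add_increasing2)
        next
          case False
          then obtain k where k: "r / 2 ^ Suc k < s" "s \<le> r / 2 ^ k"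
            using exists_dyadic_block[of s r] elim by auto
          have "1 - exp (- (1 / r) * s) \<le> s / r"
            using exp_ge_add_one_self[of "- (1 / r) * s"] by simp
          also have "\<dots> \<le> 1 / 2 ^ k" using k r by (simp add: field_simps)
          finally have "ennreal (1 - exp (- (1 / r) * s)) \<le>
              ennreal (1 / 2 ^ k) * indicator {r / 2 ^ Suc k<..} s"
            using k by (simp add: ennreal_leI del: power_Suc)
          also have "\<dots> \<le> (\<Sum>k. ennreal (1 / 2 ^ k) * indicator {r / 2 ^ Suc k<..} s)"
            by (rule le_suminf_ennreal)
          finally show ?thesis by (simp add: add_increasing)
        qed
      qed
    qed
    also have "\<dots> = (\<integral>\<^sup>+ s. indicator {r<..} s \<partial>\<nu>) +
        (\<Sum>k. (\<integral>\<^sup>+ s. ennreal (1 / 2 ^ k) * indicator {r / 2 ^ Suc k<..} s \<partial>\<nu>))"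
    proof -
      have "(indicator {u<..} :: real \<Rightarrow> ennreal) \<in> borel_measurable \<nu>" for u
        by (intro borel_measurable_indicator) (simp add: sets_levy[OF levy])
      then show ?thesis
        by (subst nn_integral_add)
          (auto intro!: nn_integral_suminf borel_measurable_suminf_order borel_measurable_times_ennreal)
    qed
    also have "\<dots> = ennreal (?w r) + (\<Sum>k. ennreal ((1 / 2 ^ k) * ?w (r / 2 ^ Suc k)))"
    proof -
      have em: "emeasure \<nu> {u<..} = ennreal (?w u)" if "0 < u" for u
        using levy_tail_finite[OF levy that] by (simp add: levy_tail_def emeasure_eq_ennreal_measure)
      show ?thesis
        using r
        by (subst nn_integral_cmult_indicator)
          (simp_all add: em sets_levy[OF levy] ennreal_mult[symmetric] levy_tail_nonneg[OF levy] del: power_Suc)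
    qed
    also have "\<dots> \<le> ennreal (?w r) + (\<Sum>k. ennreal (a k * ?w r))"
      by (intro add_left_mono suminf_le ennreal_leI blk) auto
    also have "\<dots> = ennreal (?w r + suminf a * ?w r)"
      using suma a0 wpos
      by (subst suminf_ennreal2) (auto intro!: summable_mult2 simp: suminf_mult2[symmetric] ennreal_plus suminf_nonneg)
    finally have "laplace_exponent \<nu> (1 / r) \<le> ?w r + suminf a * ?w r"
      using suminf_nonneg[OF suma a0] wpos by (subst (asm) ennreal_le_iff) auto
    then show "0 < ?w r \<and> laplace_exponent \<nu> (1 / r) \<le> (1 + suminf a) * ?w r"
      using wpos by (simp add: algebra_simps)
  qed
qed

text \<open>
  Meant for decreasing \<open>g\<close>: passing from the time \<open>u\<close> down to \<open>v\<close>, the value grows at least like the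
  power \<open>d1\<close> and at most like the power \<open>d2\<close> of \<open>u / v\<close>.
\<close>

definition weak_scaling :: "real set \<Rightarrow> (real \<Rightarrow> real) \<Rightarrow> real \<Rightarrow> real \<Rightarrow> bool" where
  "weak_scaling J g d1 d2 \<longleftrightarrow> (\<exists>c>0. \<exists>C>0. \<forall>u\<in>J. \<forall>v. 0 < v \<and> v \<le> u \<longrightarrow>
     c * (u / v) powr d1 * g u \<le> g v \<and> g v \<le> C * (u / v) powr d2 * g u)"

lemma weak_scalingI:
  assumes "0 < c" "0 < C"
    and "\<And>u v. u \<in> J \<Longrightarrow> 0 < v \<Longrightarrow> v \<le> u \<Longrightarrow> c * (u / v) powr d1 * g u \<le> g v"
    and "\<And>u v. u \<in> J \<Longrightarrow> 0 < v \<Longrightarrow> v \<le> u \<Longrightarrow> g v \<le> C * (u / v) powr d2 * g u"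
  shows "weak_scaling J g d1 d2"
  using assms unfolding weak_scaling_def by (intro exI[of _ c] exI[of _ C]) blast

lemma weak_scaling_subset: "weak_scaling J g d1 d2 \<Longrightarrow> K \<subseteq> J \<Longrightarrow> weak_scaling K g d1 d2"
  unfolding weak_scaling_def by (meson subsetD)

text \<open>
  On the compact range between \<open>R\<close> and \<open>A\<close> the function and the powers are bounded above and away from 0,
  so extending the range only changes the constants. This is needed because \<open>w\<close> scales only below
  \<open>R1\<close>, while \<open>sub_time \<nu> T\<close> may lie beyond.
\<close>

lemma weak_scaling_extend:
  fixes g :: "real \<Rightarrow> real"
  assumes sc: "weak_scaling {0<..R} g d1 d2" and R: "0 < R" and d: "0 \<le> d1" "0 \<le> d2"
    and pos: "\<And>u. 0 < u \<Longrightarrow> 0 < g u" and anti: "\<And>u v. 0 < v \<Longrightarrow> v \<le> u \<Longrightarrow> g u \<le> g v"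
  shows "weak_scaling {0<..A} g d1 d2"
proof (cases "A \<le> R")
  case True
  then show ?thesis by (intro weak_scaling_subset[OF sc]) auto
next
  case False
  then have RA: "R < A" by simp
  obtain c C where c: "0 < c" "0 < C" and
    g: "\<And>u v. u \<in> {0<..R} \<Longrightarrow> 0 < v \<Longrightarrow> v \<le> u \<Longrightarrow>
        c * (u / v) powr d1 * g u \<le> g v \<and> g v \<le> C * (u / v) powr d2 * g u"
    using sc unfolding weak_scaling_def by metis
  define q where "q = (A / R) powr d1"
  define k where "k = g R / g A"
  have q: "1 \<le> q" unfolding q_def using RA R d by (intro ge_one_powr_ge_zero) (auto simp: field_simps)
  have k: "1 \<le> k" unfolding k_def using pos[of A] anti[of R A] RA R by (simp add: field_simps)
  have gA: "0 < g A" "0 < g R" using pos RA R by auto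
  show ?thesis
  proof (rule weak_scalingI[of "min c 1 / q" "max C 1 * k"], goal_cases)
    case 1 then show ?case using c q by simp
  next
    case 2 then show ?case using c k by simp
  next
    case (3 u v)
    then have u: "0 < u" "u \<le> A" and v: "0 < v" "v \<le> u" by auto
    note gp = pos[OF u(1)] pos[OF v(1)]
    have hm: "min c 1 / q \<le> c" "min c 1 / q * q = min c 1"
      using c q by (auto simp: field_simps min_def mult_le_cancel_left1 intro: order_trans[OF _ mult_left_mono[OF q]])
    show ?case
    proof (cases "u \<le> R")
      case True
      have "min c 1 / q * (u / v) powr d1 * g u \<le> c * (u / v) powr d1 * g u"
        using hm gp by (intro mult_right_mono) auto
      also have "\<dots> \<le> g v" using g[of u v] True u v by auto
      finally show ?thesis .
    next
      case uR: False
      show ?thesis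
      proof (cases "v \<le> R")
        case True
        have "(u / v) powr d1 \<le> ((A / R) * (R / v)) powr d1"
          using u v R d by (intro powr_mono2) (auto simp: field_simps)
        also have "\<dots> = q * (R / v) powr d1" unfolding q_def using R RA v by (subst powr_mult) auto
        finally have "min c 1 / q * (u / v) powr d1 * g u \<le> min c 1 / q * (q * (R / v) powr d1) * g R"
          using c q gp anti[of R u] uR R by (intro mult_mono mult_left_mono) auto
        also have "\<dots> \<le> c * (R / v) powr d1 * g R"
          using q gA by (intro mult_right_mono) (auto simp: field_simps min_def mult_left_mono mult_le_cancel_right1)
        also have "\<dots> \<le> g v" using g[of R v] True R v by auto
        finally show ?thesis .
      next
        case False
        have "(u / v) powr d1 \<le> q"
          unfolding q_def using u v R d False
          by (intro powr_mono2 frac_le) auto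
        then have "min c 1 / q * (u / v) powr d1 * g u \<le> min c 1 / q * q * g v"
          using c q gp anti[of v u] v by (intro mult_mono mult_left_mono) auto
        also have "\<dots> \<le> g v" using q gp by (simp add: mult_le_cancel_right1)
        finally show ?thesis .
      qed
    qed
  next
    case (4 u v)
    then have u: "0 < u" "u \<le> A" and v: "0 < v" "v \<le> u" by auto
    note gp = pos[OF u(1)] pos[OF v(1)]
    have p1: "1 \<le> (u / v) powr d2" using u v d by (intro ge_one_powr_ge_zero) (auto simp: field_simps)
    have gR: "g R \<le> k * g u"
      using anti[of u A] u gA by (simp add: k_def field_simps mult_left_mono)
    show ?case
    proof (cases "u \<le> R")
      case True
      have "g v \<le> C * (u / v) powr d2 * g u" using g[of u v] True u v by auto
      also have "\<dots> \<le> (max C 1 * k) * (u / v) powr d2 * g u"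
        using gp k c by (intro mult_right_mono order_trans[OF max.cobounded1[of C 1]]) (auto simp: mult_le_cancel_left1)
      finally show ?thesis .
    next
      case uR: False
      show ?thesis
      proof (cases "v \<le> R")
        case True
        have "g v \<le> C * (R / v) powr d2 * g R" using g[of R v] True R v by auto
        also have "\<dots> \<le> max C 1 * (u / v) powr d2 * (k * g u)"
          using gR uR v d R c gA by (intro mult_mono powr_mono2) (auto simp: field_simps)
        finally show ?thesis by (simp add: mult_ac)
      next
        case False
        have "g v \<le> g R" using anti[of R v] False R by simp
        also have "\<dots> \<le> k * g u" by (rule gR)
        also have "\<dots> \<le> (max C 1 * (u / v) powr d2) * (k * g u)"
          using k gp p1 mult_mono[of 1 "max C 1" 1 "(u / v) powr d2"]
            mult_right_mono[of 1 "max C 1 * (u / v) powr d2" "k * g u"] by simp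
        finally show ?thesis by (simp add: mult_ac)
      qed
    qed
  qed
qed

text \<open>
  Below \<open>R1\<close> the Laplace exponent at \<open>1/r\<close> is comparable with \<open>w(r)\<close> and inherits its scaling. Beyond a
  finite \<open>R1\<close> the tail may vanish, but the Laplace exponent remains positive and monotone.
\<close>

lemma weak_scaling_laplace_exponent:
  assumes levy: "subordinator_levy_measure \<nu>" and poly: "poly_tail \<nu> R1 b1 b2" and b2: "b2 < 1"
    and R1: "0 < R1" and J: "R1 = \<infinity> \<and> J = {0<..} \<or> J = {0<..A}"
  shows "weak_scaling J (\<lambda>u. laplace_exponent \<nu> (1 / u)) b1 b2"
proof -
  let ?w = "levy_tail \<nu>" and ?g = "\<lambda>u. laplace_exponent \<nu> (1 / u)"
  have b: "0 < b1" "b1 \<le> b2" using poly by (auto simp: poly_tail_def)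
  obtain c1 c2 where c: "0 < c1" "0 < c2"
    and tail: "\<And>r R. 0 < r \<Longrightarrow> r \<le> R \<Longrightarrow> ereal R < R1 \<Longrightarrow>
      c1 * (R / r) powr b1 \<le> ?w r / ?w R \<and>
      ?w r / ?w R \<le> c2 * (R / r) powr b2"
    using poly unfolding poly_tail_def by metis
  obtain K where K: "0 < K" "\<And>r. 0 < r \<Longrightarrow> ereal r < R1 \<Longrightarrow>
    0 < ?w r \<and> ?g r \<le> K * ?w r"
    using laplace_exponent_le_levy_tail[OF levy poly b2] by metis
  have low: "?w r \<le> 2 * ?g r" if "0 < r" for r
    using levy_tail_le_laplace_exponent[OF levy that] .
  have main: "weak_scaling {u. 0 < u \<and> ereal u < R1} ?g b1 b2"
  proof (rule weak_scalingI[of "c1 / (2 * K)" "2 * c2 * K"], goal_cases)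
    case (3 u v)
    then have uv: "0 < u" "ereal u < R1" "0 < v" "v \<le> u" by auto
    have "c1 / (2 * K) * (u / v) powr b1 * ?g u \<le> c1 / (2 * K) * (u / v) powr b1 * (K * ?w u)"
      using K(2)[OF uv(1,2)] c K(1) by (intro mult_left_mono) auto
    also have "\<dots> = (c1 * (u / v) powr b1) * ?w u / 2" using K by simp
    also have "\<dots> \<le> (?w v / ?w u) * ?w u / 2"
      using tail[OF uv(3,4,2)] K(2)[OF uv(1,2)] by (intro divide_right_mono mult_right_mono) simp_all
    also have "\<dots> = ?w v / 2" using K(2)[OF uv(1,2)] by simp
    also have "\<dots> \<le> ?g v" using low[OF uv(3)] by simp
    finally show ?case .
  next
    case (4 u v)
    then have uv: "0 < u" "ereal u < R1" "0 < v" "v \<le> u" by auto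
    have vR: "ereal v < R1" using uv by (cases R1) auto
    have "?g v \<le> K * ?w v" using K(2)[OF uv(3) vR] by simp
    also have "\<dots> = K * (?w v / ?w u * ?w u)" using K(2)[OF uv(1,2)] by simp
    also have "\<dots> \<le> K * (c2 * (u / v) powr b2 * (2 * ?g u))"
      using tail[OF uv(3,4,2)] K(1) K(2)[OF uv(1,2)] low[OF uv(1)] c
      by (intro mult_left_mono mult_mono) simp_all
    finally show ?case by (simp add: mult_ac)
  qed (use c K in auto)
  obtain r0 where r0: "0 < r0" "ereal r0 < R1"
    using ereal_dense2[OF R1] by auto
  have tp: "\<exists>r>0. 0 < ?w r" using K(2)[OF r0] r0 by auto
  show ?thesis
  proof (cases "R1 = \<infinity> \<and> J = {0<..}")
    case True
    then show ?thesis using main by (auto elim: weak_scaling_subset)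
  next
    case False
    then have J: "J = {0<..A}" using J by blast
    have "weak_scaling {0<..r0} ?g b1 b2"
      using r0 by (intro weak_scaling_subset[OF main]) (cases R1; auto)
    then show ?thesis
      unfolding J
    proof (rule weak_scaling_extend)
      show "0 < ?g u" if "0 < u" for u using laplace_exponent_pos[OF levy tp] that by simp
      show "?g u \<le> ?g v" if "0 < v" "v \<le> u" for u v
        using that by (intro laplace_exponent_mono[OF levy] frac_le) auto
    qed (use r0 b in auto)
  qed
qed

lemma laplace_exponent_unbounded:
  assumes levy: "subordinator_levy_measure \<nu>" and poly: "poly_tail \<nu> R1 b1 b2" and b2: "b2 < 1"
    and R1: "0 < R1"
  shows "\<exists>l>0. b < laplace_exponent \<nu> l"
proof -
  obtain c C where c: "0 < c" and
    g: "\<And>u v. u \<in> {0<..1} \<Longrightarrow> 0 < v \<Longrightarrow> v \<le> u \<Longrightarrow>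
        c * (u / v) powr b1 * laplace_exponent \<nu> (1 / u) \<le> laplace_exponent \<nu> (1 / v)"
    using weak_scaling_laplace_exponent[OF assms, of "{0<..1}" 1] unfolding weak_scaling_def by metis
  have b1: "0 < b1" using poly by (simp add: poly_tail_def)
  obtain r0 where r0: "0 < r0" "ereal r0 < R1"
    using ereal_dense2[OF R1] by auto
  have tp: "\<exists>r>0. 0 < levy_tail \<nu> r"
    using laplace_exponent_le_levy_tail[OF levy poly b2] r0 by (meson order.strict_trans)
  define k where "k = c * laplace_exponent \<nu> 1"
  have k: "0 < k" unfolding k_def using c laplace_exponent_pos[OF levy tp, of 1] by simp
  define l where "l = max 1 (((\<bar>b\<bar> + 1) / k) powr (1 / b1))"
  have "(\<bar>b\<bar> + 1) / k = (((\<bar>b\<bar> + 1) / k) powr (1 / b1)) powr b1"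
    using k b1 by (simp add: powr_powr)
  also have "\<dots> \<le> l powr b1" using b1 by (intro powr_mono2) (auto simp: l_def)
  finally have "\<bar>b\<bar> + 1 \<le> k * l powr b1" using k by (simp add: field_simps)
  then have l: "1 \<le> l" "b < k * l powr b1" by (auto simp: l_def)
  have "k * l powr b1 \<le> laplace_exponent \<nu> l"
    using g[of 1 "1 / l"] l by (simp add: k_def mult_ac)
  then show ?thesis using l by (intro exI[of _ l]) auto
qed

section \<open>Laws of a subordinator\<close>

lemma additive_mono_imp_linear:
  fixes G :: "real \<Rightarrow> real"
  assumes add: "\<And>s t. 0 \<le> s \<Longrightarrow> 0 \<le> t \<Longrightarrow> G (s + t) = G s + G t"
    and mono: "\<And>s t. 0 \<le> s \<Longrightarrow> s \<le> t \<Longrightarrow> G s \<le> G t" and t: "0 \<le> t"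
  shows "G t = t * G 1"
proof -
  have mult: "G (real n * s) = real n * G s" if "0 \<le> s" for n s
  proof (induction n)
    case 0
    then show ?case using add[of 0 0] by simp
  next
    case (Suc n)
    then show ?case using add[of "real n * s" s] that by (simp add: algebra_simps)
  qed
  have nat: "G (real n) = real n * G 1" for n using mult[of 1 n] by simp
  have G1: "0 \<le> G 1" using mono[of 0 1] nat[of 0] by simp
  have bd: "real n * \<bar>G t - t * G 1\<bar> \<le> G 1" for n
  proof -
    \<comment> \<open>\<open>G (n t)\<close> lies between \<open>G k\<close> and \<open>G (k + 1)\<close>, so \<open>n (G t - t G 1)\<close> is bounded in \<open>n\<close>\<close>
    define k where "k = nat \<lfloor>real n * t\<rfloor>"
    have k: "real k \<le> real n * t" "real n * t \<le> real (Suc k)"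
      using t unfolding k_def by (simp_all add: of_nat_nat) linarith?
    have "real k * G 1 \<le> real n * G t" using mono[of "real k" "real n * t"] k nat[of k] mult[OF t] by simp
    moreover have "real n * G t \<le> real (Suc k) * G 1"
      using mono[of "real n * t" "real (Suc k)"] k nat[of "Suc k"] mult[OF t, of n] t by simp
    moreover have "real k * G 1 \<le> real n * t * G 1" "real n * t * G 1 \<le> real (Suc k) * G 1"
      using k G1 by (intro mult_right_mono; simp)+
    ultimately have "\<bar>real n * G t - real n * t * G 1\<bar> \<le> G 1"
      by (simp add: algebra_simps abs_le_iff)
    also have "\<bar>real n * G t - real n * t * G 1\<bar> = real n * \<bar>G t - t * G 1\<bar>"
      by (simp add: mult.assoc flip: right_diff_distrib add: abs_mult)
    finally show ?thesis .
  qed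
  have "\<bar>G t - t * G 1\<bar> \<le> 0"
  proof (rule ccontr)
    assume "\<not> ?thesis"
    then obtain n where "G 1 < real n * \<bar>G t - t * G 1\<bar>"
      using reals_Archimedean3[of "\<bar>G t - t * G 1\<bar>"] by auto
    then show False using bd[of n] by simp
  qed
  then show ?thesis by simp
qed

text \<open>
  All that is used about the subordinator: the Laplace transforms of its one-dimensional laws, and one
  trace of the independence of increments. Constants in later estimates may depend on \<open>\<phi>\<close> but not on the
  family \<open>\<mu>\<close>, because the law is taken under a different probability measure for each starting point.
\<close>

definition subordinator_laws :: "(real \<Rightarrow> real) \<Rightarrow> (real \<Rightarrow> real measure) \<Rightarrow> bool" where
  "subordinator_laws \<phi> \<mu> \<longleftrightarrow>
    (\<forall>t>0. prob_space (\<mu> t) \<and> sets (\<mu> t) = sets borel \<and> (AE s in \<mu> t. 0 \<le> s) \<and>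
      (\<forall>l>0. (LINT s|\<mu> t. exp (- l * s)) = exp (- (t * \<phi> l)))) \<and>
    (\<forall>a>0. \<forall>b>0. \<forall>r r'. measure (\<mu> a) {..r} * measure (\<mu> b) {..r'} \<le> measure (\<mu> (a + b)) {..r + r'})"

text \<open>
  Stationary independent increments make the Laplace transform at \<open>t\<close> multiplicative in \<open>t\<close>, and monotone paths
  make it monotone. Hence its logarithm is linear, and the value at \<open>t = 1\<close> is given.
\<close>

lemma driftless_subordinator_laws:
  assumes "driftless_subordinator N \<nu> S"
  shows "subordinator_laws (laplace_exponent \<nu>) (\<lambda>t. distr N borel (S t))"
proof -
  note dr = assms[unfolded driftless_subordinator_def]
  interpret prob_space N by (rule dr[THEN conjunct1])
  have [measurable]: "0 \<le> t \<Longrightarrow> S t \<in> borel_measurable N" for t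
    by (rule dr[THEN conjunct2, THEN conjunct2, THEN conjunct1, rule_format])
  have path: "AE \<omega> in N. S 0 \<omega> = 0 \<and> (\<forall>s t. 0 \<le> s \<and> s \<le> t \<longrightarrow> S s \<omega> \<le> S t \<omega>)"
  proof -
    have "AE \<omega> in N. S 0 \<omega> = 0 \<and> (\<forall>s t. 0 \<le> s \<and> s \<le> t \<longrightarrow> S s \<omega> \<le> S t \<omega>) \<and>
      (\<forall>t\<ge>0. continuous (at_right t) (\<lambda>s. S s \<omega>))"
      by (rule dr[THEN conjunct2, THEN conjunct2, THEN conjunct2, THEN conjunct1])
    then show ?thesis by eventually_elim simp
  qed
  have pos: "AE \<omega> in N. 0 \<le> S t \<omega>" if "0 \<le> t" for t
    using path by eventually_elim (use that in force)
  have stat: "distr N borel (\<lambda>\<omega>. S (a + b) \<omega> - S a \<omega>) = distr N borel (S b)" if "0 \<le> a" "0 \<le> b" for a b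
  proof -
    have "\<forall>s t. 0 \<le> s \<and> s \<le> t \<longrightarrow>
      distr N borel (\<lambda>\<omega>. S t \<omega> - S s \<omega>) = distr N borel (S (t - s))"
      by (rule dr[THEN conjunct2, THEN conjunct2, THEN conjunct2, THEN conjunct2, THEN conjunct2, THEN conjunct1])
    from this[rule_format, of a "a + b"] show ?thesis using that by simp
  qed
  have stat0: "distr N borel (\<lambda>\<omega>. S a \<omega> - S 0 \<omega>) = distr N borel (S a)" if "0 \<le> a" for a
    using stat[of 0 a] that by simp
  \<comment> \<open>the increments over \<open>[0, a]\<close> and \<open>[a, a + b]\<close>\<close>
  define X where "X = (\<lambda>a b (i::nat) \<omega>. if i = 0 then S a \<omega> - S 0 \<omega> else S (a + b) \<omega> - S a \<omega>)"
  have indep: "indep_vars (\<lambda>_. borel) (X a b) {..<2}" if "0 \<le> a" "0 \<le> b" for a b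
  proof -
    define t where "t = (\<lambda>i::nat. if i = 0 then 0 else if i = 1 then a else a + b)"
    have "incseq t" "0 \<le> t 0" using that by (auto simp: t_def incseq_def)
    then have "indep_vars (\<lambda>_. borel) (\<lambda>i \<omega>. S (t (Suc i)) \<omega> - S (t i) \<omega>) {..<2}"
      by (intro dr[THEN conjunct2, THEN conjunct2, THEN conjunct2, THEN conjunct2, THEN conjunct1, rule_format] conjI)
    then show ?thesis
      by (rule indep_vars_cong[THEN iffD1, rotated -1]) (auto simp: t_def X_def fun_eq_iff)
  qed
  have X_meas [measurable]: "X a b i \<in> borel_measurable N" if "0 \<le> a" "0 \<le> b" for a b i
    using that unfolding X_def by (cases "i = 0") auto
  have X_pos: "AE \<omega> in N. 0 \<le> X a b i \<omega>" if "0 \<le> a" "0 \<le> b" for a b i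
    using path
  proof eventually_elim
    case (elim \<omega>)
    note m = elim[THEN conjunct2, rule_format]
    have "S 0 \<omega> \<le> S a \<omega>" by (rule m) (use that in simp)
    moreover have "S a \<omega> \<le> S (a + b) \<omega>" by (rule m) (use that in simp)
    ultimately show ?case by (simp add: X_def)
  qed
  have X_0: "X a b 0 = (\<lambda>\<omega>. S a \<omega> - S 0 \<omega>)" for a b
    by (simp add: X_def)
  have X_1: "X a b (Suc 0) = (\<lambda>\<omega>. S (a + b) \<omega> - S a \<omega>)" for a b
    by (simp add: X_def)
  have distr_0: "distr N borel (X a b 0) = distr N borel (S a)" if "0 \<le> a" for a b
    unfolding X_0 using that by (rule stat0)
  have distr_1: "distr N borel (X a b (Suc 0)) = distr N borel (S b)" if "0 \<le> a" "0 \<le> b" for a b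
    unfolding X_1 using that by (rule stat)
  define f where "f = (\<lambda>l t. LINT \<omega>|N. exp (- l * S t \<omega>))"
  have intS: "integrable N (\<lambda>\<omega>. exp (- l * Z \<omega>))"
    if "0 \<le> l" "Z \<in> borel_measurable N" "AE \<omega> in N. 0 \<le> Z \<omega>" for l and Z :: "_ \<Rightarrow> real"
  proof (rule integrable_const_bound[where B = 1])
    show "AE \<omega> in N. norm (exp (- l * Z \<omega>)) \<le> 1"
      using that(3) by eventually_elim (use that(1) in simp)
  qed (use that(2) in measurable)
  have mult: "f l (a + b) = f l a * f l b" if "0 \<le> l" "0 \<le> a" "0 \<le> b" for l a b
  proof -
    have [measurable]: "S a \<in> borel_measurable N" "S b \<in> borel_measurable N"
      "S (a + b) \<in> borel_measurable N" "X a b i \<in> borel_measurable N" for i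
      using that X_meas by simp_all
    have "f l (a + b) = (LINT \<omega>|N. (\<Prod>i\<in>{..<2}. exp (- l * X a b i \<omega>)))"
      unfolding f_def
    proof (rule integral_cong_AE)
      show "AE \<omega> in N. exp (- l * S (a + b) \<omega>) = (\<Prod>i\<in>{..<2}. exp (- l * X a b i \<omega>))"
        using path by eventually_elim
          (simp add: numeral_2_eq_2 X_def exp_add[symmetric] algebra_simps)
    qed measurable
    also have "\<dots> = (\<Prod>i\<in>{..<2}. LINT \<omega>|N. exp (- l * X a b i \<omega>))"
    proof (rule indep_vars_lebesgue_integral)
      show "indep_vars (\<lambda>_. borel) (\<lambda>i \<omega>. exp (- l * X a b i \<omega>)) {..<2}"
        using indep[OF that(2,3)] by (rule indep_vars_compose2) measurable
      show "integrable N (\<lambda>\<omega>. exp (- l * X a b i \<omega>))" for i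
        using that(1) _ X_pos[OF that(2,3)] by (rule intS) measurable
    qed simp
    also have "\<dots> = (LINT s|distr N borel (X a b 0). exp (- l * s)) * (LINT s|distr N borel (X a b (Suc 0)). exp (- l * s))"
      by (simp add: numeral_2_eq_2 integral_distr)
    also have "\<dots> = f l a * f l b"
      using that by (simp add: distr_0 distr_1 f_def integral_distr)
    finally show ?thesis .
  qed
  have fpos: "0 < f l t" if "0 \<le> l" "0 \<le> t" for l t
  proof -
    have int: "integrable N (\<lambda>\<omega>. exp (- l * S t \<omega>))"
      using that(1) _ pos[OF that(2)] by (rule intS) (use that in simp)
    have "f l t \<noteq> 0"
      unfolding f_def integral_nonneg_eq_0_iff_AE[OF int AE_I2[OF exp_ge_zero]] by simp
    moreover have "0 \<le> f l t" by (simp add: f_def)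
    ultimately show ?thesis by simp
  qed
  have fanti: "f l t \<le> f l s" if "0 \<le> l" "0 \<le> s" "s \<le> t" for l s t
    unfolding f_def
  proof (rule integral_mono_AE)
    show "AE \<omega> in N. exp (- l * S t \<omega>) \<le> exp (- l * S s \<omega>)"
      using path
    proof eventually_elim
      case (elim \<omega>)
      have "S s \<omega> \<le> S t \<omega>" by (rule elim[THEN conjunct2, rule_format]) (use that in simp)
      then show ?case using that(1) by (simp add: mult_left_mono)
    qed
    show "integrable N (\<lambda>\<omega>. exp (- l * S t \<omega>))" "integrable N (\<lambda>\<omega>. exp (- l * S s \<omega>))"
      using that by (intro intS pos; simp)+
  qed
  have laplace: "f l t = exp (- (t * laplace_exponent \<nu> l))" if "0 < l" "0 \<le> t" for l t
  proof -
    have "- ln (f l t) = t * (- ln (f l 1))"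
    proof (rule additive_mono_imp_linear)
      show "- ln (f l (s + t)) = - ln (f l s) + - ln (f l t)" if "0 \<le> s" "0 \<le> t" for s t
        using that \<open>0 < l\<close> by (simp add: mult ln_mult_pos fpos)
      show "- ln (f l s) \<le> - ln (f l t)" if "0 \<le> s" "s \<le> t" for s t
        using that \<open>0 < l\<close> fanti[of l s t] fpos[of l s] fpos[of l t] by simp
    qed fact
    also have "- ln (f l 1) = laplace_exponent \<nu> l"
      unfolding f_def using that
      by (intro dr[THEN conjunct2, THEN conjunct2, THEN conjunct2, THEN conjunct2, THEN conjunct2, THEN conjunct2, rule_format]) simp
    finally have "ln (f l t) = - (t * laplace_exponent \<nu> l)" by simp
    then show ?thesis using fpos[of l t] that by (metis exp_ln less_imp_le)
  qed
  have super: "measure (distr N borel (S a)) {..r} * measure (distr N borel (S b)) {..r'}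
      \<le> measure (distr N borel (S (a + b))) {..r + r'}" if "0 < a" "0 < b" for a b r r'
  proof -
    have ab: "0 \<le> a" "0 \<le> b" using that by auto
    have [measurable]: "S (a + b) \<in> borel_measurable N" using ab by simp
    define A where "A = (\<lambda>i::nat. if i = 0 then {..r} else {..r'})"
    have "measure (distr N borel (S a)) {..r} * measure (distr N borel (S b)) {..r'} =
      measure (distr N borel (X a b 0)) {..r} * measure (distr N borel (X a b (Suc 0))) {..r'}"
      using distr_0[OF ab(1), of b] distr_1[OF ab] by simp
    also have "\<dots> = (\<Prod>i\<in>{..<2}. prob (X a b i -` A i \<inter> space N))"
      using ab by (simp add: numeral_2_eq_2 A_def measure_distr X_meas)
    also have "\<dots> = prob (\<Inter>i\<in>{..<2}. X a b i -` A i \<inter> space N)"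
      using indep[OF ab] by (intro indep_varsD[symmetric]) (auto simp: A_def lessThan_nat_numeral)
    also have "\<dots> \<le> prob (S (a + b) -` {..r + r'} \<inter> space N)"
    proof (rule finite_measure_mono_AE)
      show "AE \<omega> in N. \<omega> \<in> (\<Inter>i\<in>{..<2}. X a b i -` A i \<inter> space N) \<longrightarrow> \<omega> \<in> S (a + b) -` {..r + r'} \<inter> space N"
        using path by eventually_elim (auto simp: numeral_2_eq_2 lessThan_Suc X_def A_def)
    qed simp
    also have "\<dots> = measure (distr N borel (S (a + b))) {..r + r'}"
      by (simp add: measure_distr)
    finally show ?thesis .
  qed
  have law: "prob_space (distr N borel (S t)) \<and> sets (distr N borel (S t)) = sets borel \<and>
      (AE s in distr N borel (S t). 0 \<le> s) \<and>
      (\<forall>l>0. (LINT s|distr N borel (S t). exp (- l * s)) = exp (- (t * laplace_exponent \<nu> l)))"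
    if "0 < t" for t
  proof (intro conjI allI impI)
    have [measurable]: "S t \<in> borel_measurable N" using that by simp
    show "prob_space (distr N borel (S t))" by (intro prob_space_distr) measurable
    show "AE s in distr N borel (S t). 0 \<le> s"
      using pos[of t] that by (subst AE_distr_iff) simp_all
    show "(LINT s|distr N borel (S t). exp (- l * s)) = exp (- (t * laplace_exponent \<nu> l))"
      if "0 < l" for l
    proof -
      have "(LINT s|distr N borel (S t). exp (- l * s)) = f l t"
        unfolding f_def by (rule integral_distr) measurable
      then show ?thesis using laplace[of l t] that \<open>0 < t\<close> by simp
    qed
  qed simp
  show ?thesis
    unfolding subordinator_laws_def using law super by blast
qed

section \<open>Tails and moments of the laws\<close>

context
  fixes \<phi> :: "real \<Rightarrow> real" and \<mu> :: "real \<Rightarrow> real measure" and t :: real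
  assumes laws: "subordinator_laws \<phi> \<mu>" and t: "0 < t"
begin

lemma sets_law: "sets (\<mu> t) = sets borel"
  using laws t by (simp add: subordinator_laws_def)

lemma prob_space_law: "prob_space (\<mu> t)"
  using laws t by (simp add: subordinator_laws_def)

lemma AE_law_nonneg: "AE s in \<mu> t. 0 \<le> s"
  using laws t by (simp add: subordinator_laws_def)

lemma law_laplace: "0 < l \<Longrightarrow> (LINT s|\<mu> t. exp (- l * s)) = exp (- (t * \<phi> l))"
  using laws t by (simp only: subordinator_laws_def)

lemma integrable_law_exp: "0 < l \<Longrightarrow> integrable (\<mu> t) (\<lambda>s. exp (- l * s))"
proof -
  assume l: "0 < l"
  interpret prob_space "\<mu> t" by (rule prob_space_law)
  show ?thesis
  proof (rule integrable_const_bound[where B = 1])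
    show "AE s in \<mu> t. norm (exp (- l * s)) \<le> 1"
      using AE_law_nonneg by eventually_elim (use l in simp)
    show "(\<lambda>s. exp (- l * s)) \<in> borel_measurable (\<mu> t)"
      by (subst measurable_cong_sets[OF sets_law refl]) measurable
  qed
qed

lemma integrable_law_indicator: "A \<in> sets borel \<Longrightarrow> integrable (\<mu> t) (indicator A :: real \<Rightarrow> real)"
proof -
  assume A: "A \<in> sets borel"
  interpret prob_space "\<mu> t" by (rule prob_space_law)
  show ?thesis
    using A by (simp add: integrable_indicator_iff sets_law less_top[symmetric] emeasure_eq_measure)
qed

lemma law_measure_eq: "A \<in> sets borel \<Longrightarrow> measure (\<mu> t) A = (LINT s|\<mu> t. indicator A s)"
  using sets_law by simp

lemma integrable_law_one_minus_exp: "0 < l \<Longrightarrow> integrable (\<mu> t) (\<lambda>s. 1 - exp (- l * s))"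
proof -
  assume l: "0 < l"
  interpret prob_space "\<mu> t" by (rule prob_space_law)
  show ?thesis using integrable_law_exp[OF l] by (intro Bochner_Integration.integrable_diff) simp_all
qed

lemma law_one_minus_exp: "0 < l \<Longrightarrow> (LINT s|\<mu> t. 1 - exp (- l * s)) = 1 - exp (- (t * \<phi> l))"
proof -
  assume l: "0 < l"
  interpret prob_space "\<mu> t" by (rule prob_space_law)
  have "(LINT s|\<mu> t. 1 - exp (- l * s)) = (LINT s|\<mu> t. 1) - (LINT s|\<mu> t. exp (- l * s))"
    by (rule Bochner_Integration.integral_diff[OF _ integrable_law_exp[OF l]]) simp
  then show ?thesis using law_laplace[OF l] by (simp add: prob_space)
qed

lemma law_one_minus_exp_le: "0 < l \<Longrightarrow> (LINT s|\<mu> t. 1 - exp (- l * s)) \<le> t * \<phi> l"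
  using law_one_minus_exp exp_ge_add_one_self[of "- (t * \<phi> l)"] by simp

text \<open>
  The function \<open>min 1 (s/R)\<close> is at most twice \<open>1 - exp (- s/R)\<close>, whose mean is \<open>1 - exp (- t \<phi> (1/R))\<close>.
\<close>

lemma law_truncated_mean:
  assumes "0 < R"
  shows "(\<integral>\<^sup>+ s. ennreal (min 1 (s / R)) \<partial>\<mu> t) \<le> ennreal (2 * (t * \<phi> (1 / R)))"
proof -
  have "(\<integral>\<^sup>+ s. ennreal (min 1 (s / R)) \<partial>\<mu> t) \<le> (\<integral>\<^sup>+ s. ennreal (2 * (1 - exp (- (1 / R) * s))) \<partial>\<mu> t)"
  proof (rule nn_integral_mono_AE)
    show "AE s in \<mu> t. ennreal (min 1 (s / R)) \<le> ennreal (2 * (1 - exp (- (1 / R) * s)))"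
      using AE_law_nonneg
    proof eventually_elim
      case (elim s)
      then show ?case using min_one_le_one_minus_exp[of "s / R"] assms by (intro ennreal_leI) simp
    qed
  qed
  also have "\<dots> = ennreal (LINT s|\<mu> t. 2 * (1 - exp (- (1 / R) * s)))"
  proof (rule nn_integral_eq_integral)
    show "integrable (\<mu> t) (\<lambda>s. 2 * (1 - exp (- (1 / R) * s)))"
      using integrable_law_one_minus_exp[of "1 / R"] assms by (intro integrable_mult_right) simp
    show "AE s in \<mu> t. 0 \<le> 2 * (1 - exp (- (1 / R) * s))"
      using AE_law_nonneg by eventually_elim (use assms in simp)
  qed
  also have "\<dots> \<le> ennreal (2 * (t * \<phi> (1 / R)))"
    using law_one_minus_exp_le[of "1 / R"] assms
    by (intro ennreal_leI) (simp only: integral_mult_right_zero, simp)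
  finally show ?thesis .
qed

lemma law_tail_le:
  assumes "0 < R"
  shows "measure (\<mu> t) {R..} \<le> 2 * (t * \<phi> (1 / R))"
proof -
  have "measure (\<mu> t) {R..} \<le> (LINT s|\<mu> t. 2 * (1 - exp (- (1 / R) * s)))"
    unfolding law_measure_eq[OF atLeast_borel]
  proof (rule integral_mono_AE)
    show "integrable (\<mu> t) (\<lambda>s. 2 * (1 - exp (- (1 / R) * s)))"
      using integrable_law_one_minus_exp[of "1 / R"] assms by (intro integrable_mult_right) simp
    show "AE s in \<mu> t. indicator {R..} s \<le> 2 * (1 - exp (- (1 / R) * s))"
      using AE_law_nonneg
    proof eventually_elim
      case (elim s)
      have "indicator {R..} s \<le> min 1 (s / R)"
        using elim assms by (simp add: indicator_def)
      also have "\<dots> \<le> 2 * (1 - exp (- (s / R)))"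
        using elim assms by (intro min_one_le_one_minus_exp) simp
      finally show ?case by simp
    qed
  qed (simp add: integrable_law_indicator)
  also have "\<dots> \<le> 2 * (t * \<phi> (1 / R))"
    using law_one_minus_exp_le[of "1 / R"] assms by (simp only: integral_mult_right_zero) simp
  finally show ?thesis .
qed

text \<open>
  Chernoff bound: \<open>s \<le> r\<close> implies \<open>1 \<le> exp (1 - s/r)\<close>.
\<close>

lemma law_lower_tail_le:
  assumes "0 < r"
  shows "measure (\<mu> t) {..r} \<le> exp (1 - t * \<phi> (1 / r))"
proof -
  have "measure (\<mu> t) {..r} \<le> (LINT s|\<mu> t. exp 1 * exp (- (1 / r) * s))"
    unfolding law_measure_eq[OF atMost_borel]
  proof (rule integral_mono_AE)
    show "integrable (\<mu> t) (\<lambda>s. exp 1 * exp (- (1 / r) * s))"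
      using integrable_law_exp[of "1 / r"] assms by (intro integrable_mult_right) simp
    show "AE s in \<mu> t. indicator {..r} s \<le> exp 1 * exp (- (1 / r) * s)"
    proof (rule AE_I2)
      fix s
      have "1 \<le> exp (1 - s / r)" if "s \<le> r"
        using that assms by simp
      then show "indicator {..r} s \<le> exp 1 * exp (- (1 / r) * s)"
        by (simp add: indicator_def exp_diff exp_minus field_simps)
    qed
  qed (simp add: integrable_law_indicator)
  also have "\<dots> = exp (1 - t * \<phi> (1 / r))"
    using law_laplace[of "1 / r"] assms
    by (simp only: integral_mult_right_zero) (simp add: exp_diff exp_minus field_simps)
  finally show ?thesis .
qed

text \<open>
  Split the mean of \<open>1 - exp (- k S/r)\<close> at \<open>S = r\<close>. Below \<open>r\<close> the integrand is at most \<open>k S/r\<close>, so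
  that part is \<open>k\<close> times a truncated mean.
\<close>

lemma law_tail_ge_laplace:
  assumes "0 < r" "0 < k" "k \<le> 1"
  shows "1 - exp (- (t * \<phi> (k / r))) \<le> measure (\<mu> t) {r<..} + k * (2 * (t * \<phi> (1 / r)))"
proof -
  have int: "integrable (\<mu> t) (\<lambda>s. 2 * k * (1 - exp (- (1 / r) * s)))"
    using integrable_law_one_minus_exp[of "1 / r"] assms by (intro integrable_mult_right) simp
  have "1 - exp (- (t * \<phi> (k / r))) = (LINT s|\<mu> t. 1 - exp (- (k / r) * s))"
    using law_one_minus_exp[of "k / r"] assms by simp
  also have "\<dots> \<le> (LINT s|\<mu> t. indicator {r<..} s + 2 * k * (1 - exp (- (1 / r) * s)))"
  proof (rule integral_mono_AE)
    show "integrable (\<mu> t) (\<lambda>s. 1 - exp (- (k / r) * s))"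
      using assms by (intro integrable_law_one_minus_exp) simp
    show "integrable (\<mu> t) (\<lambda>s. indicator {r<..} s + 2 * k * (1 - exp (- (1 / r) * s)))"
      by (intro Bochner_Integration.integrable_add int integrable_law_indicator) simp
    show "AE s in \<mu> t. 1 - exp (- (k / r) * s) \<le> indicator {r<..} s + 2 * k * (1 - exp (- (1 / r) * s))"
      using AE_law_nonneg
    proof eventually_elim
      case (elim s)
      have e: "0 \<le> 1 - exp (- (1 / r) * s)" using elim assms by simp
      show ?case
      proof (cases "r < s")
        case True
        then show ?thesis using e assms by (simp add: add_increasing2)
      next
        case False
        have "1 - exp (- (k / r) * s) \<le> k * (s / r)"
          using exp_ge_add_one_self[of "- (k / r) * s"] by simp
        also have "\<dots> \<le> k * (2 * (1 - exp (- (s / r))))"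
          using min_one_le_one_minus_exp[of "s / r"] elim assms False
          by (intro mult_left_mono) (auto simp: min_def split: if_splits)
        finally show ?thesis using False by (simp add: mult_ac)
      qed
    qed
  qed
  also have "\<dots> = measure (\<mu> t) {r<..} + 2 * k * (LINT s|\<mu> t. 1 - exp (- (1 / r) * s))"
    by (subst Bochner_Integration.integral_add[OF integrable_law_indicator int])
      (simp_all only: law_measure_eq greaterThan_borel integral_mult_right_zero)
  also have "\<dots> \<le> measure (\<mu> t) {r<..} + 2 * k * (t * \<phi> (1 / r))"
    using law_one_minus_exp_le[of "1 / r"] assms by (intro add_left_mono mult_left_mono) simp_all
  finally show ?thesis by (simp add: mult_ac)
qed

end

lemma law_superadditive_power:
  assumes laws: "subordinator_laws \<phi> \<mu>" and "0 < t"
  shows "measure (\<mu> t) {..r} ^ Suc n \<le> measure (\<mu> (real (Suc n) * t)) {..real (Suc n) * r}"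
proof (induction n)
  case 0
  then show ?case by simp
next
  case (Suc n)
  have "measure (\<mu> t) {..r} ^ Suc (Suc n) = measure (\<mu> t) {..r} ^ Suc n * measure (\<mu> t) {..r}"
    by simp
  also have "\<dots> \<le> measure (\<mu> (real (Suc n) * t)) {..real (Suc n) * r} * measure (\<mu> t) {..r}"
    using Suc by (intro mult_right_mono) auto
  also have "\<dots> \<le> measure (\<mu> (real (Suc n) * t + t)) {..real (Suc n) * r + r}"
    using laws \<open>0 < t\<close> unfolding subordinator_laws_def by (auto simp del: of_nat_Suc)
  also have "real (Suc n) * t + t = real (Suc (Suc n)) * t"
    by (simp add: algebra_simps)
  also have "real (Suc n) * r + r = real (Suc (Suc n)) * r"
    by (simp add: algebra_simps)
  finally show ?case .
qed

lemma exists_small_powr_ge: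
  fixes A b d :: real
  assumes "0 < b" "0 < d"
  obtains a where "0 < a" "a \<le> b" "A \<le> a powr (- d)"
proof -
  define a where "a = min b ((max A 1) powr (- (1 / d)))"
  have a: "0 < a" "a \<le> b" using assms by (auto simp: a_def)
  have "A \<le> ((max A 1) powr (- (1 / d))) powr (- d)"
    using assms by (simp add: powr_powr)
  also have "\<dots> \<le> a powr (- d)"
    using a assms by (intro powr_mono2') (auto simp: a_def)
  finally show ?thesis using a that by blast
qed

text \<open>
  By the Chernoff bound and the lower scaling of \<open>\<phi>\<close>, the probability of \<open>S t \<le> \<tau> / 2^k\<close> decays at least like
  \<open>exp (- c 2^(k d1))\<close>. This beats the growth \<open>2^(k N)\<close> of the integrand over the dyadic blocks.
\<close>

lemma law_negative_moment:
  fixes \<phi> :: "real \<Rightarrow> real" and N :: real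
  assumes sc: "weak_scaling J (\<lambda>u. \<phi> (1 / u)) d1 d2" and d1: "0 < d1" and N: "0 \<le> N"
  obtains K where "0 < K"
    "\<And>\<mu> t \<tau>. subordinator_laws \<phi> \<mu> \<Longrightarrow> 0 < t \<Longrightarrow> \<tau> \<in> J \<Longrightarrow> 0 < \<tau> \<Longrightarrow> t * \<phi> (1 / \<tau>) = 1 \<Longrightarrow>
      (\<integral>\<^sup>+ s\<in>{0<..<\<tau>}. ennreal ((\<tau> / s) powr N) \<partial>\<mu> t) \<le> ennreal K"
proof -
  obtain c where c: "0 < c"
    and scl: "\<And>u v. u \<in> J \<Longrightarrow> 0 < v \<Longrightarrow> v \<le> u \<Longrightarrow> c * (u / v) powr d1 * \<phi> (1 / u) \<le> \<phi> (1 / v)"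
    using sc unfolding weak_scaling_def by metis
  obtain C where C: "0 < C" "\<And>z. 1 \<le> z \<Longrightarrow> exp (- (c * z powr d1)) \<le> C * z powr (- (N + 1))"
    using exp_neg_powr_le_powr[OF c d1] by metis
  define K where "K = exp 1 * C * 2 powr N * 2"
  show ?thesis
  proof (rule that)
    show "0 < K" using C by (simp add: K_def)
  next
    fix \<mu> t \<tau> assume laws: "subordinator_laws \<phi> \<mu>" and t: "0 < t" and \<tau>: "\<tau> \<in> J" "0 < \<tau>" "t * \<phi> (1 / \<tau>) = 1"
    interpret prob_space "\<mu> t" by (rule prob_space_law[OF laws t])
    define b where "b = (\<lambda>k::nat. 2 powr (real (Suc k) * N))"
    have blk: "b k * measure (\<mu> t) {..\<tau> / 2 ^ k} \<le> exp 1 * C * 2 powr N * (1 / 2) ^ k" for k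
    proof -
      have pk: "(2::real) ^ k = 2 powr real k" by (simp add: powr_realpow)
      have "c * (2 ^ k) powr d1 * \<phi> (1 / \<tau>) \<le> \<phi> (1 / (\<tau> / 2 ^ k))"
        using scl[of \<tau> "\<tau> / 2 ^ k"] \<tau> by (simp add: field_simps mult_left_mono)
      then have "t * (c * (2 ^ k) powr d1 * \<phi> (1 / \<tau>)) \<le> t * \<phi> (1 / (\<tau> / 2 ^ k))"
        using t by (intro mult_left_mono) auto
      also have "t * (c * (2 ^ k) powr d1 * \<phi> (1 / \<tau>)) = c * (2 ^ k) powr d1 * (t * \<phi> (1 / \<tau>))"
        by (simp only: mult_ac)
      finally have "c * (2 ^ k) powr d1 \<le> t * \<phi> (1 / (\<tau> / 2 ^ k))"
        by (simp only: \<tau>(3) mult_1_right)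
      then have "exp (1 - t * \<phi> (1 / (\<tau> / 2 ^ k))) \<le> exp (1 - c * (2 ^ k) powr d1)"
        by (simp only: exp_le_cancel_iff diff_left_mono)
      moreover have "measure (\<mu> t) {..\<tau> / 2 ^ k} \<le> exp (1 - t * \<phi> (1 / (\<tau> / 2 ^ k)))"
        using \<tau>(2) by (intro law_lower_tail_le[OF laws t]) simp
      ultimately have "measure (\<mu> t) {..\<tau> / 2 ^ k} \<le> exp (1 - c * (2 ^ k) powr d1)"
        by (rule order_trans[rotated])
      also have "\<dots> = exp 1 * exp (- (c * (2 ^ k) powr d1))" by (simp add: exp_diff exp_minus field_simps)
      also have "\<dots> \<le> exp 1 * (C * (2 ^ k) powr (- (N + 1)))"
        by (intro mult_left_mono C) auto
      finally have "b k * measure (\<mu> t) {..\<tau> / 2 ^ k} \<le> b k * (exp 1 * (C * (2 ^ k) powr (- (N + 1))))"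
        by (intro mult_left_mono) (auto simp: b_def)
      also have "\<dots> = exp 1 * C * (2 powr (real (Suc k) * N) * 2 powr (real k * (- (N + 1))))"
        unfolding b_def pk powr_powr by (simp only: mult_ac)
      also have "2 powr (real (Suc k) * N) * 2 powr (real k * (- (N + 1))) = 2 powr (N + - real k)"
        unfolding powr_add[symmetric] by (simp add: algebra_simps)
      also have "\<dots> = 2 powr N * (1 / 2) ^ k"
        unfolding powr_add powr_minus by (simp add: powr_realpow power_divide divide_simps)
      finally show ?thesis by (simp only: mult.assoc)
    qed
    have "(\<integral>\<^sup>+ s\<in>{0<..<\<tau>}. ennreal ((\<tau> / s) powr N) \<partial>\<mu> t) \<le>
        (\<integral>\<^sup>+ s. (\<Sum>k. ennreal (b k) * indicator {..\<tau> / 2 ^ k} s) \<partial>\<mu> t)"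
    proof (rule nn_integral_mono)
      fix s
      show "ennreal ((\<tau> / s) powr N) * indicator {0<..<\<tau>} s \<le> (\<Sum>k. ennreal (b k) * indicator {..\<tau> / 2 ^ k} s)"
      proof (cases "s \<in> {0<..<\<tau>}")
        case True
        then obtain k where k: "\<tau> / 2 ^ Suc k < s" "s \<le> \<tau> / 2 ^ k"
          using exists_dyadic_block[of s \<tau>] by auto
        have "\<tau> / s \<le> 2 ^ Suc k" using k True by (simp add: field_simps)
        then have "(\<tau> / s) powr N \<le> (2 ^ Suc k) powr N"
          using True N by (intro powr_mono2) auto
        also have "\<dots> = b k"
          unfolding b_def powr_realpow[OF zero_less_numeral, symmetric] powr_powr ..
        finally have "ennreal ((\<tau> / s) powr N) * indicator {0<..<\<tau>} s \<le> ennreal (b k) * indicator {..\<tau> / 2 ^ k} s"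
          using True k by (simp add: ennreal_leI del: power_Suc)
        also have "\<dots> \<le> (\<Sum>k. ennreal (b k) * indicator {..\<tau> / 2 ^ k} s)"
          by (rule le_suminf_ennreal)
        finally show ?thesis .
      qed simp
    qed
    also have "\<dots> = (\<Sum>k. (\<integral>\<^sup>+ s. ennreal (b k) * indicator {..\<tau> / 2 ^ k} s \<partial>\<mu> t))"
    proof (rule nn_integral_suminf)
      show "(\<lambda>s. ennreal (b k) * indicator {..\<tau> / 2 ^ k} s) \<in> borel_measurable (\<mu> t)" for k
        by (subst measurable_cong_sets[OF sets_law[OF laws t] refl]) measurable
    qed
    also have "\<dots> = (\<Sum>k. ennreal (b k * measure (\<mu> t) {..\<tau> / 2 ^ k}))"
      by (subst nn_integral_cmult_indicator)
        (simp_all add: sets_law[OF laws t] emeasure_eq_measure ennreal_mult b_def)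
    also have "\<dots> \<le> (\<Sum>k. ennreal (exp 1 * C * 2 powr N * (1 / 2) ^ k))"
      by (intro suminf_le ennreal_leI blk) auto
    also have "\<dots> = ennreal (\<Sum>k. exp 1 * C * 2 powr N * (1 / 2) ^ k)"
      using C(1) by (intro suminf_ennreal2 summable_mult summable_geometric) auto
    also have "(\<Sum>k. exp 1 * C * 2 powr N * (1 / 2) ^ k) = K"
      unfolding K_def by (subst suminf_mult) (auto simp: suminf_geometric intro!: summable_geometric)
    finally show "(\<integral>\<^sup>+ s\<in>{0<..<\<tau>}. ennreal ((\<tau> / s) powr N) \<partial>\<mu> t) \<le> ennreal K" .
  qed
qed

text \<open>
  In the inequality above the left side is of order at least \<open>k^d2\<close> times \<open>t \<phi> (1/r)\<close>, by the upper scaling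
  of \<open>\<phi>\<close>, and the contribution of values below \<open>r\<close> on the right side is only of order \<open>k\<close> times \<open>t \<phi> (1/r)\<close>. As \<open>d2 < 1\<close>, a
  small \<open>k\<close> leaves a positive share for the tail.
\<close>

lemma law_tail_ge:
  fixes \<phi> :: "real \<Rightarrow> real"
  assumes sc: "weak_scaling J (\<lambda>u. \<phi> (1 / u)) d1 d2" and d2: "d2 < 1" and posA: "\<forall>l>0. 0 < \<phi> l"
  obtains k c where "0 < k" "k \<le> 1" "0 < c"
    "\<And>\<mu> t r. subordinator_laws \<phi> \<mu> \<Longrightarrow> 0 < t \<Longrightarrow> 0 < r \<Longrightarrow> r / k \<in> J \<Longrightarrow> t * \<phi> (k / r) \<le> 1 \<Longrightarrow>
      c * (t * \<phi> (1 / r)) \<le> measure (\<mu> t) {r<..}"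
proof -
  note pos = posA[rule_format]
  obtain C where C: "0 < C"
    and scl: "\<And>u v. u \<in> J \<Longrightarrow> 0 < v \<Longrightarrow> v \<le> u \<Longrightarrow> \<phi> (1 / v) \<le> C * (u / v) powr d2 * \<phi> (1 / u)"
    using sc unfolding weak_scaling_def by metis
  obtain k where k: "0 < k" "k \<le> 1" "8 * C \<le> k powr (- (1 - d2))"
    using exists_small_powr_ge[of 1 "1 - d2" "8 * C"] d2 by auto
  define c where "c = k powr d2 / (4 * C)"
  have "8 * C * k \<le> k powr (- (1 - d2)) * k powr 1"
    using k by (simp add: mult_right_mono)
  also have "\<dots> = k powr d2" unfolding powr_add[symmetric] by simp
  finally have kc: "2 * k \<le> c" using C by (simp add: c_def field_simps)
  show ?thesis
  proof (rule that[of k c])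
    show "0 < c" using k C by (simp add: c_def)
    fix \<mu> t r assume laws: "subordinator_laws \<phi> \<mu>" and t: "0 < t" and r: "0 < r" "r / k \<in> J"
      and le1: "t * \<phi> (k / r) \<le> 1"
    let ?X = "t * \<phi> (1 / r)"
    have X: "0 \<le> ?X" using t r pos[of "1 / r"] by simp
    have "r \<le> r / k" using r k by (simp add: field_simps)
    then have "\<phi> (1 / r) \<le> C * (1 / k) powr d2 * \<phi> (k / r)"
      using scl[of "r / k" r] r k by simp
    then have "?X \<le> t * (C * (1 / k) powr d2 * \<phi> (k / r))" using t by (intro mult_left_mono) auto
    also have "\<dots> = (C / k powr d2) * (t * \<phi> (k / r))"
      using k by (simp add: powr_divide)
    finally have "2 * c * ?X \<le> (t * \<phi> (k / r)) / 2"
      using k C by (simp add: c_def field_simps)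
    also have "\<dots> \<le> 1 - exp (- (t * \<phi> (k / r)))"
      using le1 t r k pos[of "k / r"] by (intro one_minus_exp_lower) auto
    also have "\<dots> \<le> measure (\<mu> t) {r<..} + k * (2 * ?X)"
      by (rule law_tail_ge_laplace[OF laws t r(1) k(1,2)])
    also have "k * (2 * ?X) \<le> c * ?X" using mult_right_mono[OF kc X] by (simp add: mult_ac)
    finally show "c * ?X \<le> measure (\<mu> t) {r<..}" by simp
  qed (use k in auto)
qed

text \<open>
  Two regimes. If \<open>t \<phi> (1/R)\<close> is small, the tail at \<open>a R\<close> exceeds the tail at \<open>R\<close>, because the former
  grows at least like \<open>a^-d1\<close>. Otherwise \<open>t\<close> is comparable with \<open>1 / \<phi> (1/R)\<close>; then \<open>S t\<close> stays below \<open>R\<close> with a fixed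
  positive probability, and it falls below \<open>a R\<close> with a probability that the Chernoff bound makes as small as desired.

  The first claim of the second regime is not clear from a tail bound alone, because \<open>t \<phi> (1/R)\<close> may be
  close to 1. Split \<open>t\<close> into \<open>n\<close> equal pieces: each increment exceeds \<open>R/n\<close> with probability of order
  \<open>n^(d2 - 1)\<close>, which is at most \<open>1/2\<close> for large \<open>n\<close>, and by independence all of them stay
  below with probability at least \<open>2^-n\<close>.
\<close>

lemma law_block_ge:
  fixes \<phi> :: "real \<Rightarrow> real"
  assumes sc: "weak_scaling J (\<lambda>u. \<phi> (1 / u)) d1 d2" and d1: "0 < d1" and d2: "d2 < 1"
    and posA: "\<forall>l>0. 0 < \<phi> l"
    and JA: "\<forall>u\<in>J. \<forall>v. 0 < v \<and> v \<le> u \<longrightarrow> v \<in> J"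
  obtains a c where "0 < a" "a < 1" "0 < c"
    "\<And>\<mu> t R. subordinator_laws \<phi> \<mu> \<Longrightarrow> 0 < t \<Longrightarrow> R \<in> J \<Longrightarrow> 0 < R \<Longrightarrow> t * \<phi> (1 / R) \<le> 1 \<Longrightarrow>
      c * (t * \<phi> (1 / R)) \<le> measure (\<mu> t) {a * R<..R}"
proof -
  note pos = posA[rule_format]
  have J: "v \<in> J" if "u \<in> J" "0 < v" "v \<le> u" for u v
    using JA that by blast
  obtain c1 C where c1: "0 < c1" and C: "0 < C"
    and scl: "\<And>u v. u \<in> J \<Longrightarrow> 0 < v \<Longrightarrow> v \<le> u \<Longrightarrow> c1 * (u / v) powr d1 * \<phi> (1 / u) \<le> \<phi> (1 / v)"
    and scu: "\<And>u v. u \<in> J \<Longrightarrow> 0 < v \<Longrightarrow> v \<le> u \<Longrightarrow> \<phi> (1 / v) \<le> C * (u / v) powr d2 * \<phi> (1 / u)"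
    using sc unfolding weak_scaling_def by metis
  obtain k c0 where k: "0 < k" "k \<le> 1" and c0: "0 < c0"
    and tail: "\<And>\<mu> t r. subordinator_laws \<phi> \<mu> \<Longrightarrow> 0 < t \<Longrightarrow> 0 < r \<Longrightarrow> r / k \<in> J \<Longrightarrow> t * \<phi> (k / r) \<le> 1 \<Longrightarrow>
      c0 * (t * \<phi> (1 / r)) \<le> measure (\<mu> t) {r<..}"
    using law_tail_ge[OF sc d2 posA] by metis
  obtain a1 where a1: "0 < a1" "a1 \<le> k" "3 / (c0 * c1) \<le> a1 powr (- d1)"
    using exists_small_powr_ge[OF k(1) d1] by metis
  \<comment> \<open>up to this value of \<open>t \<phi> (1/R)\<close> the tail bound is available at the level \<open>a1 R\<close>\<close>
  define e where "e = 1 / (C * (k / a1) powr d2)"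
  have e: "0 < e" using C k a1 by (simp add: e_def)
  \<comment> \<open>the number \<open>n'\<close> of pieces into which \<open>t\<close> is split\<close>
  obtain b where b: "0 < b" "b \<le> 1" "4 * C \<le> b powr (- (1 - d2))"
    using exists_small_powr_ge[of 1 "1 - d2" "4 * C"] d2 by auto
  obtain n :: nat where n: "1 / b \<le> real n" using real_arch_simple by blast
  define n' where "n' = real (Suc n)"
  have n': "1 / b \<le> n'" "1 \<le> n'" using n by (auto simp: n'_def)
  \<comment> \<open>the Chernoff bound at the level \<open>a2 R\<close> is to lose against half of \<open>2^-n'\<close>\<close>
  obtain a2 where a2: "0 < a2" "a2 \<le> 1 / 2" "(n' + 2) / (c1 * e) \<le> a2 powr (- d1)"
    using exists_small_powr_ge[of "1 / 2" d1 "(n' + 2) / (c1 * e)"] d1 by auto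
  define a where "a = min a1 a2"
  define c where "c = (1 / 2 :: real) ^ Suc (Suc n)"
  have c: "0 < c" "c \<le> 1" unfolding c_def by (auto intro: power_le_one simp del: power_Suc)
  show ?thesis
  proof (rule that)
    show "0 < a" "a < 1" using a1 a2 by (auto simp: a_def)
    show "0 < c" by (rule c)
  next
    fix \<mu> t R assume laws: "subordinator_laws \<phi> \<mu>" and t: "0 < t" and R: "R \<in> J" "0 < R"
      and le1: "t * \<phi> (1 / R) \<le> 1"
    interpret prob_space "\<mu> t" by (rule prob_space_law[OF laws t])
    note S = sets_law[OF laws t]
    let ?X = "t * \<phi> (1 / R)"
    have X: "0 < ?X" using t R pos[of "1 / R"] by simp
    have scl': "c1 * q powr (- d1) * ?X \<le> t * \<phi> (1 / (q * R))" if "0 < q" "q \<le> 1" for q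
    proof -
      have "c1 * (R / (q * R)) powr d1 * \<phi> (1 / R) \<le> \<phi> (1 / (q * R))"
        using that R by (intro scl) (auto simp: mult_le_cancel_right1)
      then have "t * (c1 * (R / (q * R)) powr d1 * \<phi> (1 / R)) \<le> t * \<phi> (1 / (q * R))"
        using t by (intro mult_left_mono) auto
      moreover have "(R / (q * R)) powr d1 = q powr (- d1)"
        using that R by (simp add: powr_divide powr_minus_divide)
      ultimately show ?thesis by (simp add: mult_ac)
    qed
    have scu': "t * \<phi> (1 / (q * R)) \<le> C * (1 / q) powr d2 * ?X" if "0 < q" "q \<le> 1" for q
    proof -
      have "\<phi> (1 / (q * R)) \<le> C * (R / (q * R)) powr d2 * \<phi> (1 / R)"
        using that R by (intro scu) (auto simp: mult_le_cancel_right1)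
      then have "t * \<phi> (1 / (q * R)) \<le> t * (C * (R / (q * R)) powr d2 * \<phi> (1 / R))"
        using t by (intro mult_left_mono) auto
      then show ?thesis using that R by (simp add: mult_ac)
    qed
    show "c * ?X \<le> measure (\<mu> t) {a * R<..R}"
    proof (cases "?X \<le> e")
      case True
      have "t * \<phi> (k / (a1 * R)) \<le> 1"
      proof -
        have "t * \<phi> (1 / ((a1 / k) * R)) \<le> C * (1 / (a1 / k)) powr d2 * ?X"
          using a1 k by (intro scu') auto
        also have "\<dots> \<le> C * (k / a1) powr d2 * e"
          using True C by (simp add: mult_left_mono)
        also have "\<dots> = 1" using C k a1 by (simp add: e_def)
        finally show ?thesis by simp
      qed
      moreover have "a1 * R / k \<in> J"
        using a1 k R by (intro J[OF R(1)]) (auto simp: field_simps)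
      ultimately have "c0 * (t * \<phi> (1 / (a1 * R))) \<le> measure (\<mu> t) {a1 * R<..}"
        using laws t a1 R by (intro tail) auto
      moreover have "3 * ?X \<le> c0 * (t * \<phi> (1 / (a1 * R)))"
      proof -
        have "3 \<le> c0 * c1 * a1 powr (- d1)" using a1 c0 c1 by (simp add: field_simps)
        then have "3 * ?X \<le> c0 * c1 * a1 powr (- d1) * ?X" using X by (intro mult_right_mono) auto
        also have "\<dots> = c0 * (c1 * a1 powr (- d1) * ?X)" by simp
        also have "\<dots> \<le> c0 * (t * \<phi> (1 / (a1 * R)))"
          using scl'[of a1] a1 k c0 by (intro mult_left_mono) auto
        finally show ?thesis .
      qed
      moreover have "measure (\<mu> t) {a1 * R<..} \<le> measure (\<mu> t) ({a * R<..R} \<union> {R..})"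
      proof (rule finite_measure_mono)
        have "a * R \<le> a1 * R" using R by (intro mult_right_mono) (auto simp: a_def)
        then show "{a1 * R<..} \<subseteq> {a * R<..R} \<union> {R..}" by auto
      qed (simp add: S)
      moreover have "measure (\<mu> t) ({a * R<..R} \<union> {R..}) \<le> measure (\<mu> t) {a * R<..R} + measure (\<mu> t) {R..}"
        by (intro measure_Un_le) (auto simp: S)
      moreover have "measure (\<mu> t) {R..} \<le> 2 * ?X" by (rule law_tail_le[OF laws t R(2)])
      ultimately have "?X \<le> measure (\<mu> t) {a * R<..R}" by linarith
      moreover have "c * ?X \<le> ?X" using mult_right_mono[of c 1 ?X] c X by simp
      ultimately show ?thesis by linarith
    next
      case False
      define u where "u = t / n'"
      have u: "0 < u" "n' * u = t" using t n' by (auto simp: u_def)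
      have half: "measure (\<mu> u) {R / n'..} \<le> 1 / 2"
      proof -
        have "measure (\<mu> u) {R / n'..} \<le> 2 * (u * \<phi> (1 / (R / n')))"
          using law_tail_le[OF laws u(1), of "R / n'"] R n' by auto
        also have "\<dots> = 2 / n' * (t * \<phi> (1 / ((1 / n') * R)))" by (simp add: u_def)
        also have "\<dots> \<le> 2 / n' * (C * (1 / (1 / n')) powr d2 * ?X)"
          using n' by (intro mult_left_mono scu') auto
        also have "\<dots> \<le> 2 / n' * (C * n' powr d2 * 1)"
          using n' C le1 by (intro mult_left_mono) auto
        also have "\<dots> = 2 * C * n' powr (- (1 - d2))"
          using n' by (simp add: powr_diff powr_minus field_simps)
        also have "\<dots> \<le> 2 * C * (1 / b) powr (- (1 - d2))"
          using n' b d2 C by (intro mult_left_mono powr_mono2') auto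
        also have "\<dots> \<le> 1 / 2"
        proof -
          have "(1 / b) powr (- (1 - d2)) = 1 / b powr (- (1 - d2))"
            using b by (simp add: powr_divide)
          also have "\<dots> \<le> 1 / (4 * C)" using b C by (intro divide_left_mono) auto
          finally have "2 * C * (1 / b) powr (- (1 - d2)) \<le> 2 * C * (1 / (4 * C))"
            using C by (intro mult_left_mono) auto
          then show ?thesis using C by simp
        qed
        finally show ?thesis .
      qed
      have "1 / 2 \<le> measure (\<mu> u) {..R / n'}"
      proof -
        interpret u: prob_space "\<mu> u" by (rule prob_space_law[OF laws u(1)])
        have "space (\<mu> u) = {..R / n'} \<union> {R / n'..}"
          using sets_eq_imp_space_eq[OF sets_law[OF laws u(1)]] by auto
        then have "1 \<le> measure (\<mu> u) {..R / n'} + measure (\<mu> u) {R / n'..}"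
          using measure_Un_le[of "{..R / n'}" "\<mu> u" "{R / n'..}"] u.prob_space
          by (simp add: sets_law[OF laws u(1)])
        then show ?thesis using half by linarith
      qed
      then have "(1 / 2) ^ Suc n \<le> measure (\<mu> u) {..R / n'} ^ Suc n"
        by (intro power_mono) auto
      also have "\<dots> \<le> measure (\<mu> t) {..R}"
        using law_superadditive_power[OF laws u(1), of "R / n'" n] u(2) n' by (simp add: n'_def)
      finally have up: "(1 / 2) ^ Suc n \<le> measure (\<mu> t) {..R}" .
      have low: "measure (\<mu> t) {..a * R} \<le> (1 / 2) ^ Suc (Suc n)"
      proof -
        have "measure (\<mu> t) {..a * R} \<le> measure (\<mu> t) {..a2 * R}"
        proof (rule finite_measure_mono)
          have "a * R \<le> a2 * R" using R by (intro mult_right_mono) (auto simp: a_def)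
          then show "{..a * R} \<subseteq> {..a2 * R}" by auto
        qed (simp add: S)
        also have "\<dots> \<le> exp (1 - t * \<phi> (1 / (a2 * R)))"
          using a2 R by (intro law_lower_tail_le[OF laws t]) auto
        also have "\<dots> \<le> exp (- real (Suc (Suc n)))"
        proof -
          have "n' + 2 \<le> c1 * a2 powr (- d1) * e" using a2 c1 e by (simp add: field_simps)
          also have "\<dots> \<le> c1 * a2 powr (- d1) * ?X" using False c1 by (intro mult_left_mono) auto
          also have "\<dots> \<le> t * \<phi> (1 / (a2 * R))" using a2 by (intro scl') auto
          finally show ?thesis by (simp add: n'_def)
        qed
        also have "\<dots> = exp (- 1) ^ Suc (Suc n)"
          by (subst exp_of_nat_mult[symmetric]) (simp del: power_Suc)
        also have "\<dots> \<le> (1 / 2) ^ Suc (Suc n)"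
        proof (rule power_mono)
          show "exp (- 1) \<le> (1 / 2 :: real)" using one_minus_exp_lower[of 1] by simp
        qed simp
        finally show ?thesis .
      qed
      have "measure (\<mu> t) {..R} \<le> measure (\<mu> t) ({..a * R} \<union> {a * R<..R})"
        by (intro finite_measure_mono) (auto simp: S)
      also have "\<dots> \<le> measure (\<mu> t) {..a * R} + measure (\<mu> t) {a * R<..R}"
        by (intro measure_Un_le) (auto simp: S)
      finally have "c \<le> measure (\<mu> t) {a * R<..R}" using up low by (simp add: c_def)
      moreover have "c * ?X \<le> c * 1" using le1 c by (intro mult_left_mono) auto
      ultimately show ?thesis by linarith
    qed
  qed
qed

section \<open>Scale functions and volumes\<close>

lemma scale_function_pos: "scale_function f \<Longrightarrow> 0 < r \<Longrightarrow> 0 < f r"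
  unfolding scale_function_def strict_mono_on_def
  by (metis atLeast_iff le_less_trans less_imp_le order_refl)

lemma scale_function_mono: "scale_function f \<Longrightarrow> 0 \<le> r \<Longrightarrow> r \<le> R \<Longrightarrow> f r \<le> f R"
  unfolding scale_function_def strict_mono_on_def
  by (metis atLeast_iff order_le_less order_trans)

lemma scale_function_scaling:
  assumes "scale_function f"
  obtains a1 a2 c1 c2 where "0 < a1" "0 < a2" "0 < c1" "0 < c2"
    "\<And>r R. 0 < r \<Longrightarrow> r \<le> R \<Longrightarrow> c1 * (R / r) powr a1 * f r \<le> f R"
    "\<And>r R. 0 < r \<Longrightarrow> r \<le> R \<Longrightarrow> f R \<le> c2 * (R / r) powr a2 * f r"
proof -
  obtain a1 a2 c1 c2 where c: "0 < a1" "0 < a2" "0 < c1" "0 < c2"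
    and sc: "\<forall>r R. 0 < r \<and> r \<le> R \<longrightarrow>
      c1 * (R / r) powr a1 \<le> f R / f r \<and> f R / f r \<le> c2 * (R / r) powr a2"
    using assms unfolding scale_function_def by blast
  show ?thesis
  proof (rule that[OF c])
    fix r R :: real assume r: "0 < r" "r \<le> R"
    have fr: "0 < f r" using scale_function_pos[OF assms r(1)] .
    have sc': "c1 * (R / r) powr a1 \<le> f R / f r" "f R / f r \<le> c2 * (R / r) powr a2"
      using sc r by blast+
    show "c1 * (R / r) powr a1 * f r \<le> f R" using sc'(1) fr by (simp add: pos_le_divide_eq)
    show "f R \<le> c2 * (R / r) powr a2 * f r" using sc'(2) fr by (simp add: pos_divide_le_eq)
  qed
qed

lemma scale_function_0:
  assumes "scale_function f"
  shows "f 0 = 0"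
proof (rule ccontr)
  assume "f 0 \<noteq> 0"
  then have f0: "0 < f 0" using assms by (auto simp: scale_function_def less_le)
  obtain a1 a2 c1 c2 where c: "0 < a1" "0 < a2" "0 < c1" "0 < c2"
    and sc: "\<And>r R. 0 < r \<Longrightarrow> r \<le> R \<Longrightarrow> c1 * (R / r) powr a1 * f r \<le> f R"
      "\<And>r R. 0 < r \<Longrightarrow> r \<le> R \<Longrightarrow> f R \<le> c2 * (R / r) powr a2 * f r"
    using scale_function_scaling[OF assms] by blast
  define q where "q = f 1 / (c1 * f 0) + 1"
  have q: "1 \<le> q" using c f0 scale_function_pos[OF assms, of 1] by (simp add: q_def)
  \<comment> \<open>a positive value at 0 would force \<open>f 1 \<ge> c1 q f 0 > f 1\<close>\<close>
  define r where "r = q powr (- (1 / a1))"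
  have r: "0 < r" "r \<le> 1" using q c by (auto simp: r_def powr_minus_divide ge_one_powr_ge_zero)
  have qr: "q = (1 / r) powr a1" using q c by (simp add: r_def powr_minus_divide powr_powr)
  have "f 1 + c1 * f 0 = c1 * q * f 0" using c f0 by (simp add: q_def field_simps)
  also have "\<dots> \<le> c1 * q * f r"
    using scale_function_mono[OF assms, of 0 r] r c q by (intro mult_left_mono) auto
  also have "\<dots> \<le> f 1" using sc(1)[of r 1] r by (simp add: qr)
  finally show False using mult_pos_pos[OF c(3) f0] by linarith
qed

context
  fixes f :: "real \<Rightarrow> real"
  assumes f: "scale_function f"
begin

lemma gen_inv_scale_function [simp]: "0 \<le> r \<Longrightarrow> gen_inv f (f r) = r"
  using f by (intro gen_inv_eq_inverse) (simp_all add: scale_function_def)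

lemma scale_function_unbounded: "\<exists>r>0. b < f r"
proof -
  obtain a1 a2 c1 c2 where c: "0 < a1" "0 < a2" "0 < c1" "0 < c2"
    and sc: "\<And>r R. 0 < r \<Longrightarrow> r \<le> R \<Longrightarrow> c1 * (R / r) powr a1 * f r \<le> f R"
      "\<And>r R. 0 < r \<Longrightarrow> r \<le> R \<Longrightarrow> f R \<le> c2 * (R / r) powr a2 * f r"
    using scale_function_scaling[OF f] by blast
  define k where "k = c1 * f 1"
  have k: "0 < k" using c scale_function_pos[OF f, of 1] by (simp add: k_def)
  define l where "l = max 1 (((\<bar>b\<bar> + 1) / k) powr (1 / a1))"
  have "(\<bar>b\<bar> + 1) / k = (((\<bar>b\<bar> + 1) / k) powr (1 / a1)) powr a1"
    using k c by (simp add: powr_powr)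
  also have "\<dots> \<le> l powr a1" using c by (intro powr_mono2) (auto simp: l_def)
  finally have "\<bar>b\<bar> + 1 \<le> k * l powr a1" using k by (simp add: field_simps)
  also have "\<dots> \<le> f l" using sc(1)[of 1 l] by (simp add: k_def l_def mult_ac)
  finally show ?thesis by (intro exI[of _ l]) (auto simp: l_def)
qed

lemma gen_inv_set:
  "{s. 0 \<le> s \<and> t < f s} \<noteq> {}" "bdd_below {s. 0 \<le> s \<and> t < f s}"
  using scale_function_unbounded[of t] by (auto intro: less_imp_le bdd_belowI[of _ 0])

lemma less_gen_inv_imp:
  assumes "0 \<le> r" "r < gen_inv f s"
  shows "f r \<le> s"
proof (rule ccontr)
  assume "\<not> f r \<le> s"
  then have "gen_inv f s \<le> r"
    unfolding gen_inv_def using assms(1) by (intro cInf_lower gen_inv_set) simp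
  then show False using assms(2) by simp
qed

lemma gen_inv_less_imp:
  assumes "gen_inv f s < r"
  shows "s < f r"
proof -
  obtain u where "0 \<le> u" "s < f u" "u < r"
    using cInf_lessD[OF gen_inv_set(1)[of s], of r] assms by (auto simp: gen_inv_def)
  then show ?thesis using scale_function_mono[OF f, of u r] by simp
qed

lemma gen_inv_nonneg: "0 \<le> gen_inv f s"
  unfolding gen_inv_def by (rule cInf_greatest[OF gen_inv_set(1)]) simp

lemma gen_inv_mono: "s \<le> s' \<Longrightarrow> gen_inv f s \<le> gen_inv f s'"
  unfolding gen_inv_def by (rule cInf_superset_mono[OF gen_inv_set]) auto

text \<open>
  A scale function may jump, so \<open>f (gen_inv f s)\<close> need not be \<open>s\<close>. The values of \<open>f\<close> at half and at twice the
  point \<open>gen_inv f s\<close> lie on either side of \<open>s\<close>, and scaling compares them with the value at the point.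
\<close>

lemma gen_inv_sandwich:
  obtains c C where "0 < c" "0 < C"
    "\<forall>s>0. 0 < gen_inv f s \<and> c * s \<le> f (gen_inv f s) \<and> f (gen_inv f s) \<le> C * s"
proof -
  obtain a1 a2 c1 c2 where c: "0 < a1" "0 < a2" "0 < c1" "0 < c2"
    and scl: "\<And>r R. 0 < r \<Longrightarrow> r \<le> R \<Longrightarrow> c1 * (R / r) powr a1 * f r \<le> f R"
    and scu: "\<And>r R. 0 < r \<Longrightarrow> r \<le> R \<Longrightarrow> f R \<le> c2 * (R / r) powr a2 * f r"
    using scale_function_scaling[OF f] by blast
  show ?thesis
  proof (rule that[of "1 / (c2 * 2 powr a2)" "c2 * 2 powr a2"], goal_cases)
    case 3
    show ?case
    proof (intro allI impI)
      fix s :: real assume s: "0 < s"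
      let ?r = "gen_inv f s"
      have pos: "0 < ?r"
      proof (rule ccontr)
        assume "\<not> ?thesis"
        then have "?r = 0" using gen_inv_nonneg[of s] by simp
        then have all: "s < f u" if "0 < u" for u using gen_inv_less_imp[of s u] that by simp
        \<comment> \<open>a point so small that scaling forces \<open>f u \<le> s\<close>\<close>
      define u where "u = min 1 ((s * c1 / f 1) powr (1 / a1))"
        have f1: "0 < f 1" using scale_function_pos[OF f] by simp
        have u: "0 < u" "u \<le> 1" using s c f1 by (auto simp: u_def)
        have "u powr a1 \<le> ((s * c1 / f 1) powr (1 / a1)) powr a1"
          using u c by (intro powr_mono2) (auto simp: u_def)
        also have "\<dots> = s * c1 / f 1" using s c f1 by (simp add: powr_powr)
        finally have "f 1 * u powr a1 \<le> s * c1" using f1 by (simp add: field_simps)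
        moreover have "c1 * f u \<le> f 1 * u powr a1"
          using scl[of u 1] u c by (simp add: powr_divide field_simps)
        ultimately have "c1 * f u \<le> c1 * s" by (simp add: mult_ac)
        then show False using all[OF u(1)] c by simp
      qed
      have "s \<le> f (2 * ?r)" using gen_inv_less_imp[of s "2 * ?r"] pos by simp
      also have "\<dots> \<le> c2 * 2 powr a2 * f ?r" using scu[of ?r "2 * ?r"] pos by simp
      finally have 1: "1 / (c2 * 2 powr a2) * s \<le> f ?r" using c by (simp add: field_simps)
      have "f ?r \<le> c2 * 2 powr a2 * f (?r / 2)" using scu[of "?r / 2" ?r] pos by simp
      also have "\<dots> \<le> c2 * 2 powr a2 * s"
        using less_gen_inv_imp[of "?r / 2" s] pos c by (intro mult_left_mono) auto
      finally show "0 < ?r \<and> 1 / (c2 * 2 powr a2) * s \<le> f ?r \<and> f ?r \<le> c2 * 2 powr a2 * s"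
        using pos 1 by blast
    qed
  qed (use c in auto)
qed

lemma gen_inv_pos:
  assumes "0 < s"
  shows "0 < gen_inv f s"
proof -
  obtain c C where "\<forall>s>0. 0 < gen_inv f s \<and> c * s \<le> f (gen_inv f s) \<and> f (gen_inv f s) \<le> C * s"
    by (rule gen_inv_sandwich)
  then show ?thesis using assms by blast
qed

lemma gen_inv_scaling:
  obtains d1 d2 c C where "0 < d1" "0 < d2" "0 < c" "0 < C"
    "\<And>s S. 0 < s \<Longrightarrow> s \<le> S \<Longrightarrow> c * (S / s) powr d1 \<le> gen_inv f S / gen_inv f s"
    "\<And>s S. 0 < s \<Longrightarrow> s \<le> S \<Longrightarrow> gen_inv f S / gen_inv f s \<le> C * (S / s) powr d2"
proof -
  obtain a1 a2 c1 c2 where c: "0 < a1" "0 < a2" "0 < c1" "0 < c2"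
    and scl: "\<And>r R. 0 < r \<Longrightarrow> r \<le> R \<Longrightarrow> c1 * (R / r) powr a1 * f r \<le> f R"
    and scu: "\<And>r R. 0 < r \<Longrightarrow> r \<le> R \<Longrightarrow> f R \<le> c2 * (R / r) powr a2 * f r"
    using scale_function_scaling[OF f] by blast
  obtain b B where b: "0 < b" "0 < B" and sw: "\<forall>s>0. 0 < gen_inv f s \<and> b * s \<le> f (gen_inv f s) \<and> f (gen_inv f s) \<le> B * s"
    by (rule gen_inv_sandwich)
  have g: "0 < gen_inv f s" "b * s \<le> f (gen_inv f s)" "f (gen_inv f s) \<le> B * s" if "0 < s" for s
    using sw that by blast+
  show ?thesis
  proof (rule that[of "1 / a2" "1 / a1" "(b / (B * c2)) powr (1 / a2)" "(B / (b * c1)) powr (1 / a1)"])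
    fix s S :: real assume s: "0 < s" "s \<le> S"
    let ?u = "gen_inv f s" and ?U = "gen_inv f S"
    have S: "0 < S" using s by simp
    note p = g(1)[OF s(1)] g(1)[OF S]
    have uU: "?u \<le> ?U" using s by (intro gen_inv_mono)
    have "b * S \<le> f ?U" by (rule g(2)[OF S])
    also have "\<dots> \<le> c2 * (?U / ?u) powr a2 * f ?u" by (rule scu[OF p(1) uU])
    also have "\<dots> \<le> c2 * (?U / ?u) powr a2 * (B * s)"
      using g(3)[OF s(1)] c by (intro mult_left_mono) auto
    finally have "b / (B * c2) * (S / s) \<le> (?U / ?u) powr a2"
      using c b s by (simp add: field_simps)
    then have "(b / (B * c2) * (S / s)) powr (1 / a2) \<le> ((?U / ?u) powr a2) powr (1 / a2)"
      using c b s by (intro powr_mono2) auto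
    then show "(b / (B * c2)) powr (1 / a2) * (S / s) powr (1 / a2) \<le> ?U / ?u"
      using c b s p by (simp add: powr_powr flip: powr_mult)
    have "c1 * (?U / ?u) powr a1 * (b * s) \<le> c1 * (?U / ?u) powr a1 * f ?u"
      using g(2)[OF s(1)] c by (intro mult_left_mono) auto
    also have "\<dots> \<le> f ?U" by (rule scl[OF p(1) uU])
    also have "\<dots> \<le> B * S" by (rule g(3)[OF S])
    finally have "(?U / ?u) powr a1 \<le> B / (b * c1) * (S / s)"
      using c b s by (simp add: field_simps)
    then have "((?U / ?u) powr a1) powr (1 / a1) \<le> (B / (b * c1) * (S / s)) powr (1 / a1)"
      using c b s by (intro powr_mono2) auto
    then show "?U / ?u \<le> (B / (b * c1)) powr (1 / a1) * (S / s) powr (1 / a1)"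
      using c b s p by (simp add: powr_powr flip: powr_mult)
  qed (use c b in auto)
qed

end

lemma ball_measure:
  fixes m :: "'a::metric_space measure"
  assumes bc: "\<And>K :: 'a set. bounded K \<Longrightarrow> closed K \<Longrightarrow> compact K"
    and radon: "radon_measure m" and supp: "full_support m" and "0 < r"
  shows "emeasure m (ball x r) = ennreal (measure m (ball x r))" "0 < measure m (ball x r)"
proof -
  have "emeasure m (ball x r) \<le> emeasure m (cball x r)"
    by (intro emeasure_mono ball_subset_cball) (use radon in \<open>simp add: radon_measure_def\<close>)
  also have "\<dots> < \<infinity>"
  proof -
    have "\<forall>K. compact K \<longrightarrow> emeasure m K < \<infinity>" using radon unfolding radon_measure_def by blast
    then show ?thesis using bc[OF bounded_cball closed_cball] by blast
  qed
  finally show eq: "emeasure m (ball x r) = ennreal (measure m (ball x r))"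
    by (simp add: emeasure_eq_ennreal_measure)
  have "0 < emeasure m (ball x r)"
    using supp[unfolded full_support_def, rule_format, of "ball x r"] \<open>0 < r\<close> by simp
  then show "0 < measure m (ball x r)" using eq by (simp add: ennreal_less_zero_iff)
qed

lemma volume_growth:
  fixes m :: "'a::metric_space measure"
  assumes bc: "\<And>K :: 'a set. bounded K \<Longrightarrow> closed K \<Longrightarrow> compact K"
    and radon: "radon_measure m" and supp: "full_support m"
    and RE: "0 < R_E" and scal: "volume_scaling m R_E"
    and A: "R_E = \<infinity> \<or> (\<forall>r\<in>A. r \<le> b)"
  obtains C d where "0 < C" "0 < d"
    "\<And>x r R. 0 < r \<Longrightarrow> r \<le> R \<Longrightarrow> R \<in> A \<Longrightarrow>
      measure m (ball x R) \<le> C * (R / r) powr d * measure m (ball x r)"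
proof -
  obtain d1 d2 where d: "0 < d1" "d1 \<le> d2" and
    sc: "\<forall>a\<ge>1. \<exists>C_V\<ge>1. \<forall>x r R. 0 < r \<and> r \<le> R \<and> ereal R < ereal a * R_E \<longrightarrow>
        ennreal (inverse C_V * (R / r) powr d1) \<le> vol m x R / vol m x r \<and>
        vol m x R / vol m x r \<le> ennreal (C_V * (R / r) powr d2)"
    using scal unfolding volume_scaling_def by (elim exE conjE) (rule that)
  obtain a where a: "1 \<le> a" "\<And>R. R \<in> A \<Longrightarrow> ereal R < ereal a * R_E"
  proof (cases R_E)
    case (real e)
    then have e: "0 < e" using RE by simp
    define a where "a = max 1 ((\<bar>b\<bar> + 1) / e)"
    have "\<bar>b\<bar> + 1 \<le> a * e" using e by (simp add: a_def max_def field_simps)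
    then have R: "R < a * e" if "R \<le> b" for R using that by linarith
    show ?thesis
    proof (rule that[of a])
      show "1 \<le> a" by (simp add: a_def)
      show "ereal R < ereal a * R_E" if "R \<in> A" for R
      proof -
        have "\<forall>r\<in>A. r \<le> b" using A real by simp
        then show ?thesis using R[of R] that real by simp
      qed
    qed
  next
    case PInf
    show ?thesis by (rule that[of 1]) (simp_all add: PInf)
  qed (use RE in simp)
  obtain C where C: "1 \<le> C" and scC: "\<forall>x r R. 0 < r \<and> r \<le> R \<and> ereal R < ereal a * R_E \<longrightarrow>
        ennreal (inverse C * (R / r) powr d1) \<le> vol m x R / vol m x r \<and>
        vol m x R / vol m x r \<le> ennreal (C * (R / r) powr d2)"
    using sc[rule_format, OF a(1)] by (elim exE conjE) (rule that)
  show ?thesis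
  proof (rule that[of C d2])
    fix x r R assume r: "0 < r" "r \<le> R" "R \<in> A"
    then have R: "0 < R" by simp
    note br = ball_measure[OF bc radon supp r(1), of x] and bR = ball_measure[OF bc radon supp R, of x]
    have "ennreal (measure m (ball x R) / measure m (ball x r)) \<le> ennreal (C * (R / r) powr d2)"
      using scC[rule_format, OF conjI[OF r(1) conjI[OF r(2) a(2)[OF r(3)]]], THEN conjunct2, of x] br bR
      by (simp add: vol_def divide_ennreal)
    then have "measure m (ball x R) / measure m (ball x r) \<le> C * (R / r) powr d2"
      using C by (subst (asm) ennreal_le_iff) auto
    then show "measure m (ball x R) \<le> C * (R / r) powr d2 * measure m (ball x r)"
      using br by (simp add: field_simps)
  qed (use C d in auto)
qed

section \<open>Weighted means under the laws\<close>

lemma antimono_on_pos_measurable: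
  fixes f :: "real \<Rightarrow> real"
  assumes "\<And>s t. 0 < s \<Longrightarrow> s \<le> t \<Longrightarrow> f t \<le> f s"
  shows "(\<lambda>s. indicator {0<..} s * f s) \<in> borel_measurable borel"
proof -
  have "mono_on {0<..} (\<lambda>s. - f s)" using assms by (intro mono_onI) auto
  then have "(\<lambda>s. - f s) \<in> borel_measurable (restrict_space borel {0<..})"
    by (rule borel_measurable_mono_on_fnc)
  then have "(\<lambda>s. - (- f s)) \<in> borel_measurable (restrict_space borel {0<..})"
    by (rule borel_measurable_uminus)
  then show ?thesis
    by (subst (asm) borel_measurable_restrict_space_iff) simp_all
qed

context
  fixes \<phi> :: "real \<Rightarrow> real" and \<mu> :: "real \<Rightarrow> real measure" and t :: real and H :: "real \<Rightarrow> real"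
  assumes laws: "subordinator_laws \<phi> \<mu>" and t: "0 < t"
    and H [measurable]: "H \<in> borel_measurable borel"
    and H_nonneg: "\<And>s. 0 \<le> H s" and H_anti: "\<And>s u. 0 < s \<Longrightarrow> s \<le> u \<Longrightarrow> H u \<le> H s"
begin

lemma law_tonelli:
  assumes [measurable]: "Measurable.pred (borel \<Otimes>\<^sub>M borel) (\<lambda>(s, u). P s u)"
  shows "(\<integral>\<^sup>+ s. (\<integral>\<^sup>+ u. (if P s u then ennreal (H u) else 0) \<partial>lborel) \<partial>\<mu> t) =
    (\<integral>\<^sup>+ u. ennreal (H u) * emeasure (\<mu> t) {s. P s u} \<partial>lborel)"
proof -
  interpret prob_space "\<mu> t" by (rule prob_space_law[OF laws t])
  note S = sets_law[OF laws t]
  interpret pair_sigma_finite "\<mu> t" lborel ..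
  have P1: "{s. P s u} \<in> sets borel" for u
  proof -
    have "Measurable.pred borel (\<lambda>s. (\<lambda>(s, u). P s u) (s, u))" by measurable
    then show ?thesis by (simp add: pred_def)
  qed
  have "(\<lambda>(s, u). if P s u then ennreal (H u) else 0) \<in> borel_measurable (borel \<Otimes>\<^sub>M borel)"
    by measurable
  then have m: "(\<lambda>(s, u). if P s u then ennreal (H u) else 0) \<in> borel_measurable (\<mu> t \<Otimes>\<^sub>M lborel)"
    by (subst measurable_cong_sets[OF sets_pair_measure_cong[OF S sets_lborel] refl])
  have "(\<integral>\<^sup>+ s. (\<integral>\<^sup>+ u. (if P s u then ennreal (H u) else 0) \<partial>lborel) \<partial>\<mu> t) =
     (\<integral>\<^sup>+ u. (\<integral>\<^sup>+ s. (if P s u then ennreal (H u) else 0) \<partial>\<mu> t) \<partial>lborel)"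
    by (rule Fubini'[OF m, symmetric])
  also have "\<dots> = (\<integral>\<^sup>+ u. (\<integral>\<^sup>+ s. ennreal (H u) * indicator {s. P s u} s \<partial>\<mu> t) \<partial>lborel)"
    by (intro nn_integral_cong) (simp add: indicator_def)
  also have "\<dots> = (\<integral>\<^sup>+ u. ennreal (H u) * emeasure (\<mu> t) {s. P s u} \<partial>lborel)"
    by (intro nn_integral_cong nn_integral_cmult_indicator) (simp add: S P1)
  finally show ?thesis .
qed

lemma law_inner_measurable:
  assumes [measurable]: "Measurable.pred (borel \<Otimes>\<^sub>M borel) (\<lambda>(s, u). P s u)"
  shows "(\<lambda>s. \<integral>\<^sup>+ u. (if P s u then ennreal (H u) else 0) \<partial>lborel) \<in> borel_measurable (\<mu> t)"
proof -
  have "(\<lambda>(s, u). if P s u then ennreal (H u) else 0) \<in> borel_measurable (borel \<Otimes>\<^sub>M borel)"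
    by measurable
  then have "(\<lambda>(s, u). if P s u then ennreal (H u) else 0) \<in> borel_measurable (\<mu> t \<Otimes>\<^sub>M lborel)"
    by (subst measurable_cong_sets[OF sets_pair_measure_cong[OF sets_law[OF laws t] sets_lborel] refl])
  then show ?thesis by (rule lborel.borel_measurable_nn_integral)
qed

text \<open>
  As \<open>H\<close> is non-increasing, \<open>H(s) s\<close> is at most twice the integral of \<open>H\<close> over \<open>[s/2, s]\<close>. After exchanging the
  integrals, the weight of \<open>H(u)\<close> is the probability of a value in \<open>[u, 2u]\<close>, at most the tail at \<open>u\<close>. The restriction
  \<open>s > 2 \<tau>\<close> keeps \<open>u\<close> above \<open>\<tau>\<close>.
\<close>

lemma law_weighted_tail_le:
  assumes "0 < \<tau>"
  shows "(\<integral>\<^sup>+ s\<in>{2 * \<tau><..L}. ennreal (H s * s) \<partial>\<mu> t) \<le>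
    2 * (\<integral>\<^sup>+ u\<in>{\<tau>..L}. ennreal (H u) * emeasure (\<mu> t) {u..} \<partial>lborel)"
proof -
  let ?P = "\<lambda>s u. \<tau> \<le> u \<and> u \<le> L \<and> u \<le> s"
  have meas: "(\<lambda>s. \<integral>\<^sup>+ u. (if ?P s u then ennreal (H u) else 0) \<partial>lborel) \<in> borel_measurable (\<mu> t)"
    by (rule law_inner_measurable) measurable
  have "(\<integral>\<^sup>+ s\<in>{2 * \<tau><..L}. ennreal (H s * s) \<partial>\<mu> t) \<le>
      (\<integral>\<^sup>+ s. 2 * (\<integral>\<^sup>+ u. (if ?P s u then ennreal (H u) else 0) \<partial>lborel) \<partial>\<mu> t)"
  proof (rule nn_integral_mono)
    fix s
    show "ennreal (H s * s) * indicator {2 * \<tau><..L} s \<le>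
      2 * (\<integral>\<^sup>+ u. (if ?P s u then ennreal (H u) else 0) \<partial>lborel)"
    proof (cases "s \<in> {2 * \<tau><..L}")
      case True
      then have s: "2 * \<tau> < s" "s \<le> L" "0 < s" using assms by auto
      have "ennreal (H s * s) = ennreal (2 * (H s * (s / 2)))" by simp
      also have "\<dots> = 2 * ennreal (H s * (s / 2))" by (subst ennreal_mult') simp_all
      also have "ennreal (H s * (s / 2)) = (\<integral>\<^sup>+ u. ennreal (H s) * indicator {s / 2..s} u \<partial>lborel)"
        using s H_nonneg[of s]
        by (subst nn_integral_cmult_indicator) (simp_all flip: ennreal_mult')
      also have "\<dots> \<le> (\<integral>\<^sup>+ u. (if ?P s u then ennreal (H u) else 0) \<partial>lborel)"
      proof (rule nn_integral_mono)
        fix u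
        show "ennreal (H s) * indicator {s / 2..s} u \<le> (if ?P s u then ennreal (H u) else 0)"
          using s assms H_anti[of u s] by (auto simp: indicator_def intro!: ennreal_leI)
      qed
      finally show ?thesis using True by (simp add: mult_left_mono)
    qed simp
  qed
  also have "\<dots> = 2 * (\<integral>\<^sup>+ s. (\<integral>\<^sup>+ u. (if ?P s u then ennreal (H u) else 0) \<partial>lborel) \<partial>\<mu> t)"
    by (rule nn_integral_cmult[OF meas])
  also have "(\<integral>\<^sup>+ s. (\<integral>\<^sup>+ u. (if ?P s u then ennreal (H u) else 0) \<partial>lborel) \<partial>\<mu> t) =
      (\<integral>\<^sup>+ u. ennreal (H u) * emeasure (\<mu> t) {s. ?P s u} \<partial>lborel)"
    by (rule law_tonelli) measurable
  also have "\<dots> = (\<integral>\<^sup>+ u\<in>{\<tau>..L}. ennreal (H u) * emeasure (\<mu> t) {u..} \<partial>lborel)"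
    by (intro nn_integral_cong) (auto simp: indicator_def atLeast_def)
  finally show ?thesis .
qed

text \<open>
  The reverse bound: the integral of \<open>H\<close> over \<open>[s, s/a]\<close> is at most \<open>H(s) s/a\<close>, and after exchanging the
  integrals the weight of \<open>H(u)\<close> is the probability of the block \<open>{a u<..u}\<close>.
\<close>

lemma law_weighted_block_le:
  assumes "0 < \<tau>" and a: "0 < a"
  shows "ennreal a * (\<integral>\<^sup>+ u\<in>{\<tau>..L}. ennreal (H u) * emeasure (\<mu> t) {a * u<..u} \<partial>lborel)
    \<le> (\<integral>\<^sup>+ s\<in>{0<..L}. ennreal (H s * s) \<partial>\<mu> t)"
proof -
  let ?P = "\<lambda>s u. \<tau> \<le> u \<and> u \<le> L \<and> a * u < s \<and> s \<le> u"
  have meas: "(\<lambda>s. \<integral>\<^sup>+ u. (if ?P s u then ennreal (H u) else 0) \<partial>lborel) \<in> borel_measurable (\<mu> t)"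
    by (rule law_inner_measurable) measurable
  have "(\<integral>\<^sup>+ u\<in>{\<tau>..L}. ennreal (H u) * emeasure (\<mu> t) {a * u<..u} \<partial>lborel) =
      (\<integral>\<^sup>+ u. ennreal (H u) * emeasure (\<mu> t) {s. ?P s u} \<partial>lborel)"
    by (intro nn_integral_cong) (auto simp: indicator_def greaterThanAtMost_def greaterThan_def atMost_def Int_def)
  also have "\<dots> = (\<integral>\<^sup>+ s. (\<integral>\<^sup>+ u. (if ?P s u then ennreal (H u) else 0) \<partial>lborel) \<partial>\<mu> t)"
    by (rule law_tonelli[symmetric]) measurable
  finally have "ennreal a * (\<integral>\<^sup>+ u\<in>{\<tau>..L}. ennreal (H u) * emeasure (\<mu> t) {a * u<..u} \<partial>lborel) =
      (\<integral>\<^sup>+ s. ennreal a * (\<integral>\<^sup>+ u. (if ?P s u then ennreal (H u) else 0) \<partial>lborel) \<partial>\<mu> t)"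
    by (simp only: nn_integral_cmult[OF meas])
  also have "\<dots> \<le> (\<integral>\<^sup>+ s\<in>{0<..L}. ennreal (H s * s) \<partial>\<mu> t)"
  proof (rule nn_integral_mono)
    fix s
    show "ennreal a * (\<integral>\<^sup>+ u. (if ?P s u then ennreal (H u) else 0) \<partial>lborel) \<le>
      ennreal (H s * s) * indicator {0<..L} s"
    proof (cases "s \<in> {0<..L}")
      case True
      have "(\<integral>\<^sup>+ u. (if ?P s u then ennreal (H u) else 0) \<partial>lborel) \<le>
          (\<integral>\<^sup>+ u. ennreal (H s) * indicator {0..s / a} u \<partial>lborel)"
      proof (rule nn_integral_mono)
        fix u
        show "(if ?P s u then ennreal (H u) else 0) \<le> ennreal (H s) * indicator {0..s / a} u"
          using True assms H_anti[of s u] by (auto simp: indicator_def field_simps intro!: ennreal_leI)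
      qed
      also have "\<dots> = ennreal (H s * (s / a))"
        using True a H_nonneg[of s]
        by (subst nn_integral_cmult_indicator) (simp_all flip: ennreal_mult')
      finally have "ennreal a * (\<integral>\<^sup>+ u. (if ?P s u then ennreal (H u) else 0) \<partial>lborel) \<le>
          ennreal a * ennreal (H s * (s / a))" by (rule mult_left_mono) simp
      also have "\<dots> = ennreal (H s * s)"
        using a by (simp flip: ennreal_mult')
      finally show ?thesis using True by simp
    next
      case False
      have "\<not> ?P s u" for u
      proof
        assume "?P s u"
        then have "0 < u" "a * u < s" "s \<le> L" using assms(1) by auto
        then show False using False mult_pos_pos[OF a, of u] by simp
      qed
      then have "(\<lambda>u. if ?P s u then ennreal (H u) else 0) = (\<lambda>_. 0)" by (simp only: if_False)
      then show ?thesis by simp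
    qed
  qed
  finally show ?thesis .
qed

end

section \<open>Integrating a kernel over the laws\<close>

text \<open>
  The kernel on the time scale only. \<open>W x s\<close> stands for the volume of the ball that is filled by time
  \<open>s\<close>. The set \<open>J\<close> is the initial segment of times on which \<open>\<phi>\<close>, the volume and \<open>h\<close> are controlled.
  Later times are controlled only through the upper bound, which says that up to a constant the kernel
  stays below its size at any earlier time in \<open>J\<close>.
\<close>

locale kernel_bounds =
  fixes J :: "real set" and D :: "'a set" and W :: "'a \<Rightarrow> real \<Rightarrow> real"
    and h p :: "real \<Rightarrow> 'a \<Rightarrow> 'a \<Rightarrow> real" and \<phi> :: "real \<Rightarrow> real" and d1 d2 :: real
  assumes J_pos: "\<And>u. u \<in> J \<Longrightarrow> 0 < u"
    and J_down: "\<And>u v. u \<in> J \<Longrightarrow> 0 < v \<Longrightarrow> v \<le> u \<Longrightarrow> v \<in> J"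
    and \<phi>_pos: "\<And>l. 0 < l \<Longrightarrow> 0 < \<phi> l"
    and \<phi>_scaling: "weak_scaling J (\<lambda>u. \<phi> (1 / u)) d1 d2" and d1: "0 < d1" and d2: "d2 < 1"
    and W_pos: "\<And>x s. 0 < s \<Longrightarrow> 0 < W x s"
    and W_mono: "\<And>x s S. 0 < s \<Longrightarrow> s \<le> S \<Longrightarrow> W x s \<le> W x S"
    and W_growth: "\<exists>C>0. \<exists>d\<ge>0. \<forall>S\<in>J. \<forall>s. 0 < s \<and> s \<le> S \<longrightarrow> (\<forall>x. W x S \<le> C * (S / s) powr d * W x s)"
    and h_nonneg: "\<And>s x y. 0 < s \<Longrightarrow> x \<in> D \<Longrightarrow> y \<in> D \<Longrightarrow> 0 \<le> h s x y"
    and h_anti: "\<And>s t x y. 0 < s \<Longrightarrow> s \<le> t \<Longrightarrow> x \<in> D \<Longrightarrow> y \<in> D \<Longrightarrow> h t x y \<le> h s x y"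
    and h_decay: "power_decay_on J D h"
    and p_upper: "\<exists>C>0. \<forall>u\<in>J. \<forall>s\<ge>u. \<forall>x\<in>D. \<forall>y\<in>D. p s x y \<le> C * h u x y / W x u"
begin

abbreviation subordinated :: "(real \<Rightarrow> real measure) \<Rightarrow> real \<Rightarrow> 'a \<Rightarrow> 'a \<Rightarrow> ennreal" where
  "subordinated \<mu> t x y \<equiv> (\<integral>\<^sup>+ s\<in>{0<..}. ennreal (p s x y) \<partial>\<mu> t)"

lemma h_growth:
  obtains c \<gamma> where "0 < c" "0 \<le> \<gamma>"
    "\<forall>t\<in>J. \<forall>s. 0 < s \<and> s \<le> t \<longrightarrow> (\<forall>x\<in>D. \<forall>y\<in>D. h s x y \<le> c * (t / s) powr \<gamma> * h t x y)"
proof -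
  obtain c \<gamma> where c: "0 < c" "0 \<le> \<gamma>" and dec: "\<forall>s\<in>J. \<forall>t\<in>J. s \<le> t \<longrightarrow> (\<forall>x\<in>D. \<forall>y\<in>D.
      s powr \<gamma> * h s x y \<le> c * (t powr \<gamma> * h t x y))"
    using h_decay unfolding power_decay_on_def by blast
  show ?thesis
  proof (rule that[OF c], intro ballI allI impI)
    fix s t x y assume t: "t \<in> J" and s: "0 < s \<and> s \<le> t" and xy: "x \<in> D" "y \<in> D"
    have "s \<in> J" using J_down[OF t] s by blast
    then have "s powr \<gamma> * h s x y \<le> c * (t powr \<gamma> * h t x y)" using dec t s xy by blast
    then show "h s x y \<le> c * (t / s) powr \<gamma> * h t x y"
      using s by (simp add: powr_divide field_simps)
  qed
qed

lemma W_growth':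
  obtains C d where "0 < C" "0 \<le> d" "\<forall>S\<in>J. \<forall>s. 0 < s \<and> s \<le> S \<longrightarrow> (\<forall>x. W x S \<le> C * (S / s) powr d * W x s)"
  using W_growth by blast

text \<open>
  On the block \<open>{a u<..u}\<close> the values of \<open>h\<close> and of \<open>1 / W\<close> are at least those at \<open>u\<close>, by monotonicity. The
  bound is applied with \<open>R x y = \<Phi> (dist x y)\<close>.
\<close>

lemma block_lower_bound:
  assumes low: "\<And>K. 0 < K \<Longrightarrow> \<exists>c>0. \<forall>s\<in>J. \<forall>x\<in>D. \<forall>y\<in>D. R x y \<le> K * s \<longrightarrow> c * h s x y / W x s \<le> p s x y"
  obtains c where "0 < c" "\<forall>\<mu> t u. subordinator_laws \<phi> \<mu> \<longrightarrow> 0 < t \<longrightarrow> u \<in> J \<longrightarrow> t * \<phi> (1 / u) \<le> 1 \<longrightarrow>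
    (\<forall>x\<in>D. \<forall>y\<in>D. R x y \<le> u \<longrightarrow>
      ennreal (c * (t * \<phi> (1 / u)) * h u x y / W x u) \<le> subordinated \<mu> t x y)"
proof -
  obtain a c0 where a: "0 < a" "a < 1" and c0: "0 < c0" and
    blk: "\<And>\<mu> t R. subordinator_laws \<phi> \<mu> \<Longrightarrow> 0 < t \<Longrightarrow> R \<in> J \<Longrightarrow> 0 < R \<Longrightarrow> t * \<phi> (1 / R) \<le> 1 \<Longrightarrow>
      c0 * (t * \<phi> (1 / R)) \<le> measure (\<mu> t) {a * R<..R}"
  proof -
    have "\<forall>l>0. 0 < \<phi> l" "\<forall>u\<in>J. \<forall>v. 0 < v \<and> v \<le> u \<longrightarrow> v \<in> J"
      using \<phi>_pos J_down by blast+
    from law_block_ge[OF \<phi>_scaling d1 d2 this] show ?thesis using that by blast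
  qed
  obtain c1 where c1: "0 < c1" and lo: "\<forall>s\<in>J. \<forall>x\<in>D. \<forall>y\<in>D. R x y \<le> (1 / a) * s \<longrightarrow> c1 * h s x y / W x s \<le> p s x y"
    using low[of "1 / a"] a by auto
  show ?thesis
  proof (rule that[of "c0 * c1"], goal_cases)
    case 1 then show ?case using c0 c1 by simp
  next
    case 2
    show ?case
    proof (intro allI impI ballI)
      fix \<mu> t u x y assume laws: "subordinator_laws \<phi> \<mu>" and t: "0 < t" and u: "u \<in> J"
        and le1: "t * \<phi> (1 / u) \<le> 1" and xy: "x \<in> D" "y \<in> D" and R: "R x y \<le> u"
      interpret prob_space "\<mu> t" by (rule prob_space_law[OF laws t])
      have u0: "0 < u" by (rule J_pos[OF u])
      define B where "B = c1 * h u x y / W x u"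
      have B: "0 \<le> B" using c1 h_nonneg[OF u0 xy] W_pos[OF u0, of x] by (simp add: B_def)
      have pB: "B \<le> p s x y" if s: "s \<in> {a * u<..u}" for s
      proof -
        have s0: "0 < s" "s \<le> u" using s mult_pos_pos[OF a(1) u0] by auto
        have "a * R x y \<le> a * u" using R a by (intro mult_left_mono) auto
        also have "a * u \<le> s" using s by simp
        finally have "R x y \<le> (1 / a) * s" using a by (simp add: field_simps)
        then have "c1 * h s x y / W x s \<le> p s x y" using lo J_down[OF u s0] xy by blast
        moreover have "B \<le> c1 * h s x y / W x s"
          unfolding B_def using h_anti[OF s0 xy] W_mono[OF s0, of x] W_pos[OF s0(1), of x] c1 h_nonneg[OF u0 xy]
          by (intro frac_le mult_left_mono mult_nonneg_nonneg) auto
        ultimately show ?thesis by simp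
      qed
      have "ennreal (c0 * c1 * (t * \<phi> (1 / u)) * h u x y / W x u) = ennreal (B * (c0 * (t * \<phi> (1 / u))))"
        by (simp add: B_def mult_ac)
      also have "\<dots> \<le> ennreal (B * measure (\<mu> t) {a * u<..u})"
        using blk[OF laws t u u0 le1] B by (intro ennreal_leI mult_left_mono)
      also have "\<dots> = (\<integral>\<^sup>+ s. ennreal B * indicator {a * u<..u} s \<partial>\<mu> t)"
        using B by (subst nn_integral_cmult_indicator)
          (simp_all add: sets_law[OF laws t] emeasure_eq_measure ennreal_mult)
      also have "\<dots> \<le> subordinated \<mu> t x y"
      proof (rule nn_integral_mono)
        fix s
        show "ennreal B * indicator {a * u<..u} s \<le> ennreal (p s x y) * indicator {0<..} s"
        proof (cases "s \<in> {a * u<..u}")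
          case True
          moreover have "0 < s" using True mult_pos_pos[OF a(1) u0] by simp
          ultimately show ?thesis using pB[OF True] by (simp add: ennreal_leI)
        qed simp
      qed
      finally show "ennreal (c0 * c1 * (t * \<phi> (1 / u)) * h u x y / W x u) \<le> subordinated \<mu> t x y" .
    qed
  qed
qed

text \<open>
  For \<open>s < u\<close> the quotient \<open>h / W\<close> at \<open>s\<close> exceeds the one at \<open>u\<close> at most by a
  constant multiple of a power of \<open>u / s\<close>, whose mean is a
  negative moment of the law.
\<close>

lemma near_diagonal_upper:
  obtains C where "0 < C" "\<forall>\<mu> t u. subordinator_laws \<phi> \<mu> \<longrightarrow> 0 < t \<longrightarrow> u \<in> J \<longrightarrow> t * \<phi> (1 / u) = 1 \<longrightarrow>
    (\<forall>x\<in>D. \<forall>y\<in>D.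
      subordinated \<mu> t x y \<le> ennreal (C * h u x y / W x u))"
proof -
  obtain c \<gamma> where c: "0 < c" "0 \<le> \<gamma>" and hg:
    "\<forall>t\<in>J. \<forall>s. 0 < s \<and> s \<le> t \<longrightarrow> (\<forall>x\<in>D. \<forall>y\<in>D. h s x y \<le> c * (t / s) powr \<gamma> * h t x y)"
    by (rule h_growth)
  obtain Cw d where Cw: "0 < Cw" "0 \<le> d" and wg:
    "\<forall>S\<in>J. \<forall>s. 0 < s \<and> s \<le> S \<longrightarrow> (\<forall>x. W x S \<le> Cw * (S / s) powr d * W x s)"
    by (rule W_growth')
  obtain Cp where Cp: "0 < Cp" and pu: "\<forall>u\<in>J. \<forall>s\<ge>u. \<forall>x\<in>D. \<forall>y\<in>D. p s x y \<le> Cp * h u x y / W x u"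
    using p_upper by blast
  have N: "0 \<le> \<gamma> + d" using c Cw by simp
  obtain K where K: "0 < K" and mom:
    "\<And>\<mu> t \<tau>. subordinator_laws \<phi> \<mu> \<Longrightarrow> 0 < t \<Longrightarrow> \<tau> \<in> J \<Longrightarrow> 0 < \<tau> \<Longrightarrow> t * \<phi> (1 / \<tau>) = 1 \<Longrightarrow>
      (\<integral>\<^sup>+ s\<in>{0<..<\<tau>}. ennreal ((\<tau> / s) powr (\<gamma> + d)) \<partial>\<mu> t) \<le> ennreal K"
    using law_negative_moment[OF \<phi>_scaling d1 N] by blast
  define q where "q = max 1 (c * Cw)"
  have q: "1 \<le> q" "c * Cw \<le> q" by (auto simp: q_def)
  show ?thesis
  proof (rule that[of "Cp * q * (1 + K)"], goal_cases)
    case 1 then show ?case using Cp K q by simp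
  next
    case 2
    show ?case
    proof (intro allI impI ballI)
      fix \<mu> t u x y assume laws: "subordinator_laws \<phi> \<mu>" and t: "0 < t" and u: "u \<in> J"
        and eq1: "t * \<phi> (1 / u) = 1" and xy: "x \<in> D" "y \<in> D"
      interpret prob_space "\<mu> t" by (rule prob_space_law[OF laws t])
      have u0: "0 < u" by (rule J_pos[OF u])
      have hu: "0 \<le> h u x y" by (rule h_nonneg[OF u0 xy])
      have Wu: "0 < W x u" by (rule W_pos[OF u0])
      define B where "B = Cp * q * h u x y / W x u"
      have B: "0 \<le> B" using Cp hu Wu q by (simp add: B_def)
      have pw: "ennreal (p s x y) * indicator {0<..} s \<le>
          ennreal B * (1 + ennreal ((u / s) powr (\<gamma> + d)) * indicator {0<..<u} s)" for s
      proof -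
        consider "s \<le> 0" | "0 < s" "s < u" | "0 < s" "u \<le> s" by linarith
        then show ?thesis
        proof cases
          case 2
          then have su: "0 < s" "s \<le> u" by auto
          have sJ: "s \<in> J" by (rule J_down[OF u su])
          have "p s x y \<le> Cp * h s x y / W x s" using pu sJ xy by blast
          also have "\<dots> \<le> Cp * (c * (u / s) powr \<gamma> * h u x y) / (W x u / (Cw * (u / s) powr d))"
          proof (rule frac_le)
            show "Cp * h s x y \<le> Cp * (c * (u / s) powr \<gamma> * h u x y)"
              using hg u su xy Cp by (intro mult_left_mono) auto
            show "0 < W x u / (Cw * (u / s) powr d)" using Wu Cw su u0 by simp
            have "W x u \<le> Cw * (u / s) powr d * W x s" using wg u su by blast
            then show "W x u / (Cw * (u / s) powr d) \<le> W x s" using Cw su u0 by (simp add: field_simps)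
            show "0 \<le> Cp * (c * (u / s) powr \<gamma> * h u x y)" using Cp c hu by simp
          qed
          also have "\<dots> = Cp * (c * Cw) * h u x y / W x u * ((u / s) powr \<gamma> * (u / s) powr d)"
            using Cw Wu by (simp add: field_simps)
          also have "(u / s) powr \<gamma> * (u / s) powr d = (u / s) powr (\<gamma> + d)" by (simp add: powr_add)
          also have "Cp * (c * Cw) * h u x y / W x u * (u / s) powr (\<gamma> + d) \<le> B * (u / s) powr (\<gamma> + d)"
            unfolding B_def using q Cp hu Wu by (intro mult_right_mono divide_right_mono mult_left_mono) auto
          finally have "ennreal (p s x y) \<le> ennreal B * ennreal ((u / s) powr (\<gamma> + d))"
            using B by (simp add: ennreal_leI flip: ennreal_mult)
          then show ?thesis using 2 by (simp add: distrib_left add_increasing)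
        next
          case 3
          have "p s x y \<le> Cp * h u x y / W x u" using pu u 3 xy by blast
          also have "\<dots> = Cp * 1 * h u x y / W x u" by simp
          also have "\<dots> \<le> B"
            unfolding B_def using q Cp hu Wu by (intro divide_right_mono mult_right_mono mult_left_mono) auto
          finally have "ennreal (p s x y) \<le> ennreal B" by (rule ennreal_leI)
          then show ?thesis using 3 by simp
        qed simp
      qed
      have meas: "(\<lambda>s. ennreal ((u / s) powr (\<gamma> + d)) * indicator {0<..<u} s) \<in> borel_measurable (\<mu> t)"
        by (subst measurable_cong_sets[OF sets_law[OF laws t] refl]) measurable
      have "subordinated \<mu> t x y \<le>
          (\<integral>\<^sup>+ s. ennreal B * (1 + ennreal ((u / s) powr (\<gamma> + d)) * indicator {0<..<u} s) \<partial>\<mu> t)"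
        by (intro nn_integral_mono pw)
      also have "\<dots> = ennreal B * (1 + (\<integral>\<^sup>+ s\<in>{0<..<u}. ennreal ((u / s) powr (\<gamma> + d)) \<partial>\<mu> t))"
        using meas by (simp add: nn_integral_cmult nn_integral_add emeasure_space_1)
      also have "\<dots> \<le> ennreal B * (1 + ennreal K)"
        using mom[OF laws t u u0 eq1] by (intro mult_left_mono add_left_mono) auto
      also have "\<dots> = ennreal (B * (1 + K))"
        using B K by (simp add: ennreal_mult ennreal_plus[symmetric] ennreal_1[symmetric] del: ennreal_plus ennreal_1)
      also have "B * (1 + K) = Cp * q * (1 + K) * h u x y / W x u" by (simp add: B_def)
      finally show "subordinated \<mu> t x y \<le> ennreal (Cp * q * (1 + K) * h u x y / W x u)" .
    qed
  qed
qed

lemma off_diagonal_local_upper: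
  assumes off: "\<exists>C>0. \<forall>x\<in>D. \<forall>y\<in>D. \<forall>s. R x y \<in> J \<and> 0 < s \<and> s \<le> R x y \<longrightarrow>
    p s x y \<le> C * h (R x y) x y / W x (R x y) * (s / R x y)"
  obtains C where "0 < C" "\<forall>\<mu> t. subordinator_laws \<phi> \<mu> \<longrightarrow> 0 < t \<longrightarrow>
    (\<forall>x\<in>D. \<forall>y\<in>D. R x y \<in> J \<longrightarrow>
      subordinated \<mu> t x y \<le> ennreal (C * (t * \<phi> (1 / R x y)) * h (R x y) x y / W x (R x y)))"
proof -
  obtain Cp where Cp: "0 < Cp" and pu: "\<forall>u\<in>J. \<forall>s\<ge>u. \<forall>x\<in>D. \<forall>y\<in>D. p s x y \<le> Cp * h u x y / W x u"
    using p_upper by blast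
  obtain C where C: "0 < C" and po: "\<forall>x\<in>D. \<forall>y\<in>D. \<forall>s. R x y \<in> J \<and> 0 < s \<and> s \<le> R x y \<longrightarrow>
    p s x y \<le> C * h (R x y) x y / W x (R x y) * (s / R x y)"
    using off by blast
  show ?thesis
  proof (rule that[of "2 * (C + Cp)"], goal_cases)
    case 1 then show ?case using C Cp by simp
  next
    case 2
    show ?case
    proof (intro allI impI ballI)
      fix \<mu> :: "real \<Rightarrow> real measure" and t :: real and x y assume laws: "subordinator_laws \<phi> \<mu>" and t: "0 < t"
        and xy: "x \<in> D" "y \<in> D" and u: "R x y \<in> J"
      define u where "u = R x y"
      note uJ = u[folded u_def]
      have u0: "0 < u" by (rule J_pos[OF uJ])
      have hu: "0 \<le> h u x y" by (rule h_nonneg[OF u0 xy])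
      have Wu: "0 < W x u" by (rule W_pos[OF u0])
      define B where "B = (C + Cp) * h u x y / W x u"
      have B: "0 \<le> B" using Cp C hu Wu by (simp add: B_def)
      have pw: "ennreal (p s x y) * indicator {0<..} s \<le> ennreal B * ennreal (min 1 (s / u))" for s
      proof (cases "0 < s")
        case s: True
        have "p s x y \<le> B * min 1 (s / u)"
        proof (cases "s \<le> u")
          case True
          have "p s x y \<le> C * h u x y / W x u * (s / u)" using po xy u s True unfolding u_def by blast
          also have "\<dots> \<le> B * (s / u)"
            unfolding B_def using C Cp hu Wu s u0 by (intro mult_right_mono divide_right_mono) auto
          finally show ?thesis using True u0 by simp
        next
          case False
          then have "p s x y \<le> Cp * h u x y / W x u" using pu uJ xy by force
          also have "\<dots> \<le> B"
            unfolding B_def using C Cp hu Wu by (intro mult_right_mono divide_right_mono) auto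
          finally show ?thesis using False u0 by simp
        qed
        then show ?thesis using s u0 B by (simp add: ennreal_leI flip: ennreal_mult)
      qed simp
      have "subordinated \<mu> t x y \<le> (\<integral>\<^sup>+ s. ennreal B * ennreal (min 1 (s / u)) \<partial>\<mu> t)"
        by (intro nn_integral_mono pw)
      also have "\<dots> = ennreal B * (\<integral>\<^sup>+ s. ennreal (min 1 (s / u)) \<partial>\<mu> t)"
      proof (rule nn_integral_cmult)
        show "(\<lambda>s. ennreal (min 1 (s / u))) \<in> borel_measurable (\<mu> t)"
          by (subst measurable_cong_sets[OF sets_law[OF laws t] refl]) measurable
      qed
      also have "\<dots> \<le> ennreal B * ennreal (2 * (t * \<phi> (1 / u)))"
        by (intro mult_left_mono law_truncated_mean[OF laws t u0]) simp
      also have "\<dots> = ennreal (2 * (C + Cp) * (t * \<phi> (1 / u)) * h u x y / W x u)"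
        by (subst ennreal_mult'[OF B, symmetric]) (simp add: B_def algebra_simps)
      finally show "subordinated \<mu> t x y \<le>
          ennreal (2 * (C + Cp) * (t * \<phi> (1 / R x y)) * h (R x y) x y / W x (R x y))"
        by (simp only: u_def)
    qed
  qed
qed

end

section \<open>The jump regime\<close>

lemma ennreal_bound_add:
  fixes A B T :: ennreal
  assumes "A \<le> ennreal a * T" "B \<le> ennreal b * T" "0 \<le> a" "0 \<le> b"
  shows "A + B \<le> ennreal (a + b) * T"
  using add_mono[OF assms(1,2)] assms(3,4) by (simp add: distrib_right)

lemma ennreal_bound_trans:
  fixes A B T :: ennreal
  assumes "A \<le> ennreal a * B" "B \<le> ennreal b * T" "0 \<le> a"
  shows "A \<le> ennreal (a * b) * T"
proof -
  note assms(1)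
  also have "ennreal a * B \<le> ennreal a * (ennreal b * T)"
    using assms(2) by (rule mult_left_mono) simp
  also have "\<dots> = ennreal (a * b) * T"
    using assms(3) by (simp add: ennreal_mult' mult.assoc)
  finally show ?thesis .
qed

context kernel_bounds
begin

context
  fixes w :: "real \<Rightarrow> real" and R :: "'a \<Rightarrow> 'a \<Rightarrow> real" and K :: real
  assumes \<phi>_mono: "\<And>l l'. 0 < l \<Longrightarrow> l \<le> l' \<Longrightarrow> \<phi> l \<le> \<phi> l'"
    and w_nonneg: "\<And>u. 0 \<le> w u" and w_anti: "\<And>u v. 0 < v \<Longrightarrow> v \<le> u \<Longrightarrow> w u \<le> w v"
    and w_le: "\<And>u. 0 < u \<Longrightarrow> w u \<le> 2 * \<phi> (1 / u)"
    and K: "0 < K" and le_w: "\<And>u. u \<in> J \<Longrightarrow> \<phi> (1 / u) \<le> K * w u"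
begin

lemma cutoff_measurable:
  assumes xy: "x \<in> D" "y \<in> D"
  shows "(\<lambda>u. indicator {0<..} u * h u x y) \<in> borel_measurable borel"
    "(\<lambda>u. indicator {0<..} u * w u) \<in> borel_measurable borel"
  using h_anti xy w_anti by (intro antimono_on_pos_measurable; blast)+

lemma jump_integrand_measurable:
  assumes xy: "x \<in> D" "y \<in> D" and a: "0 < a"
  shows "(\<lambda>u. ennreal (h u x y * w u) * indicator {a..L} u) \<in> borel_measurable lborel"
proof -
  have gen: "(\<lambda>u. ennreal (f u * g u) * indicator {a..L} u) \<in> borel_measurable borel"
    if [measurable]: "f \<in> borel_measurable borel" "g \<in> borel_measurable borel" for f g :: "real \<Rightarrow> real"
    by measurable
  have "(\<lambda>u. ennreal (indicator {0<..} u * h u x y * (indicator {0<..} u * w u)) * indicator {a..L} u) =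
      (\<lambda>u. ennreal (h u x y * w u) * indicator {a..L} u)"
    using a by (auto simp: fun_eq_iff indicator_def)
  then show ?thesis using gen[OF cutoff_measurable[OF xy]] by simp
qed

text \<open>
  The integral in the claim starts at \<open>2 \<tau>\<close>, but the mean of \<open>h(S) S\<close> produces one that starts at \<open>\<tau>\<close>. The part
  between is bounded by the value of the integrand at \<open>\<tau>\<close>.
\<close>

lemma jump_integral_split:
  assumes xy: "x \<in> D" "y \<in> D" and u: "0 < u" "2 * u \<le> L"
  shows "(\<integral>\<^sup>+ s\<in>{u..L}. ennreal (h s x y * w s) \<partial>lborel) \<le>
    ennreal (u * h u x y * w u) + (\<integral>\<^sup>+ s\<in>{2 * u..L}. ennreal (h s x y * w s) \<partial>lborel)"
proof -
  have "(\<integral>\<^sup>+ s\<in>{u..L}. ennreal (h s x y * w s) \<partial>lborel) \<le>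
    (\<integral>\<^sup>+ s. ennreal (h u x y * w u) * indicator {u..2 * u} s + ennreal (h s x y * w s) * indicator {2 * u..L} s \<partial>lborel)"
  proof (rule nn_integral_mono)
    fix s
    have le: "ennreal (h s x y * w s) \<le> ennreal (h u x y * w u)" if "u \<le> s"
      using that u h_anti[OF u(1) that xy] w_anti[OF u(1) that] w_nonneg h_nonneg[OF u(1) xy]
      by (intro ennreal_leI mult_mono) auto
    show "ennreal (h s x y * w s) * indicator {u..L} s \<le>
      ennreal (h u x y * w u) * indicator {u..2 * u} s + ennreal (h s x y * w s) * indicator {2 * u..L} s"
    proof -
      consider "s < u" | "u \<le> s" "s \<le> 2 * u" | "2 * u < s" by linarith
      then show ?thesis
        using le u by cases (simp_all add: indicator_def add_increasing2)
    qed
  qed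
  also have "\<dots> = (\<integral>\<^sup>+ s. ennreal (h u x y * w u) * indicator {u..2 * u} s \<partial>lborel) +
      (\<integral>\<^sup>+ s\<in>{2 * u..L}. ennreal (h s x y * w s) \<partial>lborel)"
    by (rule nn_integral_add) (use jump_integrand_measurable[OF xy, of "2 * u" L] u in simp_all)
  also have "(\<integral>\<^sup>+ s. ennreal (h u x y * w u) * indicator {u..2 * u} s \<partial>lborel) = ennreal (u * h u x y * w u)"
    using u h_nonneg[OF u(1) xy] w_nonneg[of u]
    by (subst nn_integral_cmult_indicator) (simp_all add: mult_ac flip: ennreal_mult')
  finally show ?thesis .
qed

lemma jump_integral_ge:
  assumes xy: "x \<in> D" "y \<in> D" and u: "0 < a" "a \<le> u" "2 * u \<le> L"
  shows "ennreal (u * h (2 * u) x y * w (2 * u)) \<le> (\<integral>\<^sup>+ s\<in>{a..L}. ennreal (h s x y * w s) \<partial>lborel)"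
proof -
  have u0: "0 < u" "0 < 2 * u" using u by auto
  have "ennreal (u * h (2 * u) x y * w (2 * u)) =
      (\<integral>\<^sup>+ s. ennreal (h (2 * u) x y * w (2 * u)) * indicator {u..2 * u} s \<partial>lborel)"
    using u0 h_nonneg[OF u0(2) xy] w_nonneg[of "2 * u"]
    by (subst nn_integral_cmult_indicator) (simp_all add: mult_ac flip: ennreal_mult')
  also have "\<dots> \<le> (\<integral>\<^sup>+ s\<in>{a..L}. ennreal (h s x y * w s) \<partial>lborel)"
  proof (rule nn_integral_mono)
    fix s
    show "ennreal (h (2 * u) x y * w (2 * u)) * indicator {u..2 * u} s \<le> ennreal (h s x y * w s) * indicator {a..L} s"
    proof (cases "u \<le> s \<and> s \<le> 2 * u")
      case True
      then have s: "0 < s" "s \<le> 2 * u" using u0 by auto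
      have "ennreal (h (2 * u) x y * w (2 * u)) \<le> ennreal (h s x y * w s)"
        using h_anti[OF s xy] w_anti[OF s] w_nonneg h_nonneg[OF s(1) xy]
        by (intro ennreal_leI mult_mono) auto
      then show ?thesis using True u by (simp add: indicator_def)
    qed (auto simp: indicator_def)
  qed
  finally show ?thesis .
qed

text \<open>
  For \<open>u \<ge> \<tau>\<close> the block \<open>{a u<..u}\<close> has probability at least a multiple of \<open>t \<phi> (1/u)\<close>, hence of \<open>t w(u)\<close>.
\<close>

lemma off_diagonal_jump_lower:
  assumes off: "\<exists>c>0. \<forall>x\<in>D. \<forall>y\<in>D. \<forall>s. 4 * R x y \<in> J \<and> 0 < s \<and> s \<le> 4 * R x y \<longrightarrow>
    c * h s x y / W x (R x y) * (s / R x y) \<le> p s x y"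
  obtains c where "0 < c" "\<forall>\<mu> t \<tau>. subordinator_laws \<phi> \<mu> \<longrightarrow> 0 < t \<longrightarrow> 0 < \<tau> \<longrightarrow> t * \<phi> (1 / \<tau>) = 1 \<longrightarrow>
    (\<forall>x\<in>D. \<forall>y\<in>D. \<tau> \<le> R x y \<longrightarrow> 4 * R x y \<in> J \<longrightarrow>
      ennreal (c * t / (R x y * W x (R x y))) * (\<integral>\<^sup>+ u\<in>{2 * \<tau>..4 * R x y}. ennreal (h u x y * w u) \<partial>lborel)
      \<le> subordinated \<mu> t x y)"
proof -
  obtain a c0 where a: "0 < a" "a < 1" and c0: "0 < c0" and
    blk: "\<And>\<mu> t R. subordinator_laws \<phi> \<mu> \<Longrightarrow> 0 < t \<Longrightarrow> R \<in> J \<Longrightarrow> 0 < R \<Longrightarrow> t * \<phi> (1 / R) \<le> 1 \<Longrightarrow>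
      c0 * (t * \<phi> (1 / R)) \<le> measure (\<mu> t) {a * R<..R}"
  proof -
    have "\<forall>l>0. 0 < \<phi> l" "\<forall>u\<in>J. \<forall>v. 0 < v \<and> v \<le> u \<longrightarrow> v \<in> J"
      using \<phi>_pos J_down by blast+
    from law_block_ge[OF \<phi>_scaling d1 d2 this] show ?thesis using that by blast
  qed
  obtain c1 where c1: "0 < c1" and lo: "\<forall>x\<in>D. \<forall>y\<in>D. \<forall>s. 4 * R x y \<in> J \<and> 0 < s \<and> s \<le> 4 * R x y \<longrightarrow>
    c1 * h s x y / W x (R x y) * (s / R x y) \<le> p s x y"
    using off by blast
  show ?thesis
  proof (rule that[of "c1 * a * (c0 / 2)"], goal_cases)
    case 1 then show ?case using a c0 c1 by simp
  next
    case 2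
    show ?case
    proof (intro allI impI ballI)
      fix \<mu> :: "real \<Rightarrow> real measure" and t \<tau> :: real and x y
      assume laws: "subordinator_laws \<phi> \<mu>" and t: "0 < t" and \<tau>: "0 < \<tau>" "t * \<phi> (1 / \<tau>) = 1"
        and xy: "x \<in> D" "y \<in> D" and R: "\<tau> \<le> R x y" "4 * R x y \<in> J"
      interpret prob_space "\<mu> t" by (rule prob_space_law[OF laws t])
      define r where "r = R x y"
      have r: "0 < r" "\<tau> \<le> r" "4 * r \<in> J" using R \<tau> by (auto simp: r_def)
      have Wr: "0 < W x r" by (rule W_pos[OF r(1)])
      define Q where "Q = r * W x r"
      have Q: "0 < Q" using r Wr by (simp add: Q_def)
      let ?H = "\<lambda>u. indicator {0<..} u * h u x y"
      have Hm: "?H \<in> borel_measurable borel" by (rule cutoff_measurable[OF xy])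
      have H0: "0 \<le> ?H s" for s using h_nonneg[OF _ xy, of s] by (simp add: indicator_def)
      have Ha: "?H u \<le> ?H s" if "0 < s" "s \<le> u" for s u
        using h_anti[OF that xy] that by (simp add: indicator_def)
      have mono: "t * \<phi> (1 / u) \<le> 1" if "\<tau> \<le> u" for u
      proof -
        have "\<phi> (1 / u) \<le> \<phi> (1 / \<tau>)" using that \<tau> by (intro \<phi>_mono frac_le) auto
        then have "t * \<phi> (1 / u) \<le> t * \<phi> (1 / \<tau>)" using t by (intro mult_left_mono) auto
        then show ?thesis using \<tau> by simp
      qed
      have pw: "ennreal (h u x y * w u) * indicator {2 * \<tau>..4 * r} u * ennreal (c0 / 2 * t) \<le>
        ennreal (?H u) * emeasure (\<mu> t) {a * u<..u} * indicator {2 * \<tau>..4 * r} u" for u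
      proof (cases "u \<in> {2 * \<tau>..4 * r}")
        case True
        then have u: "0 < u" "\<tau> \<le> u" "u \<le> 4 * r" using \<tau> by auto
        have uJ: "u \<in> J" by (rule J_down[OF r(3) u(1,3)])
        have "c0 / 2 * t * w u \<le> c0 / 2 * t * (2 * \<phi> (1 / u))"
          using w_le[OF u(1)] c0 t by (intro mult_left_mono) auto
        also have "\<dots> = c0 * (t * \<phi> (1 / u))" by simp
        also have "\<dots> \<le> measure (\<mu> t) {a * u<..u}"
          by (rule blk[OF laws t uJ u(1) mono[OF u(2)]])
        finally have "h u x y * (c0 / 2 * t * w u) \<le> h u x y * measure (\<mu> t) {a * u<..u}"
          using h_nonneg[OF u(1) xy] by (intro mult_left_mono)
        then have "ennreal (h u x y * w u * (c0 / 2 * t)) \<le> ennreal (h u x y * measure (\<mu> t) {a * u<..u})"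
          by (intro ennreal_leI) (simp add: mult_ac)
        also have "\<dots> = ennreal (h u x y) * emeasure (\<mu> t) {a * u<..u}"
          using h_nonneg[OF u(1) xy] by (simp add: emeasure_eq_measure ennreal_mult)
        also have "ennreal (h u x y * w u * (c0 / 2 * t)) = ennreal (h u x y * w u) * ennreal (c0 / 2 * t)"
          using h_nonneg[OF u(1) xy] w_nonneg[of u] by (subst ennreal_mult') simp_all
        finally show ?thesis using True u by simp
      qed simp
      let ?I = "\<integral>\<^sup>+ u\<in>{2 * \<tau>..4 * r}. ennreal (h u x y * w u) \<partial>lborel"
      have Im: "(\<lambda>u. ennreal (h u x y * w u) * indicator {2 * \<tau>..4 * r} u) \<in> borel_measurable lborel"
        using \<tau> by (intro jump_integrand_measurable[OF xy]) simp
      have e1: "ennreal (c1 * a * (c0 / 2) * t / Q) * ?I = ennreal (c1 / Q) * (ennreal a * (?I * ennreal (c0 / 2 * t)))"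
      proof -
        have "c1 * a * (c0 / 2) * t / Q = (c1 / Q) * (a * (c0 / 2 * t))" by simp
        then have "ennreal (c1 * a * (c0 / 2) * t / Q) = ennreal (c1 / Q) * (ennreal a * ennreal (c0 / 2 * t))"
          using c1 Q a by (simp only: ennreal_mult' less_imp_le divide_pos_pos)
        then show ?thesis by (simp only: mult_ac)
      qed
      have "?I * ennreal (c0 / 2 * t) =
          (\<integral>\<^sup>+ u. ennreal (h u x y * w u) * indicator {2 * \<tau>..4 * r} u * ennreal (c0 / 2 * t) \<partial>lborel)"
        by (rule nn_integral_multc[OF Im, symmetric])
      also have "\<dots> \<le> (\<integral>\<^sup>+ u\<in>{2 * \<tau>..4 * r}. ennreal (?H u) * emeasure (\<mu> t) {a * u<..u} \<partial>lborel)"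
        by (intro nn_integral_mono pw)
      finally have e2: "ennreal a * (?I * ennreal (c0 / 2 * t)) \<le>
          ennreal a * (\<integral>\<^sup>+ u\<in>{2 * \<tau>..4 * r}. ennreal (?H u) * emeasure (\<mu> t) {a * u<..u} \<partial>lborel)"
        by (rule mult_left_mono) simp
      also have "\<dots> \<le> (\<integral>\<^sup>+ s\<in>{0<..4 * r}. ennreal (?H s * s) \<partial>\<mu> t)"
        by (rule law_weighted_block_le[OF laws t Hm H0 Ha]) (use \<tau> a in simp_all)
      finally have e3: "ennreal (c1 / Q) * (ennreal a * (?I * ennreal (c0 / 2 * t))) \<le>
          ennreal (c1 / Q) * (\<integral>\<^sup>+ s\<in>{0<..4 * r}. ennreal (?H s * s) \<partial>\<mu> t)"
        by (rule mult_left_mono) simp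
      note e1
      also note e3
      also have "ennreal (c1 / Q) * (\<integral>\<^sup>+ s\<in>{0<..4 * r}. ennreal (?H s * s) \<partial>\<mu> t) =
          (\<integral>\<^sup>+ s. ennreal (c1 / Q) * (ennreal (?H s * s) * indicator {0<..4 * r} s) \<partial>\<mu> t)"
      proof (rule nn_integral_cmult[symmetric])
        note [measurable] = Hm
        show "(\<lambda>s. ennreal (?H s * s) * indicator {0<..4 * r} s) \<in> borel_measurable (\<mu> t)"
          by (subst measurable_cong_sets[OF sets_law[OF laws t] refl]) measurable
      qed
      also have "\<dots> \<le> subordinated \<mu> t x y"
      proof (rule nn_integral_mono)
        fix s
        show "ennreal (c1 / Q) * (ennreal (?H s * s) * indicator {0<..4 * r} s) \<le> ennreal (p s x y) * indicator {0<..} s"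
        proof (cases "0 < s \<and> s \<le> 4 * r")
          case True
          have "c1 * h s x y / W x r * (s / r) \<le> p s x y"
            using lo xy r True unfolding r_def by blast
          then have "(c1 / Q) * (h s x y * s) \<le> p s x y" by (simp add: Q_def mult_ac)
          then have "ennreal (c1 / Q) * ennreal (h s x y * s) \<le> ennreal (p s x y)"
            using c1 Q by (subst ennreal_mult'[symmetric]) (auto intro: ennreal_leI)
          then show ?thesis using True by simp
        qed (auto simp: indicator_def)
      qed
      finally show "ennreal (c1 * a * (c0 / 2) * t / (R x y * W x (R x y))) *
          (\<integral>\<^sup>+ u\<in>{2 * \<tau>..4 * R x y}. ennreal (h u x y * w u) \<partial>lborel)
        \<le> subordinated \<mu> t x y"
        by (simp only: Q_def r_def)
    qed
  qed
qed

text \<open>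
  Below \<open>2 \<tau>\<close> the mean of \<open>h(S) S\<close> is of order \<open>\<tau> h(\<tau>)\<close>: above \<open>\<tau>\<close> by monotonicity of \<open>h\<close>, below \<open>\<tau>\<close>
  because \<open>h(s)\<close> exceeds \<open>h(\<tau>)\<close> at most by a constant multiple of a power of \<open>\<tau> / s\<close>, which has bounded mean.
\<close>

lemma small_time_contribution:
  obtains k where "0 < k" "\<forall>\<mu> t \<tau>. subordinator_laws \<phi> \<mu> \<longrightarrow> 0 < t \<longrightarrow> \<tau> \<in> J \<longrightarrow> t * \<phi> (1 / \<tau>) = 1 \<longrightarrow>
    (\<forall>x\<in>D. \<forall>y\<in>D. (\<integral>\<^sup>+ s\<in>{0<..2 * \<tau>}. ennreal (h s x y * s) \<partial>\<mu> t) \<le> ennreal k * ennreal (\<tau> * h \<tau> x y))"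
proof -
  obtain c \<gamma> where c: "0 < c" "0 \<le> \<gamma>" and hg:
    "\<forall>t\<in>J. \<forall>s. 0 < s \<and> s \<le> t \<longrightarrow> (\<forall>x\<in>D. \<forall>y\<in>D. h s x y \<le> c * (t / s) powr \<gamma> * h t x y)"
    by (rule h_growth)
  obtain Km where Km: "0 < Km" and mom:
    "\<And>\<mu> t \<tau>. subordinator_laws \<phi> \<mu> \<Longrightarrow> 0 < t \<Longrightarrow> \<tau> \<in> J \<Longrightarrow> 0 < \<tau> \<Longrightarrow> t * \<phi> (1 / \<tau>) = 1 \<Longrightarrow>
      (\<integral>\<^sup>+ s\<in>{0<..<\<tau>}. ennreal ((\<tau> / s) powr \<gamma>) \<partial>\<mu> t) \<le> ennreal Km"
    using law_negative_moment[OF \<phi>_scaling d1 c(2)] by blast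
  show ?thesis
  proof (rule that[of "2 + c * Km"], goal_cases)
    case 1 then show ?case using c Km by (simp add: add_pos_pos)
  next
    case 2
    show ?case
    proof (intro allI impI ballI)
      fix \<mu> :: "real \<Rightarrow> real measure" and t \<tau> :: real and x y
      assume laws: "subordinator_laws \<phi> \<mu>" and t: "0 < t" and \<tau>J: "\<tau> \<in> J" and \<tau>: "t * \<phi> (1 / \<tau>) = 1"
        and xy: "x \<in> D" "y \<in> D"
      interpret prob_space "\<mu> t" by (rule prob_space_law[OF laws t])
      have \<tau>0: "0 < \<tau>" by (rule J_pos[OF \<tau>J])
      define B where "B = \<tau> * h \<tau> x y"
      have B: "0 \<le> B" using \<tau>0 h_nonneg[OF \<tau>0 xy] by (simp add: B_def)
      let ?f = "\<lambda>s. ennreal ((\<tau> / s) powr \<gamma>) * indicator {0<..<\<tau>} s"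
      have f: "?f \<in> borel_measurable (\<mu> t)"
        by (subst measurable_cong_sets[OF sets_law[OF laws t] refl]) measurable
      have pw: "ennreal (h s x y * s) * indicator {0<..2 * \<tau>} s \<le> ennreal B * (2 + ennreal c * ?f s)" for s
      proof -
        consider "s \<le> 0 \<or> 2 * \<tau> < s" | "0 < s" "s < \<tau>" | "\<tau> \<le> s" "s \<le> 2 * \<tau>" "0 < s"
          using \<tau>0 by linarith
        then show ?thesis
        proof cases
          case 1
          then show ?thesis by (auto simp: indicator_def)
        next
          case 2
          then have s: "0 < s" "s \<le> \<tau>" by auto
          have "h s x y * s \<le> (c * (\<tau> / s) powr \<gamma> * h \<tau> x y) * \<tau>"
            using hg \<tau>J s xy h_nonneg[OF s(1) xy] h_nonneg[OF \<tau>0 xy] c by (intro mult_mono) auto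
          also have "\<dots> = B * (c * (\<tau> / s) powr \<gamma>)" by (simp add: B_def mult_ac)
          finally have "ennreal (h s x y * s) \<le> ennreal (B * (c * (\<tau> / s) powr \<gamma>))" by (rule ennreal_leI)
          also have "\<dots> = ennreal B * (ennreal c * ennreal ((\<tau> / s) powr \<gamma>))"
            using B c by (simp add: ennreal_mult')
          also have "\<dots> \<le> ennreal B * (2 + ennreal c * ?f s)"
            using 2 by (intro mult_left_mono) (simp_all add: add_increasing)
          finally show ?thesis using 2 \<tau>0 by simp
        next
          case 3
          have "h s x y * s \<le> h \<tau> x y * (2 * \<tau>)"
            using h_anti[OF \<tau>0 3(1) xy] 3 h_nonneg[OF \<tau>0 xy] by (intro mult_mono) auto
          also have "\<dots> = B * 2" by (simp add: B_def)
          finally have "ennreal (h s x y * s) \<le> ennreal (B * 2)" by (rule ennreal_leI)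
          also have "\<dots> = ennreal B * 2" using B by (simp add: ennreal_mult')
          also have "\<dots> \<le> ennreal B * (2 + ennreal c * ?f s)"
            by (intro mult_left_mono) simp_all
          finally show ?thesis using 3 by simp
        qed
      qed
      have "(\<integral>\<^sup>+ s\<in>{0<..2 * \<tau>}. ennreal (h s x y * s) \<partial>\<mu> t) \<le> (\<integral>\<^sup>+ s. ennreal B * (2 + ennreal c * ?f s) \<partial>\<mu> t)"
        by (intro nn_integral_mono pw)
      also have "\<dots> = ennreal B * (2 + ennreal c * (\<integral>\<^sup>+ s. ?f s \<partial>\<mu> t))"
        using f by (simp add: nn_integral_cmult nn_integral_add emeasure_space_1)
      also have "\<dots> \<le> ennreal B * (2 + ennreal c * ennreal Km)"
        using mom[OF laws t \<tau>J \<tau>0 \<tau>] by (intro mult_left_mono add_left_mono) auto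
      also have "2 + ennreal c * ennreal Km = ennreal (2 + c * Km)"
        using c Km by (simp add: ennreal_plus ennreal_mult')
      finally show "(\<integral>\<^sup>+ s\<in>{0<..2 * \<tau>}. ennreal (h s x y * s) \<partial>\<mu> t) \<le>
          ennreal (2 + c * Km) * ennreal (\<tau> * h \<tau> x y)"
        by (simp only: B_def mult.commute)
    qed
  qed
qed

text \<open>
  The integral contains the interval \<open>[2 \<tau>, 4 \<tau>]\<close>, on which the integrand is at least its value at \<open>4 \<tau>\<close>. The scaling
  properties compare this with the value at \<open>\<tau>\<close>, and \<open>t \<phi> (1/\<tau>) = 1\<close>. The upper end of the integral has to be at
  least \<open>4 \<tau>\<close>, which holds because it is \<open>4 R\<close> with \<open>\<tau> \<le> R\<close>.
\<close>

lemma small_time_le_jump_integral: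
  obtains k where "0 < k" "\<forall>t \<tau> L. 0 < t \<longrightarrow> 0 < \<tau> \<longrightarrow> 4 * \<tau> \<in> J \<longrightarrow> 4 * \<tau> \<le> L \<longrightarrow> t * \<phi> (1 / \<tau>) = 1 \<longrightarrow>
    (\<forall>x\<in>D. \<forall>y\<in>D. ennreal (\<tau> * h \<tau> x y) \<le>
      ennreal k * (ennreal t * (\<integral>\<^sup>+ u\<in>{2 * \<tau>..L}. ennreal (h u x y * w u) \<partial>lborel)))"
proof -
  obtain c \<gamma> where c: "0 < c" "0 \<le> \<gamma>" and hg:
    "\<forall>t\<in>J. \<forall>s. 0 < s \<and> s \<le> t \<longrightarrow> (\<forall>x\<in>D. \<forall>y\<in>D. h s x y \<le> c * (t / s) powr \<gamma> * h t x y)"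
    by (rule h_growth)
  obtain C where C: "0 < C"
    and scu: "\<forall>u\<in>J. \<forall>v. 0 < v \<and> v \<le> u \<longrightarrow> \<phi> (1 / v) \<le> C * (u / v) powr d2 * \<phi> (1 / u)"
    using \<phi>_scaling unfolding weak_scaling_def by blast
  define k where "k = (c * 4 powr \<gamma>) * (C * 4 powr d2 * K) / 2"
  show ?thesis
  proof (rule that[of k], goal_cases)
    case 1 then show ?case using c C K by (simp add: k_def)
  next
    case 2
    show ?case
    proof (intro allI impI ballI)
      fix t \<tau> L :: real and x y
      assume t: "0 < t" and \<tau>: "0 < \<tau>" "4 * \<tau> \<in> J" "4 * \<tau> \<le> L" "t * \<phi> (1 / \<tau>) = 1" and xy: "x \<in> D" "y \<in> D"
      have le: "0 < \<tau> \<and> \<tau> \<le> 4 * \<tau>" and \<tau>4: "0 < 4 * \<tau>" using \<tau> by auto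
      have "h \<tau> x y \<le> c * (4 * \<tau> / \<tau>) powr \<gamma> * h (4 * \<tau>) x y" using hg \<tau>(2) le xy by blast
      then have h4: "h \<tau> x y \<le> c * 4 powr \<gamma> * h (4 * \<tau>) x y" using \<tau> by simp
      have "\<phi> (1 / \<tau>) \<le> C * (4 * \<tau> / \<tau>) powr d2 * \<phi> (1 / (4 * \<tau>))" using scu \<tau>(2) le by blast
      also have "\<dots> \<le> C * (4 * \<tau> / \<tau>) powr d2 * (K * w (4 * \<tau>))"
        using le_w[OF \<tau>(2)] C by (intro mult_left_mono) auto
      finally have f4: "\<phi> (1 / \<tau>) \<le> C * 4 powr d2 * K * w (4 * \<tau>)" using \<tau> by simp
      have "\<tau> * h \<tau> x y = \<tau> * t * (h \<tau> x y * \<phi> (1 / \<tau>))" using \<tau>(4) by (simp add: mult_ac)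
      also have "\<dots> \<le> \<tau> * t * ((c * 4 powr \<gamma> * h (4 * \<tau>) x y) * (C * 4 powr d2 * K * w (4 * \<tau>)))"
        using h4 f4 \<tau> t c h_nonneg[OF \<tau>4 xy] \<phi>_pos[of "1 / \<tau>"]
        by (intro mult_left_mono mult_mono) auto
      also have "\<dots> = k * (t * (2 * \<tau> * h (2 * (2 * \<tau>)) x y * w (2 * (2 * \<tau>))))"
        by (simp add: k_def mult_ac)
      finally have "ennreal (\<tau> * h \<tau> x y) \<le> ennreal (k * (t * (2 * \<tau> * h (2 * (2 * \<tau>)) x y * w (2 * (2 * \<tau>)))))"
        by (rule ennreal_leI)
      also have "\<dots> = ennreal k * (ennreal t * ennreal (2 * \<tau> * h (2 * (2 * \<tau>)) x y * w (2 * (2 * \<tau>))))"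
        using t c C K by (subst ennreal_mult', simp add: k_def) (subst ennreal_mult', simp_all)
      also have "\<dots> \<le> ennreal k * (ennreal t * (\<integral>\<^sup>+ u\<in>{2 * \<tau>..L}. ennreal (h u x y * w u) \<partial>lborel))"
        using \<tau> by (intro mult_left_mono jump_integral_ge[OF xy]) simp_all
      finally show "ennreal (\<tau> * h \<tau> x y) \<le>
        ennreal k * (ennreal t * (\<integral>\<^sup>+ u\<in>{2 * \<tau>..L}. ennreal (h u x y * w u) \<partial>lborel))" .
    qed
  qed
qed

text \<open>
  The times split into three ranges. Up to \<open>2 \<tau>\<close> the contribution is of order \<open>\<tau> h(\<tau>)\<close>. Between \<open>2 \<tau>\<close> and
  \<open>4 R\<close> it is a weighted tail. After \<open>4 R\<close> the kernel is at most its size at \<open>4 R\<close>, and the tail at \<open>4 R\<close> is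
  bounded by the part of the integral over \<open>[2 R, 4 R]\<close>.
\<close>

lemma off_diagonal_jump_upper:
  assumes off: "\<exists>C>0. \<forall>x\<in>D. \<forall>y\<in>D. \<forall>s. R x y \<in> J \<and> 0 < s \<and> s \<le> R x y \<longrightarrow>
    p s x y \<le> C * h s x y / W x (R x y) * (s / R x y)"
  obtains C where "0 < C" "\<forall>\<mu> t \<tau>. subordinator_laws \<phi> \<mu> \<longrightarrow> 0 < t \<longrightarrow> 0 < \<tau> \<longrightarrow> t * \<phi> (1 / \<tau>) = 1 \<longrightarrow>
    (\<forall>x\<in>D. \<forall>y\<in>D. \<tau> \<le> R x y \<longrightarrow> 4 * R x y \<in> J \<longrightarrow>
      subordinated \<mu> t x y \<le>
      ennreal (C * t / (R x y * W x (R x y))) * (\<integral>\<^sup>+ u\<in>{2 * \<tau>..4 * R x y}. ennreal (h u x y * w u) \<partial>lborel))"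
proof -
  obtain Cp where Cp: "0 < Cp" and pu: "\<forall>u\<in>J. \<forall>s\<ge>u. \<forall>x\<in>D. \<forall>y\<in>D. p s x y \<le> Cp * h u x y / W x u"
    using p_upper by blast
  obtain C where C: "0 < C" and po: "\<forall>x\<in>D. \<forall>y\<in>D. \<forall>s. R x y \<in> J \<and> 0 < s \<and> s \<le> R x y \<longrightarrow>
    p s x y \<le> C * h s x y / W x (R x y) * (s / R x y)"
    using off by blast
  obtain k1 where k1: "0 < k1" and st: "\<forall>\<mu> t \<tau>. subordinator_laws \<phi> \<mu> \<longrightarrow> 0 < t \<longrightarrow> \<tau> \<in> J \<longrightarrow> t * \<phi> (1 / \<tau>) = 1 \<longrightarrow>
    (\<forall>x\<in>D. \<forall>y\<in>D. (\<integral>\<^sup>+ s\<in>{0<..2 * \<tau>}. ennreal (h s x y * s) \<partial>\<mu> t) \<le> ennreal k1 * ennreal (\<tau> * h \<tau> x y))"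
    by (rule small_time_contribution)
  obtain k where k: "0 < k" and X: "\<forall>t \<tau> L. 0 < t \<longrightarrow> 0 < \<tau> \<longrightarrow> 4 * \<tau> \<in> J \<longrightarrow> 4 * \<tau> \<le> L \<longrightarrow> t * \<phi> (1 / \<tau>) = 1 \<longrightarrow>
    (\<forall>x\<in>D. \<forall>y\<in>D. ennreal (\<tau> * h \<tau> x y) \<le>
      ennreal k * (ennreal t * (\<integral>\<^sup>+ u\<in>{2 * \<tau>..L}. ennreal (h u x y * w u) \<partial>lborel)))"
    by (rule small_time_le_jump_integral)
  define C0 where "C0 = C + Cp"
  have C0: "0 < C0" "C \<le> C0" "Cp \<le> C0" using C Cp by (auto simp: C0_def)
  define k' where "k' = k1 * k + (8 * K * k + 4 * K) + K"
  have k': "0 < k'" using k1 k K by (simp add: k'_def add_pos_pos)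
  show ?thesis
  proof (rule that[of "C0 * k'"], goal_cases)
    case 1 then show ?case using C0 k' by simp
  next
    case 2
    show ?case
    proof (intro allI impI ballI)
      fix \<mu> :: "real \<Rightarrow> real measure" and t \<tau> :: real and x y
      assume laws: "subordinator_laws \<phi> \<mu>" and t: "0 < t" and \<tau>: "0 < \<tau>" "t * \<phi> (1 / \<tau>) = 1"
        and xy: "x \<in> D" "y \<in> D" and R: "\<tau> \<le> R x y" "4 * R x y \<in> J"
      interpret prob_space "\<mu> t" by (rule prob_space_law[OF laws t])
      note S = sets_law[OF laws t]
      define r where "r = R x y"
      have r: "0 < r" "\<tau> \<le> r" "4 * r \<in> J" "0 < 4 * r" using R \<tau> by (auto simp: r_def)
      have rJ: "r \<in> J" by (rule J_down[OF r(3)]) (use r in auto)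
      have \<tau>J: "\<tau> \<in> J" "4 * \<tau> \<in> J" by (rule J_down[OF r(3)]; use r \<tau> in simp)+
      have Wr: "0 < W x r" by (rule W_pos[OF r(1)])
      define Q where "Q = r * W x r"
      have Q: "0 < Q" using r Wr by (simp add: Q_def)
      define I where "I = (\<integral>\<^sup>+ u\<in>{2 * \<tau>..4 * r}. ennreal (h u x y * w u) \<partial>lborel)"
      define T where "T = ennreal t * I"
      let ?H = "\<lambda>u. indicator {0<..} u * h u x y"
      have Hm: "?H \<in> borel_measurable borel" by (rule cutoff_measurable[OF xy])
      have H0: "0 \<le> ?H s" for s using h_nonneg[OF _ xy, of s] by (simp add: indicator_def)
      have Ha: "?H u \<le> ?H s" if "0 < s" "s \<le> u" for s u
        using h_anti[OF that xy] that by (simp add: indicator_def)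
      \<comment> \<open>the contributions of early, intermediate and late times\<close>
      define A where "A = (\<lambda>s. ennreal (h s x y * s) * indicator {0<..2 * \<tau>} s)"
      define B where "B = (\<lambda>s. ennreal (h s x y * s) * indicator {2 * \<tau><..4 * r} s)"
      define E where "E = (\<lambda>s. ennreal (r * h (4 * r) x y) * indicator {4 * r..} s)"
      have B_eq: "B = (\<lambda>s. ennreal (?H s * s) * indicator {2 * \<tau><..4 * r} s)"
        using \<tau> by (auto simp: B_def fun_eq_iff indicator_def)
      have A_eq: "A = (\<lambda>s. ennreal (?H s * s) * indicator {0<..2 * \<tau>} s)"
        by (auto simp: A_def fun_eq_iff indicator_def)
      have meas: "A \<in> borel_measurable (\<mu> t)" "B \<in> borel_measurable (\<mu> t)" "E \<in> borel_measurable (\<mu> t)"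
        unfolding A_eq B_eq E_def using Hm
        by (subst measurable_cong_sets[OF S refl], measurable)+
      have X': "ennreal (\<tau> * h \<tau> x y) \<le> ennreal k * T"
        unfolding T_def I_def using X t \<tau> \<tau>J(2) r xy by simp
      have A_le: "(\<integral>\<^sup>+ s. A s \<partial>\<mu> t) \<le> ennreal (k1 * k) * T"
      proof (rule ennreal_bound_trans[OF _ X'])
        show "(\<integral>\<^sup>+ s. A s \<partial>\<mu> t) \<le> ennreal k1 * ennreal (\<tau> * h \<tau> x y)"
          unfolding A_def using st laws t \<tau>J(1) \<tau>(2) xy by blast
      qed (use k1 in simp)
      have B_le: "(\<integral>\<^sup>+ s. B s \<partial>\<mu> t) \<le> ennreal (8 * K * k + 4 * K) * T"
      proof -
        have "(\<integral>\<^sup>+ s. B s \<partial>\<mu> t) \<le> 2 * (\<integral>\<^sup>+ u\<in>{\<tau>..4 * r}. ennreal (?H u) * emeasure (\<mu> t) {u..} \<partial>lborel)"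
          unfolding B_eq by (rule law_weighted_tail_le[OF laws t Hm H0 Ha \<tau>(1)])
        also have "(\<integral>\<^sup>+ u\<in>{\<tau>..4 * r}. ennreal (?H u) * emeasure (\<mu> t) {u..} \<partial>lborel) \<le>
          (\<integral>\<^sup>+ u. ennreal (2 * K * t) * (ennreal (h u x y * w u) * indicator {\<tau>..4 * r} u) \<partial>lborel)"
        proof (rule nn_integral_mono)
          fix u
          show "ennreal (?H u) * emeasure (\<mu> t) {u..} * indicator {\<tau>..4 * r} u \<le>
            ennreal (2 * K * t) * (ennreal (h u x y * w u) * indicator {\<tau>..4 * r} u)"
          proof (cases "u \<in> {\<tau>..4 * r}")
            case True
            then have u: "0 < u" "u \<le> 4 * r" using \<tau> by auto
            have uJ: "u \<in> J" by (rule J_down[OF r(3) u])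
            have "measure (\<mu> t) {u..} \<le> 2 * (t * \<phi> (1 / u))" by (rule law_tail_le[OF laws t u(1)])
            also have "\<dots> \<le> 2 * (t * (K * w u))" using le_w[OF uJ] t by (intro mult_left_mono) auto
            finally have "h u x y * measure (\<mu> t) {u..} \<le> h u x y * (2 * (t * (K * w u)))"
              using h_nonneg[OF u(1) xy] by (rule mult_left_mono)
            also have "\<dots> = (2 * K * t) * (h u x y * w u)" by (simp add: mult_ac)
            finally have "ennreal (h u x y * measure (\<mu> t) {u..}) \<le> ennreal ((2 * K * t) * (h u x y * w u))"
              by (rule ennreal_leI)
            also have "\<dots> = ennreal (2 * K * t) * ennreal (h u x y * w u)"
              using K t by (intro ennreal_mult') simp
            also have "ennreal (h u x y * measure (\<mu> t) {u..}) = ennreal (h u x y) * emeasure (\<mu> t) {u..}"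
              using h_nonneg[OF u(1) xy] by (simp add: emeasure_eq_measure ennreal_mult)
            finally show ?thesis using True u by simp
          qed simp
        qed
        also have "\<dots> = ennreal (2 * K * t) * (\<integral>\<^sup>+ u\<in>{\<tau>..4 * r}. ennreal (h u x y * w u) \<partial>lborel)"
          by (rule nn_integral_cmult[OF jump_integrand_measurable[OF xy \<tau>(1)]])
        also have "(\<integral>\<^sup>+ u\<in>{\<tau>..4 * r}. ennreal (h u x y * w u) \<partial>lborel) \<le> ennreal (\<tau> * h \<tau> x y * w \<tau>) + I"
          unfolding I_def using r by (intro jump_integral_split[OF xy \<tau>(1)]) simp
        also have "2 * (ennreal (2 * K * t) * (ennreal (\<tau> * h \<tau> x y * w \<tau>) + I)) =
            2 * (ennreal (2 * K * t) * ennreal (\<tau> * h \<tau> x y * w \<tau>)) + ennreal (4 * K) * T"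
        proof -
          have "2 * (ennreal (2 * K * t) * I) = ennreal (2 * (2 * K * t)) * I"
            by (subst ennreal_mult'[of 2]) (simp_all add: mult.assoc)
          also have "\<dots> = ennreal (4 * K) * T"
            unfolding T_def using K by (subst mult.assoc[symmetric], subst ennreal_mult'[symmetric]) (simp_all add: mult_ac)
          finally show ?thesis by (simp add: distrib_left)
        qed
        also have "2 * (ennreal (2 * K * t) * ennreal (\<tau> * h \<tau> x y * w \<tau>)) \<le> ennreal (8 * K) * ennreal (\<tau> * h \<tau> x y)"
        proof -
          have "t * w \<tau> \<le> t * (2 * \<phi> (1 / \<tau>))" using w_le[OF \<tau>(1)] t by (intro mult_left_mono) auto
          also have "\<dots> = 2" using \<tau>(2) by simp
          finally have "4 * K * (\<tau> * h \<tau> x y) * (t * w \<tau>) \<le> 4 * K * (\<tau> * h \<tau> x y) * 2"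
            using K \<tau> h_nonneg[OF \<tau>(1) xy] by (intro mult_left_mono) auto
          then have "ennreal (2 * (2 * K * t * (\<tau> * h \<tau> x y * w \<tau>))) \<le> ennreal (8 * K * (\<tau> * h \<tau> x y))"
            by (intro ennreal_leI) (simp add: mult_ac)
          then show ?thesis using K t by (simp only: ennreal_mult' zero_le_numeral mult_nonneg_nonneg less_imp_le ennreal_numeral)
        qed
        finally have "(\<integral>\<^sup>+ s. B s \<partial>\<mu> t) \<le> ennreal (8 * K) * ennreal (\<tau> * h \<tau> x y) + ennreal (4 * K) * T"
          by (simp add: add_right_mono mult_left_mono)
        moreover have "ennreal (8 * K) * ennreal (\<tau> * h \<tau> x y) \<le> ennreal (8 * K * k) * T"
          by (rule ennreal_bound_trans[OF order_refl X']) (use K in simp)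
        ultimately show ?thesis
          using K k by (simp add: distrib_right) (meson add_right_mono order_trans)
      qed
      have E_le: "(\<integral>\<^sup>+ s. E s \<partial>\<mu> t) \<le> ennreal K * T"
      proof -
        have h4: "0 \<le> h (4 * r) x y" by (rule h_nonneg[OF r(4) xy])
        have "(\<integral>\<^sup>+ s. E s \<partial>\<mu> t) = ennreal (r * h (4 * r) x y * measure (\<mu> t) {4 * r..})"
          unfolding E_def using r h4
          by (subst nn_integral_cmult_indicator) (simp_all add: S emeasure_eq_measure flip: ennreal_mult')
        also have "\<dots> \<le> ennreal (K * (t * (2 * r * h (2 * (2 * r)) x y * w (2 * (2 * r)))))"
        proof (rule ennreal_leI)
          have "measure (\<mu> t) {4 * r..} \<le> 2 * (t * \<phi> (1 / (4 * r)))" by (rule law_tail_le[OF laws t r(4)])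
          also have "\<dots> \<le> 2 * (t * (K * w (4 * r)))" using le_w[OF r(3)] t by (intro mult_left_mono) auto
          finally have "r * h (4 * r) x y * measure (\<mu> t) {4 * r..} \<le> r * h (4 * r) x y * (2 * (t * (K * w (4 * r))))"
            using r h4 by (intro mult_left_mono) auto
          then show "r * h (4 * r) x y * measure (\<mu> t) {4 * r..} \<le> K * (t * (2 * r * h (2 * (2 * r)) x y * w (2 * (2 * r))))"
            by (simp add: mult_ac)
        qed
        also have "\<dots> = ennreal K * (ennreal t * ennreal (2 * r * h (2 * (2 * r)) x y * w (2 * (2 * r))))"
          using K t by (subst ennreal_mult', simp) (subst ennreal_mult', simp_all)
        also have "\<dots> \<le> ennreal K * (ennreal t * I)"
          unfolding I_def using r \<tau> by (intro mult_left_mono jump_integral_ge[OF xy]) simp_all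
        finally show ?thesis by (simp only: T_def)
      qed
      have pw: "ennreal (p s x y) * indicator {0<..} s \<le> ennreal (C0 / Q) * (A s + B s + E s)" for s
      proof -
        consider "s \<le> 0" | "0 < s" "s \<le> 4 * r" | "4 * r < s" by linarith
        then show ?thesis
        proof cases
          case 2
          have hs: "0 \<le> h s x y" by (rule h_nonneg[OF 2(1) xy])
          have "p s x y \<le> C0 / Q * (h s x y * s)"
          proof (cases "s \<le> r")
            case True
            have "p s x y \<le> C * h s x y / W x r * (s / r)"
              using po xy rJ 2(1) True unfolding r_def by blast
            also have "\<dots> = C * (h s x y * s / Q)" by (simp add: Q_def mult_ac)
            also have "\<dots> \<le> C0 * (h s x y * s / Q)" using C0 hs 2 Q by (intro mult_right_mono) auto
            finally show ?thesis by simp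
          next
            case False
            have sJ: "s \<in> J" by (rule J_down[OF r(3) 2])
            have "p s x y \<le> Cp * h s x y / W x s" using pu sJ xy by blast
            also have "\<dots> \<le> Cp * h s x y / W x r"
              using W_mono[of r s x] False r Wr Cp hs by (intro divide_left_mono mult_pos_pos) auto
            also have "\<dots> = Cp * (h s x y * r / Q)" using r by (simp add: Q_def)
            also have "\<dots> \<le> C0 * (h s x y * s / Q)"
              using C0 Cp hs 2 Q False r by (intro mult_mono divide_right_mono mult_left_mono) auto
            finally show ?thesis by simp
          qed
          then have "ennreal (p s x y) \<le> ennreal (C0 / Q) * ennreal (h s x y * s)"
            using C0 Q by (subst ennreal_mult'[symmetric]) (auto intro: ennreal_leI)
          also have "\<dots> \<le> ennreal (C0 / Q) * (A s + B s + E s)"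
            using 2 by (intro mult_left_mono) (auto simp: A_def B_def indicator_def)
          finally show ?thesis using 2 by simp
        next
          case 3
          then have s4: "4 * r \<le> s" by simp
          have h4: "0 \<le> h (4 * r) x y" by (rule h_nonneg[OF r(4) xy])
          have "p s x y \<le> Cp * h (4 * r) x y / W x (4 * r)" using pu r(3) s4 xy by blast
          also have "\<dots> \<le> Cp * h (4 * r) x y / W x r"
            using W_mono[of r "4 * r" x] r Wr W_pos[OF r(4), of x] Cp h4 by (intro divide_left_mono mult_pos_pos) auto
          also have "\<dots> = Cp * (r * h (4 * r) x y / Q)" using r by (simp add: Q_def)
          also have "\<dots> \<le> C0 * (r * h (4 * r) x y / Q)"
            using C0 h4 r Q by (intro mult_right_mono) auto
          finally have "p s x y \<le> C0 / Q * (r * h (4 * r) x y)" by simp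
          then have "ennreal (p s x y) \<le> ennreal (C0 / Q) * ennreal (r * h (4 * r) x y)"
            using C0 Q by (subst ennreal_mult'[symmetric]) (auto intro: ennreal_leI)
          also have "\<dots> \<le> ennreal (C0 / Q) * (A s + B s + E s)"
            using 3 by (intro mult_left_mono) (auto simp: E_def indicator_def)
          finally show ?thesis using 3 r by simp
        qed simp
      qed
      have "subordinated \<mu> t x y \<le> (\<integral>\<^sup>+ s. ennreal (C0 / Q) * (A s + B s + E s) \<partial>\<mu> t)"
        by (intro nn_integral_mono pw)
      also have "\<dots> = ennreal (C0 / Q) * ((\<integral>\<^sup>+ s. A s \<partial>\<mu> t) + (\<integral>\<^sup>+ s. B s \<partial>\<mu> t) + (\<integral>\<^sup>+ s. E s \<partial>\<mu> t))"
        using meas by (simp add: nn_integral_cmult nn_integral_add)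
      also have "\<dots> \<le> ennreal (C0 / Q) * (ennreal k' * T)"
        unfolding k'_def using k1 k K
        by (intro mult_left_mono ennreal_bound_add A_le B_le E_le) simp_all
      also have "\<dots> = ennreal (C0 * k' * t / Q) * I"
      proof -
        have "C0 * k' * t / Q = (C0 / Q) * (k' * t)" by simp
        then have "ennreal (C0 * k' * t / Q) = ennreal (C0 / Q) * (ennreal k' * ennreal t)"
          using C0 Q k' by (simp only: ennreal_mult' less_imp_le divide_pos_pos)
        then show ?thesis by (simp only: T_def mult.assoc)
      qed
      finally show "subordinated \<mu> t x y \<le>
        ennreal (C0 * k' * t / (R x y * W x (R x y))) *
          (\<integral>\<^sup>+ u\<in>{2 * \<tau>..4 * R x y}. ennreal (h u x y * w u) \<partial>lborel)"
        by (simp only: Q_def I_def r_def)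
    qed
  qed
qed

end

end

section \<open>Pointwise bounds from the heat kernel profile\<close>

lemma vol_eq:
  fixes m :: "'a::metric_space measure"
  assumes "\<And>K :: 'a set. bounded K \<Longrightarrow> closed K \<Longrightarrow> compact K"
    and "radon_measure m" and "full_support m" and "0 < r"
  shows "vol m x r = ennreal (measure m (ball x r))"
  unfolding vol_def by (rule ball_measure(1)[OF assms])

text \<open>
  By the scaling of \<open>\<Phi>\<close>, the quotient \<open>r / gen_inv \<Phi> s\<close> is at least a positive power of \<open>\<Phi>(r) / s\<close>, so the Gaussian
  factor is smaller than every power of \<open>s / \<Phi>(r)\<close>.
\<close>

lemma gaussian_le_powr:
  assumes f: "scale_function \<Phi>" and c: "0 < c"
  obtains C where "0 < C" "\<forall>s r. 0 < r \<and> 0 < s \<and> s \<le> \<Phi> r \<longrightarrow>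
    exp (- (c * r\<^sup>2 / (gen_inv \<Phi> s)\<^sup>2)) \<le> C * (s / \<Phi> r) powr M"
proof -
  obtain d1 d2 b B where d: "0 < d1" "0 < d2" "0 < b" "0 < B"
    and lo: "\<And>s S. 0 < s \<Longrightarrow> s \<le> S \<Longrightarrow> b * (S / s) powr d1 \<le> gen_inv \<Phi> S / gen_inv \<Phi> s"
    and up: "\<And>s S. 0 < s \<Longrightarrow> s \<le> S \<Longrightarrow> gen_inv \<Phi> S / gen_inv \<Phi> s \<le> B * (S / s) powr d2"
    using gen_inv_scaling[OF f] by blast
  have cb: "0 < c * b\<^sup>2" "0 < 2 * d1" using c d by auto
  obtain C where C: "0 < C" "\<And>z. 1 \<le> z \<Longrightarrow> exp (- (c * b\<^sup>2 * z powr (2 * d1))) \<le> C * z powr (- M)"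
    using exp_neg_powr_le_powr[OF cb] by blast
  show ?thesis
  proof (rule that[OF C(1)], intro allI impI, elim conjE)
    fix s r assume r: "0 < r" and s: "0 < s" "s \<le> \<Phi> r"
    have rp: "0 < \<Phi> r" by (rule scale_function_pos[OF f r])
    define z where "z = \<Phi> r / s"
    have z: "1 \<le> z" using s by (simp add: z_def)
    have th: "0 < gen_inv \<Phi> s" by (rule gen_inv_pos[OF f s(1)])
    have "b * z powr d1 \<le> r / gen_inv \<Phi> s"
      using lo[OF s] r gen_inv_scale_function[OF f, of r] by (simp add: z_def)
    then have "(b * z powr d1)\<^sup>2 \<le> (r / gen_inv \<Phi> s)\<^sup>2"
      using d z by (intro power_mono) auto
    then have "b\<^sup>2 * z powr (2 * d1) \<le> r\<^sup>2 / (gen_inv \<Phi> s)\<^sup>2"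
      using z by (simp add: power_mult_distrib power_divide powr_powr mult.commute flip: powr_realpow)
    then have "c * (b\<^sup>2 * z powr (2 * d1)) \<le> c * (r\<^sup>2 / (gen_inv \<Phi> s)\<^sup>2)"
      using c by (intro mult_left_mono) auto
    then have "exp (- (c * r\<^sup>2 / (gen_inv \<Phi> s)\<^sup>2)) \<le> exp (- (c * b\<^sup>2 * z powr (2 * d1)))"
      by (simp add: mult.assoc)
    also have "\<dots> \<le> C * z powr (- M)" by (rule C(2)[OF z])
    also have "z powr (- M) = (s / \<Phi> r) powr M"
      using s rp by (simp add: z_def powr_minus powr_divide)
    finally show "exp (- (c * r\<^sup>2 / (gen_inv \<Phi> s)\<^sup>2)) \<le> C * (s / \<Phi> r) powr M" .
  qed
qed

text \<open>
  The two-sided estimate on the initial segment \<open>J\<close> of times, together with an upper bound for later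
  times. Bounded and unbounded \<open>D\<close>, near and off the diagonal, are treated with different \<open>J\<close>.
\<close>

locale hk_setting =
  fixes m :: "'a::metric_space measure" and D :: "'a set" and \<Phi> \<Psi> :: "real \<Rightarrow> real"
    and h p :: "real \<Rightarrow> 'a \<Rightarrow> 'a \<Rightarrow> real" and C0 :: real and J :: "real set"
    and \<phi> :: "real \<Rightarrow> real" and d1 d2 :: real
  assumes bc: "\<And>K :: 'a set. bounded K \<Longrightarrow> closed K \<Longrightarrow> compact K"
    and radon: "radon_measure m" and supp: "full_support m"
    and \<Phi>: "scale_function \<Phi>" and \<Psi>: "scale_function \<Psi>" and \<Phi>_le_\<Psi>: "\<And>r. 0 \<le> r \<Longrightarrow> \<Phi> r \<le> \<Psi> r"
    and J_pos: "\<And>u. u \<in> J \<Longrightarrow> 0 < u"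
    and J_down: "\<And>u v. u \<in> J \<Longrightarrow> 0 < v \<Longrightarrow> v \<le> u \<Longrightarrow> v \<in> J"
    and \<phi>_pos: "\<And>l. 0 < l \<Longrightarrow> 0 < \<phi> l"
    and \<phi>_scaling: "weak_scaling J (\<lambda>u. \<phi> (1 / u)) d1 d2" and d1: "0 < d1" and d2: "d2 < 1"
    and vol_growth: "\<exists>C>0. \<exists>d\<ge>0. \<forall>S\<in>J. \<forall>s. 0 < s \<and> s \<le> S \<longrightarrow> (\<forall>x.
      measure m (ball x (gen_inv \<Phi> S)) \<le> C * (S / s) powr d * measure m (ball x (gen_inv \<Phi> s)))"
    and h_nonneg: "\<And>s x y. 0 < s \<Longrightarrow> x \<in> D \<Longrightarrow> y \<in> D \<Longrightarrow> 0 \<le> h s x y"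
    and h_anti: "\<And>s t x y. 0 < s \<Longrightarrow> s \<le> t \<Longrightarrow> x \<in> D \<Longrightarrow> y \<in> D \<Longrightarrow> h t x y \<le> h s x y"
    and h_decay: "power_decay_on J D h"
    and p_nonneg: "\<And>s x y. 0 < s \<Longrightarrow> x \<in> D \<Longrightarrow> y \<in> D \<Longrightarrow> 0 \<le> p s x y"
    and p_upper: "\<exists>C>0. \<forall>u\<in>J. \<forall>s\<ge>u. \<forall>x\<in>D. \<forall>y\<in>D.
      p s x y \<le> C * h u x y / measure m (ball x (gen_inv \<Phi> u))"
    and two_sided: "hk_two_sided J m D \<Phi> \<Psi> h C0 p"
begin

definition W :: "'a \<Rightarrow> real \<Rightarrow> real" where
  "W x s = measure m (ball x (gen_inv \<Phi> s))"

lemma W_pos: "0 < s \<Longrightarrow> 0 < W x s"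
  unfolding W_def by (intro ball_measure(2)[OF bc radon supp] gen_inv_pos[OF \<Phi>])

lemma vol_gen_inv: "0 < s \<Longrightarrow> vol m x (gen_inv \<Phi> s) = ennreal (W x s)"
  unfolding W_def by (intro vol_eq[OF bc radon supp] gen_inv_pos[OF \<Phi>])

lemma vol_dist: "0 < r \<Longrightarrow> vol m x r = ennreal (W x (\<Phi> r))"
  using gen_inv_scale_function[OF \<Phi>, of r] vol_eq[OF bc radon supp, of r x] by (simp add: W_def)

lemma W_mono: "0 < s \<Longrightarrow> s \<le> S \<Longrightarrow> W x s \<le> W x S"
proof -
  assume s: "0 < s" "s \<le> S"
  then have S: "0 < S" by simp
  have "emeasure m (ball x (gen_inv \<Phi> s)) \<le> emeasure m (ball x (gen_inv \<Phi> S))"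
    using gen_inv_mono[OF \<Phi> s(2)] radon by (intro emeasure_mono subset_ball) (simp_all add: radon_measure_def)
  then have "ennreal (W x s) \<le> ennreal (W x S)"
    using vol_gen_inv[OF s(1), of x] vol_gen_inv[OF S, of x] by (simp add: vol_def)
  then show ?thesis using W_pos[OF S, of x] by simp
qed

sublocale kernel_bounds J D W h p \<phi> d1 d2
  by unfold_locales
    (fact J_pos J_down \<phi>_pos \<phi>_scaling d1 d2 W_pos W_mono vol_growth[folded W_def] h_nonneg h_anti h_decay
      p_upper[folded W_def])+

text \<open>
  For \<open>C0 = 1\<close> the jump term of the profile is infinite on the diagonal, so the profile is compared with real numbers
  \<open>A\<close>, which leads back to inequalities between reals.
\<close>

lemma kernel_ge_profile:
  obtains c1 c2 where "0 < c1" "0 < c2"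
    "\<forall>s\<in>J. \<forall>x\<in>D. \<forall>y\<in>D. \<forall>A. ennreal A \<le> hk_profile m \<Phi> \<Psi> C0 c2 s x y \<longrightarrow> c1 * h s x y * A \<le> p s x y"
proof -
  obtain c1 c2 where c: "0 < c1" "0 < c2" and
    ts: "\<forall>t\<in>J. \<forall>x\<in>D. \<forall>y\<in>D.
      ennreal (c1 * h t x y) * hk_profile m \<Phi> \<Psi> C0 c2 t x y \<le> ennreal (p t x y)"
    using two_sided unfolding hk_two_sided_def by blast
  show ?thesis
  proof (rule that[OF c]; intro ballI allI impI)
    fix s x y A assume s: "s \<in> J" and xy: "x \<in> D" "y \<in> D" and A: "ennreal A \<le> hk_profile m \<Phi> \<Psi> C0 c2 s x y"
    note s0 = J_pos[OF s]
    have h0: "0 \<le> c1 * h s x y" using c h_nonneg[OF s0 xy] by simp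
    have "ennreal (c1 * h s x y * A) = ennreal (c1 * h s x y) * ennreal A" by (rule ennreal_mult'[OF h0])
    also have "\<dots> \<le> ennreal (c1 * h s x y) * hk_profile m \<Phi> \<Psi> C0 c2 s x y"
      using A by (rule mult_left_mono) simp
    also have "\<dots> \<le> ennreal (p s x y)" using ts s xy by blast
    finally show "c1 * h s x y * A \<le> p s x y"
      using p_nonneg[OF s0 xy] by (simp only: ennreal_le_iff)
  qed
qed

lemma kernel_le_profile:
  obtains c3 c4 where "0 < c3" "0 < c4"
    "\<forall>s\<in>J. \<forall>x\<in>D. \<forall>y\<in>D. \<forall>A\<ge>0. hk_profile m \<Phi> \<Psi> C0 c4 s x y \<le> ennreal A \<longrightarrow> p s x y \<le> c3 * h s x y * A"
proof -
  obtain c3 c4 where c: "0 < c3" "0 < c4" and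
    ts: "\<forall>t\<in>J. \<forall>x\<in>D. \<forall>y\<in>D.
      ennreal (p t x y) \<le> ennreal (c3 * h t x y) * hk_profile m \<Phi> \<Psi> C0 c4 t x y"
    using two_sided unfolding hk_two_sided_def by blast
  show ?thesis
  proof (rule that[OF c]; intro ballI allI impI)
    fix s x y A assume s: "s \<in> J" and xy: "x \<in> D" "y \<in> D" and A0: "0 \<le> A"
      and A: "hk_profile m \<Phi> \<Psi> C0 c4 s x y \<le> ennreal A"
    have h0: "0 \<le> c3 * h s x y" using c h_nonneg[OF J_pos[OF s] xy] by simp
    have "ennreal (p s x y) \<le> ennreal (c3 * h s x y) * hk_profile m \<Phi> \<Psi> C0 c4 s x y" using ts s xy by blast
    also have "\<dots> \<le> ennreal (c3 * h s x y) * ennreal A" using A by (rule mult_left_mono) simp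
    also have "\<dots> = ennreal (c3 * h s x y * A)" by (rule ennreal_mult'[OF h0, symmetric])
    finally show "p s x y \<le> c3 * h s x y * A"
      using mult_nonneg_nonneg[OF h0 A0] by (simp only: ennreal_le_iff)
  qed
qed

text \<open>
  If \<open>\<Phi> (dist x y)\<close> is at most a multiple of \<open>s\<close>, then \<open>dist x y\<close> is at most a multiple of \<open>gen_inv \<Phi> s\<close>, and
  the Gaussian factor is bounded below.
\<close>

lemma on_diagonal_lower:
  assumes K: "0 < K"
  shows "\<exists>c>0. \<forall>s\<in>J. \<forall>x\<in>D. \<forall>y\<in>D. \<Phi> (dist x y) \<le> K * s \<longrightarrow> c * h s x y / W x s \<le> p s x y"
proof -
  obtain c1 c2 where c: "0 < c1" "0 < c2" and
    lo: "\<forall>s\<in>J. \<forall>x\<in>D. \<forall>y\<in>D. \<forall>A. ennreal A \<le> hk_profile m \<Phi> \<Psi> C0 c2 s x y \<longrightarrow> c1 * h s x y * A \<le> p s x y"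
    by (rule kernel_ge_profile)
  obtain e1 e2 b B where d: "0 < e1" "0 < e2" "0 < b" "0 < B"
    and gl: "\<And>s S. 0 < s \<Longrightarrow> s \<le> S \<Longrightarrow> b * (S / s) powr e1 \<le> gen_inv \<Phi> S / gen_inv \<Phi> s"
    and gu: "\<And>s S. 0 < s \<Longrightarrow> s \<le> S \<Longrightarrow> gen_inv \<Phi> S / gen_inv \<Phi> s \<le> B * (S / s) powr e2"
    using gen_inv_scaling[OF \<Phi>] by blast
  define A where "A = B * max K 1 powr e2"
  define e where "e = exp (- (c2 * A\<^sup>2))"
  have e: "0 < e" "e \<le> 1" using c by (auto simp: e_def)
  show ?thesis
  proof (intro exI[of _ "c1 * e"] conjI ballI impI)
    show "0 < c1 * e" using c e by simp
    fix s x y assume s: "s \<in> J" and xy: "x \<in> D" "y \<in> D" and R: "\<Phi> (dist x y) \<le> K * s"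
    note s0 = J_pos[OF s]
    let ?th = "gen_inv \<Phi> s"
    have th: "0 < ?th" by (rule gen_inv_pos[OF \<Phi> s0])
    have "\<Phi> (dist x y) \<le> max K 1 * s"
      using R s0 by (meson max.cobounded1 mult_right_mono order_trans less_imp_le)
    then have "dist x y \<le> gen_inv \<Phi> (max K 1 * s)"
      using gen_inv_mono[OF \<Phi>] gen_inv_scale_function[OF \<Phi>, of "dist x y"] by fastforce
    also have "\<dots> \<le> A * ?th"
      using gu[of s "max K 1 * s"] s0 th by (simp add: A_def pos_divide_le_eq mult_le_cancel_right1)
    finally have "dist x y / ?th \<le> A" using th by (simp add: pos_divide_le_eq)
    then have "(dist x y / ?th)\<^sup>2 \<le> A\<^sup>2" using th by (intro power_mono) auto
    then have "e \<le> exp (- (c2 * (dist x y)\<^sup>2 / ?th\<^sup>2))"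
      using c by (simp add: e_def power_divide mult_left_mono flip: times_divide_eq_right)
    then have 1: "ennreal (e / W x s) \<le> 1 / vol m x ?th * ennreal (exp (- (c2 * (dist x y)\<^sup>2 / ?th\<^sup>2)))"
      using W_pos[OF s0, of x] e
      by (simp add: vol_gen_inv[OF s0] divide_ennreal divide_right_mono ennreal_leI flip: ennreal_1 ennreal_mult')
    have 2: "ennreal (e / W x s) \<le> 1 / vol m x ?th"
      using W_pos[OF s0, of x] e
      by (simp add: vol_gen_inv[OF s0] divide_ennreal divide_right_mono ennreal_leI flip: ennreal_1)
    have "ennreal (e / W x s) \<le> hk_profile m \<Phi> \<Psi> C0 c2 s x y"
      unfolding hk_profile_def using 1 2 by (simp add: add_increasing)
    then have "c1 * h s x y * (e / W x s) \<le> p s x y" using lo s xy by blast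
    then show "c1 * e * h s x y / W x s \<le> p s x y" by (simp add: mult_ac)
  qed
qed

text \<open>
  Replacing \<open>h\<close> and the volume at \<open>s\<close> by their values at \<open>\<Phi> (dist x y)\<close> costs a power \<open>\<gamma> + d\<close>. The Gaussian factor
  pays for it and leaves one power of \<open>s / \<Phi> (dist x y)\<close> over.
\<close>

lemma off_diagonal_local_kernel_upper:
  assumes C0: "C0 = 0"
  shows "\<exists>C>0. \<forall>x\<in>D. \<forall>y\<in>D. \<forall>s. \<Phi> (dist x y) \<in> J \<and> 0 < s \<and> s \<le> \<Phi> (dist x y) \<longrightarrow>
    p s x y \<le> C * h (\<Phi> (dist x y)) x y / W x (\<Phi> (dist x y)) * (s / \<Phi> (dist x y))"
proof -
  obtain c3 c4 where c: "0 < c3" "0 < c4" and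
    up: "\<forall>s\<in>J. \<forall>x\<in>D. \<forall>y\<in>D. \<forall>A\<ge>0. hk_profile m \<Phi> \<Psi> C0 c4 s x y \<le> ennreal A \<longrightarrow> p s x y \<le> c3 * h s x y * A"
    by (rule kernel_le_profile)
  obtain ch \<gamma> where ch: "0 < ch" "0 \<le> \<gamma>" and hg:
    "\<forall>t\<in>J. \<forall>s. 0 < s \<and> s \<le> t \<longrightarrow> (\<forall>x\<in>D. \<forall>y\<in>D. h s x y \<le> ch * (t / s) powr \<gamma> * h t x y)"
    by (rule h_growth)
  obtain Cw d where Cw: "0 < Cw" "0 \<le> d" and wg:
    "\<forall>S\<in>J. \<forall>s. 0 < s \<and> s \<le> S \<longrightarrow> (\<forall>x. W x S \<le> Cw * (S / s) powr d * W x s)"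
    by (rule W_growth')
  obtain Cg where Cg: "0 < Cg" and gauss: "\<forall>s r. 0 < r \<and> 0 < s \<and> s \<le> \<Phi> r \<longrightarrow>
    exp (- (c4 * r\<^sup>2 / (gen_inv \<Phi> s)\<^sup>2)) \<le> Cg * (s / \<Phi> r) powr (\<gamma> + d + 1)"
    by (rule gaussian_le_powr[OF \<Phi> c(2)])
  show ?thesis
  proof (intro exI[of _ "c3 * ch * Cw * Cg"] conjI ballI allI impI; (elim conjE)?)
    show "0 < c3 * ch * Cw * Cg" using c ch Cw Cg by simp
    fix x y s assume xy: "x \<in> D" "y \<in> D" and RJ: "\<Phi> (dist x y) \<in> J" and s: "0 < s" "s \<le> \<Phi> (dist x y)"
    define R where "R = \<Phi> (dist x y)"
    have sJ: "s \<in> J" by (rule J_down[OF RJ s])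
    have R0: "0 < R" using J_pos[OF RJ] by (simp add: R_def)
    have dxy: "0 < dist x y"
      using R0 scale_function_0[OF \<Phi>] unfolding R_def by (metis order_less_irrefl zero_le_dist order_le_less)
    define q where "q = s / R"
    have q: "0 < q" "q \<le> 1" using s R0 by (auto simp: q_def R_def)
    let ?E = "exp (- (c4 * (dist x y)\<^sup>2 / (gen_inv \<Phi> s)\<^sup>2))"
    have Ws: "0 < W x s" by (rule W_pos[OF s(1)])
    have WR: "0 < W x R" by (rule W_pos[OF R0])
    have hR: "0 \<le> h R x y" by (rule h_nonneg[OF R0 xy])
    have "hk_profile m \<Phi> \<Psi> C0 c4 s x y \<le> 1 / vol m x (gen_inv \<Phi> s) * ennreal ?E"
      unfolding hk_profile_def C0 by (rule min.coboundedI2) simp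
    also have "\<dots> = ennreal (1 / W x s * ?E)"
      using Ws by (simp add: vol_gen_inv[OF s(1)] divide_ennreal flip: ennreal_1 ennreal_mult')
    finally have "p s x y \<le> c3 * h s x y * (1 / W x s * ?E)"
      by (rule up[rule_format, OF sJ xy, rotated]) (use Ws in simp)
    also have "\<dots> \<le> c3 * (ch * (1 / q) powr \<gamma> * h R x y) * ((Cw * (1 / q) powr d / W x R) * (Cg * q powr (\<gamma> + d + 1)))"
    proof (intro mult_mono mult_left_mono)
      show "h s x y \<le> ch * (1 / q) powr \<gamma> * h R x y"
        using hg[rule_format, OF RJ _ xy, of s] s by (simp add: q_def R_def)
      have "W x R \<le> Cw * (1 / q) powr d * W x s"
        using wg[rule_format, OF RJ, of s x] s by (simp add: q_def R_def)
      then show "1 / W x s \<le> Cw * (1 / q) powr d / W x R"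
        using Ws WR by (simp add: field_simps)
      show "?E \<le> Cg * q powr (\<gamma> + d + 1)"
        using gauss[rule_format, of "dist x y" s] dxy s by (simp add: q_def R_def)
    qed (use c ch Cw hR h_nonneg[OF s(1) xy] Ws WR in auto)
    also have "\<dots> = c3 * ch * Cw * Cg * h R x y / W x R * ((1 / q) powr \<gamma> * (1 / q) powr d * q powr (\<gamma> + d + 1))"
      by (simp add: mult_ac)
    also have "(1 / q) powr \<gamma> * (1 / q) powr d * q powr (\<gamma> + d + 1) = q"
      using q by (simp add: powr_divide powr_add)
    finally show "p s x y \<le> c3 * ch * Cw * Cg * h (\<Phi> (dist x y)) x y / W x (\<Phi> (dist x y)) * (s / \<Phi> (dist x y))"
      by (simp only: q_def R_def)
  qed
qed

text \<open>
  The jump part has the right form because \<open>\<Phi> \<le> \<Psi>\<close>; the Gaussian part is bounded by the same expression.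
\<close>

lemma off_diagonal_jump_kernel_upper:
  assumes C0: "C0 = 1"
  shows "\<exists>C>0. \<forall>x\<in>D. \<forall>y\<in>D. \<forall>s. \<Phi> (dist x y) \<in> J \<and> 0 < s \<and> s \<le> \<Phi> (dist x y) \<longrightarrow>
    p s x y \<le> C * h s x y / W x (\<Phi> (dist x y)) * (s / \<Phi> (dist x y))"
proof -
  obtain c3 c4 where c: "0 < c3" "0 < c4" and
    up: "\<forall>s\<in>J. \<forall>x\<in>D. \<forall>y\<in>D. \<forall>A\<ge>0. hk_profile m \<Phi> \<Psi> C0 c4 s x y \<le> ennreal A \<longrightarrow> p s x y \<le> c3 * h s x y * A"
    by (rule kernel_le_profile)
  obtain Cw d where Cw: "0 < Cw" "0 \<le> d" and wg:
    "\<forall>S\<in>J. \<forall>s. 0 < s \<and> s \<le> S \<longrightarrow> (\<forall>x. W x S \<le> Cw * (S / s) powr d * W x s)"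
    by (rule W_growth')
  obtain Cg where Cg: "0 < Cg" and gauss: "\<forall>s r. 0 < r \<and> 0 < s \<and> s \<le> \<Phi> r \<longrightarrow>
    exp (- (c4 * r\<^sup>2 / (gen_inv \<Phi> s)\<^sup>2)) \<le> Cg * (s / \<Phi> r) powr (d + 1)"
    by (rule gaussian_le_powr[OF \<Phi> c(2)])
  show ?thesis
  proof (intro exI[of _ "c3 * (1 + Cw * Cg)"] conjI ballI allI impI; (elim conjE)?)
    show "0 < c3 * (1 + Cw * Cg)" using c Cw Cg by (simp add: add_pos_pos)
    fix x y s assume xy: "x \<in> D" "y \<in> D" and RJ: "\<Phi> (dist x y) \<in> J" and s: "0 < s" "s \<le> \<Phi> (dist x y)"
    define R where "R = \<Phi> (dist x y)"
    have sJ: "s \<in> J" by (rule J_down[OF RJ s])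
    have R0: "0 < R" using J_pos[OF RJ] by (simp add: R_def)
    have dxy: "0 < dist x y"
      using R0 scale_function_0[OF \<Phi>] unfolding R_def by (metis order_less_irrefl zero_le_dist order_le_less)
    define q where "q = s / R"
    have q: "0 < q" "q \<le> 1" using s R0 by (auto simp: q_def R_def)
    let ?E = "exp (- (c4 * (dist x y)\<^sup>2 / (gen_inv \<Phi> s)\<^sup>2))"
    have Ws: "0 < W x s" by (rule W_pos[OF s(1)])
    have WR: "0 < W x R" by (rule W_pos[OF R0])
    have R\<Psi>: "R \<le> \<Psi> (dist x y)" using \<Phi>_le_\<Psi>[of "dist x y"] by (simp add: R_def)
    have "hk_profile m \<Phi> \<Psi> C0 c4 s x y \<le>
        ennreal s / (vol m x (dist x y) * ennreal (\<Psi> (dist x y))) + 1 / vol m x (gen_inv \<Phi> s) * ennreal ?E"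
      unfolding hk_profile_def C0 by (rule min.coboundedI2) simp
    also have "\<dots> = ennreal (s / (W x R * \<Psi> (dist x y))) + ennreal (1 / W x s * ?E)"
      using Ws WR R0 R\<Psi> s
      by (simp add: vol_gen_inv[OF s(1)] vol_dist[OF dxy] R_def[symmetric] divide_ennreal flip: ennreal_1 ennreal_mult')
    also have "\<dots> = ennreal (s / (W x R * \<Psi> (dist x y)) + 1 / W x s * ?E)"
      using Ws WR R0 R\<Psi> s by (intro ennreal_plus[symmetric]) auto
    also have "\<dots> \<le> ennreal ((1 + Cw * Cg) * q / W x R)"
    proof (rule ennreal_leI)
      have "s / (W x R * \<Psi> (dist x y)) \<le> s / (W x R * R)"
        using s WR R0 R\<Psi> by (intro divide_left_mono mult_left_mono mult_pos_pos) auto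
      also have "\<dots> = q / W x R" by (simp add: q_def)
      finally have 1: "s / (W x R * \<Psi> (dist x y)) \<le> q / W x R" .
      have "1 / W x s * ?E \<le> (Cw * (1 / q) powr d / W x R) * (Cg * q powr (d + 1))"
      proof (intro mult_mono)
        have "W x R \<le> Cw * (1 / q) powr d * W x s"
          using wg[rule_format, OF RJ, of s x] s by (simp add: q_def R_def)
        then show "1 / W x s \<le> Cw * (1 / q) powr d / W x R"
          using Ws WR by (simp add: field_simps)
        show "?E \<le> Cg * q powr (d + 1)"
          using gauss[rule_format, of "dist x y" s] dxy s by (simp add: q_def R_def)
      qed (use Cw WR in auto)
      also have "\<dots> = Cw * Cg / W x R * ((1 / q) powr d * q powr (d + 1))" by (simp add: mult_ac)
      also have "(1 / q) powr d * q powr (d + 1) = q" using q by (simp add: powr_divide powr_add)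
      finally show "s / (W x R * \<Psi> (dist x y)) + 1 / W x s * ?E \<le> (1 + Cw * Cg) * q / W x R"
        using 1 by (simp add: algebra_simps add_divide_distrib)
    qed
    finally have "p s x y \<le> c3 * h s x y * ((1 + Cw * Cg) * q / W x R)"
      by (rule up[rule_format, OF sJ xy, rotated]) (use WR q Cw Cg in simp)
    then show "p s x y \<le> c3 * (1 + Cw * Cg) * h s x y / W x (\<Phi> (dist x y)) * (s / \<Phi> (dist x y))"
      by (simp add: q_def R_def mult_ac)
  qed
qed

text \<open>
  Both members of the minimum in the profile are bounded below: the jump part because \<open>\<Psi>\<close> is at most a multiple of \<open>\<Phi>\<close>,
  the on-diagonal part because \<open>s \<le> 4 \<Phi> (dist x y)\<close> and the volume is doubling.
\<close>

lemma off_diagonal_jump_kernel_lower: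
  assumes C0: "C0 = 1" and K: "0 < K" and \<Psi>_le: "\<And>x y. x \<in> D \<Longrightarrow> y \<in> D \<Longrightarrow> x \<noteq> y \<Longrightarrow> \<Psi> (dist x y) \<le> K * \<Phi> (dist x y)"
  shows "\<exists>c>0. \<forall>x\<in>D. \<forall>y\<in>D. \<forall>s. 4 * \<Phi> (dist x y) \<in> J \<and> 0 < s \<and> s \<le> 4 * \<Phi> (dist x y) \<longrightarrow>
    c * h s x y / W x (\<Phi> (dist x y)) * (s / \<Phi> (dist x y)) \<le> p s x y"
proof -
  obtain c1 c2 where c: "0 < c1" "0 < c2" and
    lo: "\<forall>s\<in>J. \<forall>x\<in>D. \<forall>y\<in>D. \<forall>A. ennreal A \<le> hk_profile m \<Phi> \<Psi> C0 c2 s x y \<longrightarrow> c1 * h s x y * A \<le> p s x y"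
    by (rule kernel_ge_profile)
  obtain Cw d where Cw: "0 < Cw" "0 \<le> d" and wg:
    "\<forall>S\<in>J. \<forall>s. 0 < s \<and> s \<le> S \<longrightarrow> (\<forall>x. W x S \<le> Cw * (S / s) powr d * W x s)"
    by (rule W_growth')
  define b where "b = min (1 / K) (1 / (4 * (Cw * 4 powr d)))"
  have b: "0 < b" "b \<le> 1 / K" "b \<le> 1 / (4 * (Cw * 4 powr d))" using K Cw by (auto simp: b_def)
  show ?thesis
  proof (intro exI[of _ "c1 * b"] conjI ballI allI impI; (elim conjE)?)
    show "0 < c1 * b" using c b by simp
    fix x y s assume xy: "x \<in> D" "y \<in> D" and RJ: "4 * \<Phi> (dist x y) \<in> J" and s: "0 < s" "s \<le> 4 * \<Phi> (dist x y)"
    define R where "R = \<Phi> (dist x y)"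
    have sJ: "s \<in> J" by (rule J_down[OF RJ s])
    have R0: "0 < R" "0 < 4 * R" using J_pos[OF RJ] by (auto simp: R_def)
    have dxy: "0 < dist x y"
      using R0 scale_function_0[OF \<Phi>] unfolding R_def by (metis order_less_irrefl zero_le_dist order_le_less)
    have Ws: "0 < W x s" by (rule W_pos[OF s(1)])
    have WR: "0 < W x R" by (rule W_pos[OF R0(1)])
    have \<Psi>0: "0 < \<Psi> (dist x y)" by (rule scale_function_pos[OF \<Psi> dxy])
    have "\<Psi> (dist x y) \<le> K * R" using \<Psi>_le[OF xy] dxy by (simp add: R_def)
    then have "s / (W x R * (K * R)) \<le> s / (W x R * \<Psi> (dist x y))"
      using s WR R0 K \<Psi>0 by (intro divide_left_mono mult_left_mono mult_pos_pos) auto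
    moreover have "b * (s / R) / W x R \<le> 1 / K * (s / R) / W x R"
      using b s R0 WR by (intro divide_right_mono mult_right_mono) auto
    ultimately have 1: "b * (s / R) / W x R \<le> s / (W x R * \<Psi> (dist x y))" by (simp add: mult_ac)
    have "b * (s / R) / W x R \<le> 1 / W x s"
    proof -
      have "W x s \<le> W x (4 * R)" using s by (intro W_mono) (auto simp: R_def)
      also have "\<dots> \<le> Cw * (4 * R / R) powr d * W x R"
        using wg[rule_format, OF RJ, of R x] R0 by (simp add: R_def)
      also have "4 * R / R = 4" using R0 by simp
      finally have Wle: "W x s \<le> Cw * 4 powr d * W x R" .
      have "b * (s / R) \<le> 1 / (4 * (Cw * 4 powr d)) * 4"
        using b s R0 Cw by (intro mult_mono) (auto simp: R_def pos_divide_le_eq)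
      also have "\<dots> = 1 / (Cw * 4 powr d)" by simp
      finally have "b * (s / R) / W x R \<le> 1 / (Cw * 4 powr d) / W x R"
        using WR by (intro divide_right_mono) auto
      also have "\<dots> = 1 / (Cw * 4 powr d * W x R)" by simp
      also have "\<dots> \<le> 1 / W x s" using Wle Ws Cw WR by (intro divide_left_mono mult_pos_pos) auto
      finally show ?thesis .
    qed
    then have 2: "ennreal (b * (s / R) / W x R) \<le> 1 / vol m x (gen_inv \<Phi> s)"
      using Ws by (simp add: vol_gen_inv[OF s(1)] divide_ennreal ennreal_leI flip: ennreal_1)
    have 3: "ennreal (b * (s / R) / W x R) \<le> ennreal (C0 * s) / (vol m x (dist x y) * ennreal (\<Psi> (dist x y)))"
      using 1 WR \<Psi>0 s C0
      by (simp add: vol_dist[OF dxy] R_def[symmetric] divide_ennreal ennreal_leI flip: ennreal_mult')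
    have "ennreal (b * (s / R) / W x R) \<le> hk_profile m \<Phi> \<Psi> C0 c2 s x y"
      unfolding hk_profile_def using 2 3 by (simp add: add_increasing2)
    then have "c1 * h s x y * (b * (s / R) / W x R) \<le> p s x y" using lo sJ xy by blast
    then show "c1 * b * h s x y / W x (\<Phi> (dist x y)) * (s / \<Phi> (dist x y)) \<le> p s x y"
      by (simp add: R_def mult_ac)
  qed
qed

lemma near_diagonal:
  obtains c C where "0 < c" "0 < C" "\<forall>\<mu> t u. subordinator_laws \<phi> \<mu> \<longrightarrow> 0 < t \<longrightarrow> u \<in> J \<longrightarrow> t * \<phi> (1 / u) = 1 \<longrightarrow>
    (\<forall>x\<in>D. \<forall>y\<in>D. \<Phi> (dist x y) \<le> u \<longrightarrow>
      ennreal c * (ennreal (h u x y) / vol m x (gen_inv \<Phi> u)) \<le> subordinated \<mu> t x y \<and>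
      subordinated \<mu> t x y \<le> ennreal C * (ennreal (h u x y) / vol m x (gen_inv \<Phi> u)))"
proof -
  obtain c where c: "0 < c" and lo: "\<forall>\<mu> t u. subordinator_laws \<phi> \<mu> \<longrightarrow> 0 < t \<longrightarrow> u \<in> J \<longrightarrow> t * \<phi> (1 / u) \<le> 1 \<longrightarrow>
    (\<forall>x\<in>D. \<forall>y\<in>D. \<Phi> (dist x y) \<le> u \<longrightarrow>
      ennreal (c * (t * \<phi> (1 / u)) * h u x y / W x u) \<le> subordinated \<mu> t x y)"
    by (rule block_lower_bound[OF on_diagonal_lower])
  obtain C where C: "0 < C" and up: "\<forall>\<mu> t u. subordinator_laws \<phi> \<mu> \<longrightarrow> 0 < t \<longrightarrow> u \<in> J \<longrightarrow> t * \<phi> (1 / u) = 1 \<longrightarrow>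
    (\<forall>x\<in>D. \<forall>y\<in>D.
      subordinated \<mu> t x y \<le> ennreal (C * h u x y / W x u))"
    by (rule near_diagonal_upper)
  show ?thesis
  proof (rule that[OF c C], intro allI impI ballI)
    fix \<mu> :: "real \<Rightarrow> real measure" and t u :: real and x y
    assume laws: "subordinator_laws \<phi> \<mu>" and t: "0 < t" and u: "u \<in> J" and eq: "t * \<phi> (1 / u) = 1"
      and xy: "x \<in> D" "y \<in> D" and R: "\<Phi> (dist x y) \<le> u"
    note u0 = J_pos[OF u]
    have conv: "ennreal k * (ennreal (h u x y) / vol m x (gen_inv \<Phi> u)) = ennreal (k * h u x y / W x u)"
      if "0 < k" for k
      using that W_pos[OF u0, of x] h_nonneg[OF u0 xy]
      by (simp add: vol_gen_inv[OF u0] divide_ennreal flip: ennreal_mult')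
    have "ennreal (c * (t * \<phi> (1 / u)) * h u x y / W x u) \<le> subordinated \<mu> t x y"
      using lo[rule_format, OF laws t u _ xy R] eq by simp
    then show "ennreal c * (ennreal (h u x y) / vol m x (gen_inv \<Phi> u)) \<le> subordinated \<mu> t x y \<and>
      subordinated \<mu> t x y \<le> ennreal C * (ennreal (h u x y) / vol m x (gen_inv \<Phi> u))"
      unfolding conv[OF c] conv[OF C] using up[rule_format, OF laws t u eq xy] by (simp add: eq)
  qed
qed

lemma off_diagonal_local:
  assumes C0: "C0 = 0"
  obtains c C where "0 < c" "0 < C" "\<forall>\<mu> t. subordinator_laws \<phi> \<mu> \<longrightarrow> 0 < t \<longrightarrow>
    (\<forall>x\<in>D. \<forall>y\<in>D. x \<noteq> y \<longrightarrow> \<Phi> (dist x y) \<in> J \<longrightarrow> t * \<phi> (1 / \<Phi> (dist x y)) \<le> 1 \<longrightarrow>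
      ennreal c * (ennreal t / vol m x (dist x y) * (ennreal (h (\<Phi> (dist x y)) x y) / ennreal (1 / \<phi> (1 / \<Phi> (dist x y)))))
        \<le> subordinated \<mu> t x y \<and>
      subordinated \<mu> t x y \<le>
        ennreal C * (ennreal t / vol m x (dist x y) * (ennreal (h (\<Phi> (dist x y)) x y) / ennreal (1 / \<phi> (1 / \<Phi> (dist x y))))))"
proof -
  obtain c where c: "0 < c" and lo: "\<forall>\<mu> t u. subordinator_laws \<phi> \<mu> \<longrightarrow> 0 < t \<longrightarrow> u \<in> J \<longrightarrow> t * \<phi> (1 / u) \<le> 1 \<longrightarrow>
    (\<forall>x\<in>D. \<forall>y\<in>D. \<Phi> (dist x y) \<le> u \<longrightarrow>
      ennreal (c * (t * \<phi> (1 / u)) * h u x y / W x u) \<le> subordinated \<mu> t x y)"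
    by (rule block_lower_bound[OF on_diagonal_lower])
  obtain C where C: "0 < C" and up: "\<forall>\<mu> t. subordinator_laws \<phi> \<mu> \<longrightarrow> 0 < t \<longrightarrow>
    (\<forall>x\<in>D. \<forall>y\<in>D. \<Phi> (dist x y) \<in> J \<longrightarrow>
      subordinated \<mu> t x y \<le>
        ennreal (C * (t * \<phi> (1 / \<Phi> (dist x y))) * h (\<Phi> (dist x y)) x y / W x (\<Phi> (dist x y))))"
    by (rule off_diagonal_local_upper[OF off_diagonal_local_kernel_upper[OF C0]])
  show ?thesis
  proof (rule that[OF c C], intro allI impI ballI)
    fix \<mu> :: "real \<Rightarrow> real measure" and t :: real and x y
    assume laws: "subordinator_laws \<phi> \<mu>" and t: "0 < t" and xy: "x \<in> D" "y \<in> D" and ne: "x \<noteq> y"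
      and u: "\<Phi> (dist x y) \<in> J" and le: "t * \<phi> (1 / \<Phi> (dist x y)) \<le> 1"
    note u0 = J_pos[OF u]
    have dxy: "0 < dist x y" using ne by simp
    have f0: "0 < \<phi> (1 / \<Phi> (dist x y))" using u0 by (intro \<phi>_pos) simp
    have conv: "ennreal k * (ennreal t / vol m x (dist x y) * (ennreal (h (\<Phi> (dist x y)) x y) / ennreal (1 / \<phi> (1 / \<Phi> (dist x y))))) =
        ennreal (k * (t * \<phi> (1 / \<Phi> (dist x y))) * h (\<Phi> (dist x y)) x y / W x (\<Phi> (dist x y)))"
      if "0 < k" for k
    proof -
      have "ennreal t / vol m x (dist x y) = ennreal (t / W x (\<Phi> (dist x y)))"
        using t W_pos[OF u0, of x] by (simp add: vol_dist[OF dxy] divide_ennreal)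
      moreover have "ennreal (h (\<Phi> (dist x y)) x y) / ennreal (1 / \<phi> (1 / \<Phi> (dist x y))) =
          ennreal (h (\<Phi> (dist x y)) x y * \<phi> (1 / \<Phi> (dist x y)))"
        using f0 h_nonneg[OF u0 xy] by (subst divide_ennreal) simp_all
      moreover have "ennreal k * (ennreal (t / W x (\<Phi> (dist x y))) * ennreal (h (\<Phi> (dist x y)) x y * \<phi> (1 / \<Phi> (dist x y)))) =
          ennreal (k * (t / W x (\<Phi> (dist x y)) * (h (\<Phi> (dist x y)) x y * \<phi> (1 / \<Phi> (dist x y)))))"
        using that t W_pos[OF u0, of x] by (simp only: ennreal_mult' less_imp_le divide_pos_pos)
      ultimately show ?thesis by (simp add: mult_ac)
    qed
    show "ennreal c * (ennreal t / vol m x (dist x y) * (ennreal (h (\<Phi> (dist x y)) x y) / ennreal (1 / \<phi> (1 / \<Phi> (dist x y)))))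
        \<le> subordinated \<mu> t x y \<and>
      subordinated \<mu> t x y \<le>
        ennreal C * (ennreal t / vol m x (dist x y) * (ennreal (h (\<Phi> (dist x y)) x y) / ennreal (1 / \<phi> (1 / \<Phi> (dist x y)))))"
      unfolding conv[OF c] conv[OF C]
      using lo[rule_format, OF laws t u le xy order_refl] up[rule_format, OF laws t xy u] by blast
  qed
qed

lemma off_diagonal_jump:
  assumes C0: "C0 = 1" and K: "0 < K" and \<Psi>_le: "\<And>x y. x \<in> D \<Longrightarrow> y \<in> D \<Longrightarrow> x \<noteq> y \<Longrightarrow> \<Psi> (dist x y) \<le> K * \<Phi> (dist x y)"
    and \<phi>_mono: "\<And>l l'. 0 < l \<Longrightarrow> l \<le> l' \<Longrightarrow> \<phi> l \<le> \<phi> l'"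
    and w: "\<And>u. 0 \<le> w u" "\<And>u v. 0 < v \<Longrightarrow> v \<le> u \<Longrightarrow> w u \<le> w v" "\<And>u. 0 < u \<Longrightarrow> w u \<le> 2 * \<phi> (1 / u)"
    and Kw: "0 < Kw" "\<And>u. u \<in> J \<Longrightarrow> \<phi> (1 / u) \<le> Kw * w u"
  obtains c C where "0 < c" "0 < C" "\<forall>\<mu> t \<tau>. subordinator_laws \<phi> \<mu> \<longrightarrow> 0 < t \<longrightarrow> 0 < \<tau> \<longrightarrow> t * \<phi> (1 / \<tau>) = 1 \<longrightarrow>
    (\<forall>x\<in>D. \<forall>y\<in>D. x \<noteq> y \<longrightarrow> \<tau> \<le> \<Phi> (dist x y) \<longrightarrow> 4 * \<Phi> (dist x y) \<in> J \<longrightarrow>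
      ennreal c * (ennreal t / vol m x (dist x y) *
          ((\<integral>\<^sup>+ u\<in>{2 * \<tau>..4 * \<Phi> (dist x y)}. ennreal (h u x y * w u) \<partial>lborel) / ennreal (\<Phi> (dist x y))))
        \<le> subordinated \<mu> t x y \<and>
      subordinated \<mu> t x y \<le>
        ennreal C * (ennreal t / vol m x (dist x y) *
          ((\<integral>\<^sup>+ u\<in>{2 * \<tau>..4 * \<Phi> (dist x y)}. ennreal (h u x y * w u) \<partial>lborel) / ennreal (\<Phi> (dist x y)))))"
proof -
  have kernel_lower: "\<exists>c>0. \<forall>x\<in>D. \<forall>y\<in>D. \<forall>s. 4 * \<Phi> (dist x y) \<in> J \<and> 0 < s \<and> s \<le> 4 * \<Phi> (dist x y) \<longrightarrow>
      c * h s x y / W x (\<Phi> (dist x y)) * (s / \<Phi> (dist x y)) \<le> p s x y"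
    by (rule off_diagonal_jump_kernel_lower[OF C0 K]) (fact \<Psi>_le)
  note kernel_upper = off_diagonal_jump_kernel_upper[OF C0]
  obtain c where c: "0 < c" and lo: "\<forall>\<mu> t \<tau>. subordinator_laws \<phi> \<mu> \<longrightarrow> 0 < t \<longrightarrow> 0 < \<tau> \<longrightarrow> t * \<phi> (1 / \<tau>) = 1 \<longrightarrow>
    (\<forall>x\<in>D. \<forall>y\<in>D. \<tau> \<le> \<Phi> (dist x y) \<longrightarrow> 4 * \<Phi> (dist x y) \<in> J \<longrightarrow>
      ennreal (c * t / (\<Phi> (dist x y) * W x (\<Phi> (dist x y)))) * (\<integral>\<^sup>+ u\<in>{2 * \<tau>..4 * \<Phi> (dist x y)}. ennreal (h u x y * w u) \<partial>lborel)
      \<le> subordinated \<mu> t x y)"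
  proof (rule off_diagonal_jump_lower[where w = w and K = Kw and R = "\<lambda>x y. \<Phi> (dist x y)"], goal_cases)
    case 1 from 1(2,3) show ?case by (rule \<phi>_mono)
  next
    case 2 show ?case by (rule w)
  next
    case 3 from 3(2,3) show ?case by (rule w)
  next
    case 4 from 4(2) show ?case by (rule w)
  next
    case 5 show ?case by (rule Kw)
  next
    case 6 from 6(2) show ?case by (rule Kw)
  next
    case 7 show ?case by (rule kernel_lower)
  next
    case (8 c) from 8(2,3) show ?case by (rule that)
  qed
  obtain C where C: "0 < C" and up: "\<forall>\<mu> t \<tau>. subordinator_laws \<phi> \<mu> \<longrightarrow> 0 < t \<longrightarrow> 0 < \<tau> \<longrightarrow> t * \<phi> (1 / \<tau>) = 1 \<longrightarrow>
    (\<forall>x\<in>D. \<forall>y\<in>D. \<tau> \<le> \<Phi> (dist x y) \<longrightarrow> 4 * \<Phi> (dist x y) \<in> J \<longrightarrow>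
      subordinated \<mu> t x y \<le>
      ennreal (C * t / (\<Phi> (dist x y) * W x (\<Phi> (dist x y)))) * (\<integral>\<^sup>+ u\<in>{2 * \<tau>..4 * \<Phi> (dist x y)}. ennreal (h u x y * w u) \<partial>lborel))"
  proof (rule off_diagonal_jump_upper[where w = w and K = Kw and R = "\<lambda>x y. \<Phi> (dist x y)"], goal_cases)
    case 1 from 1(2,3) show ?case by (rule \<phi>_mono)
  next
    case 2 show ?case by (rule w)
  next
    case 3 from 3(2,3) show ?case by (rule w)
  next
    case 4 from 4(2) show ?case by (rule w)
  next
    case 5 show ?case by (rule Kw)
  next
    case 6 from 6(2) show ?case by (rule Kw)
  next
    case 7 show ?case by (rule kernel_upper)
  next
    case (8 c) from 8(2,3) show ?case by (rule that)
  qed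
  show ?thesis
  proof (rule that[OF c C], intro allI impI ballI)
    fix \<mu> :: "real \<Rightarrow> real measure" and t \<tau> :: real and x y
    assume laws: "subordinator_laws \<phi> \<mu>" and t: "0 < t" and \<tau>: "0 < \<tau>" "t * \<phi> (1 / \<tau>) = 1"
      and xy: "x \<in> D" "y \<in> D" and ne: "x \<noteq> y"
      and R: "\<tau> \<le> \<Phi> (dist x y)" "4 * \<Phi> (dist x y) \<in> J"
    define r where "r = \<Phi> (dist x y)"
    have r: "0 < r" using R \<tau> by (simp add: r_def)
    have dxy: "0 < dist x y" using ne by simp
    have Wr: "0 < W x r" by (rule W_pos[OF r])
    have conv: "ennreal k * (ennreal t / vol m x (dist x y) * (I / ennreal r)) = ennreal (k * t / (r * W x r)) * I"
      if "0 < k" for k and I :: ennreal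
    proof -
      have 1: "ennreal t / vol m x (dist x y) = ennreal (t / W x r)"
        using t Wr by (simp add: vol_dist[OF dxy] divide_ennreal r_def)
      have 2: "I / ennreal r = ennreal (1 / r) * I"
        using r by (simp add: divide_ennreal_def inverse_ennreal inverse_eq_divide mult.commute)
      have "k * t / (r * W x r) = k * (t / W x r * (1 / r))" by simp
      then have "ennreal (k * t / (r * W x r)) = ennreal k * (ennreal (t / W x r) * ennreal (1 / r))"
        using that t Wr by (simp only: ennreal_mult' less_imp_le divide_pos_pos)
      then show ?thesis unfolding 1 2 by (simp only: mult.assoc)
    qed
    show "ennreal c * (ennreal t / vol m x (dist x y) *
          ((\<integral>\<^sup>+ u\<in>{2 * \<tau>..4 * \<Phi> (dist x y)}. ennreal (h u x y * w u) \<partial>lborel) / ennreal (\<Phi> (dist x y))))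
        \<le> subordinated \<mu> t x y \<and>
      subordinated \<mu> t x y \<le>
        ennreal C * (ennreal t / vol m x (dist x y) *
          ((\<integral>\<^sup>+ u\<in>{2 * \<tau>..4 * \<Phi> (dist x y)}. ennreal (h u x y * w u) \<partial>lborel) / ennreal (\<Phi> (dist x y))))"
      unfolding r_def[symmetric] conv[OF c] conv[OF C]
      using lo[rule_format, OF laws t \<tau> xy R] up[rule_format, OF laws t \<tau> xy R] by (simp only: r_def)
  qed
qed

end

section \<open>Extending the heat kernel estimates to later times\<close>

lemma measure_ball_subset:
  fixes m :: "'a::metric_space measure"
  assumes bc: "\<And>K :: 'a set. bounded K \<Longrightarrow> closed K \<Longrightarrow> compact K"
    and radon: "radon_measure m" and supp: "full_support m" and "0 < R" and sub: "ball x r \<subseteq> ball y R"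
  shows "measure m (ball x r) \<le> measure m (ball y R)"
proof (rule measure_mono_fmeasurable[OF sub])
  have S: "sets m = sets borel" by (rule radon[unfolded radon_measure_def, THEN conjunct1])
  show "ball x r \<in> sets m" using S by simp
  show "ball y R \<in> fmeasurable m"
  proof (rule fmeasurableI)
    show "ball y R \<in> sets m" using S by simp
    show "emeasure m (ball y R) < \<infinity>"
    proof -
      have "emeasure m (ball y R) = ennreal (measure m (ball y R))"
        by (rule ball_measure(1)[OF bc radon supp \<open>0 < R\<close>])
      also have "\<dots> < \<infinity>" by (rule ennreal_less_top[folded infinity_ennreal_def])
      finally show ?thesis .
    qed
  qed
qed

lemma volume_growth_in_time:
  fixes m :: "'a::metric_space measure"
  assumes bc: "\<And>K :: 'a set. bounded K \<Longrightarrow> closed K \<Longrightarrow> compact K"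
    and radon: "radon_measure m" and supp: "full_support m"
    and RE: "0 < R_E" and scal: "volume_scaling m R_E" and \<Phi>: "scale_function \<Phi>"
    and J: "R_E = \<infinity> \<or> (\<forall>u\<in>J. u \<le> b)"
  shows "\<exists>C>0. \<exists>d\<ge>0. \<forall>S\<in>J. \<forall>s. 0 < s \<and> s \<le> S \<longrightarrow> (\<forall>x.
      measure m (ball x (gen_inv \<Phi> S)) \<le> C * (S / s) powr d * measure m (ball x (gen_inv \<Phi> s)))"
proof -
  have A: "R_E = \<infinity> \<or> (\<forall>r\<in>gen_inv \<Phi> ` J. r \<le> gen_inv \<Phi> b)"
    using J by (auto intro: gen_inv_mono[OF \<Phi>])
  obtain C d where C: "0 < C" "0 < d" and
    g: "\<And>x r R. 0 < r \<Longrightarrow> r \<le> R \<Longrightarrow> R \<in> gen_inv \<Phi> ` J \<Longrightarrow>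
      measure m (ball x R) \<le> C * (R / r) powr d * measure m (ball x r)"
    using volume_growth[OF bc radon supp RE scal A] by blast
  obtain e1 e2 b B where e: "0 < e1" "0 < e2" "0 < b" "0 < B"
    and gl: "\<And>s S. 0 < s \<Longrightarrow> s \<le> S \<Longrightarrow> b * (S / s) powr e1 \<le> gen_inv \<Phi> S / gen_inv \<Phi> s"
    and gu: "\<And>s S. 0 < s \<Longrightarrow> s \<le> S \<Longrightarrow> gen_inv \<Phi> S / gen_inv \<Phi> s \<le> B * (S / s) powr e2"
    using gen_inv_scaling[OF \<Phi>] by blast
  have "\<forall>S\<in>J. \<forall>s. 0 < s \<and> s \<le> S \<longrightarrow> (\<forall>x. measure m (ball x (gen_inv \<Phi> S)) \<le>
      C * B powr d * (S / s) powr (e2 * d) * measure m (ball x (gen_inv \<Phi> s)))"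
  proof (intro ballI allI impI; elim conjE)
    fix S s x assume S: "S \<in> J" and s: "0 < s" "s \<le> S"
    have p: "0 < gen_inv \<Phi> s" "0 < gen_inv \<Phi> S" using s by (auto intro!: gen_inv_pos[OF \<Phi>])
    have "measure m (ball x (gen_inv \<Phi> S)) \<le> C * (gen_inv \<Phi> S / gen_inv \<Phi> s) powr d * measure m (ball x (gen_inv \<Phi> s))"
      using S gen_inv_mono[OF \<Phi> s(2)] p by (intro g) auto
    also have "\<dots> \<le> C * (B * (S / s) powr e2) powr d * measure m (ball x (gen_inv \<Phi> s))"
      using gu[OF s] C p by (intro mult_right_mono mult_left_mono powr_mono2) auto
    also have "(B * (S / s) powr e2) powr d = B powr d * (S / s) powr (e2 * d)"
      using e by (simp add: powr_mult powr_powr)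
    finally show "measure m (ball x (gen_inv \<Phi> S)) \<le>
        C * B powr d * (S / s) powr (e2 * d) * measure m (ball x (gen_inv \<Phi> s))" by (simp only: mult.assoc)
  qed
  moreover have "0 < C * B powr d" "0 \<le> e2 * d" using C e by auto
  ultimately show ?thesis by blast
qed

lemma inverse_vol_eq:
  fixes m :: "'a::metric_space measure"
  assumes bc: "\<And>K :: 'a set. bounded K \<Longrightarrow> closed K \<Longrightarrow> compact K"
    and radon: "radon_measure m" and supp: "full_support m" and r: "0 < r"
  shows "1 / vol m x r = ennreal (1 / measure m (ball x r))"
proof -
  have "vol m x r = ennreal (measure m (ball x r))" by (rule vol_eq[OF bc radon supp r])
  moreover have "0 < measure m (ball x r)" by (rule ball_measure(2)[OF bc radon supp r])
  ultimately show ?thesis by (simp add: divide_ennreal flip: ennreal_1)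
qed

lemma hk_two_sided_imp_upper:
  fixes m :: "'a::metric_space measure"
  assumes bc: "\<And>K :: 'a set. bounded K \<Longrightarrow> closed K \<Longrightarrow> compact K"
    and radon: "radon_measure m" and supp: "full_support m" and \<Phi>: "scale_function \<Phi>"
    and J: "J \<subseteq> {0<..}"
    and h_nonneg: "\<forall>s>0. \<forall>x\<in>D. \<forall>y\<in>D. 0 \<le> h s x y"
    and ts: "\<forall>t\<in>J. \<forall>x\<in>D. \<forall>y\<in>D. ennreal (p t x y) \<le> ennreal (c * h t x y) * hk_profile m \<Phi> \<Psi> C0 c' t x y"
    and c: "0 < c" and s: "s \<in> J" and xy: "x \<in> D" "y \<in> D"
  shows "p s x y \<le> c * h s x y / measure m (ball x (gen_inv \<Phi> s))"
proof -
  have s0: "0 < s" using s J by auto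
  have th: "0 < gen_inv \<Phi> s" by (rule gen_inv_pos[OF \<Phi> s0])
  note B = ball_measure(2)[OF bc radon supp th, of x]
  have h0: "0 \<le> c * h s x y" using h_nonneg s0 xy c by simp
  have "ennreal (p s x y) \<le> ennreal (c * h s x y) * hk_profile m \<Phi> \<Psi> C0 c' s x y" using ts s xy by blast
  also have "\<dots> \<le> ennreal (c * h s x y) * (1 / vol m x (gen_inv \<Phi> s))"
    unfolding hk_profile_def by (intro mult_left_mono) auto
  also have "\<dots> = ennreal (c * h s x y * (1 / measure m (ball x (gen_inv \<Phi> s))))"
  proof -
    have "1 / vol m x (gen_inv \<Phi> s) = ennreal (1 / measure m (ball x (gen_inv \<Phi> s)))"
      by (rule inverse_vol_eq[OF bc radon supp th])
    then show ?thesis by (simp only: ennreal_mult'[OF h0])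
  qed
  finally show ?thesis using h0 B by (subst (asm) ennreal_le_iff) simp_all
qed

lemma HK_U_upper:
  fixes m :: "'a::metric_space measure"
  assumes bc: "\<And>K :: 'a set. bounded K \<Longrightarrow> closed K \<Longrightarrow> compact K"
    and radon: "radon_measure m" and supp: "full_support m" and \<Phi>: "scale_function \<Phi>"
    and h_nonneg: "\<forall>s>0. \<forall>x\<in>D. \<forall>y\<in>D. 0 \<le> h s x y"
    and h_anti: "\<forall>x\<in>D. \<forall>y\<in>D. \<forall>s t. 0 < s \<and> s \<le> t \<longrightarrow> h t x y \<le> h s x y"
    and HK: "hk_two_sided {0<..} m D \<Phi> \<Psi> h C0 p"
  shows "\<exists>C>0. \<forall>u>0. \<forall>s\<ge>u. \<forall>x\<in>D. \<forall>y\<in>D.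
      p s x y \<le> C * h u x y / measure m (ball x (gen_inv \<Phi> u))"
proof -
  obtain c c' where c: "0 < c" and
    ts: "\<forall>t\<in>{0<..}. \<forall>x\<in>D. \<forall>y\<in>D. ennreal (p t x y) \<le> ennreal (c * h t x y) * hk_profile m \<Phi> \<Psi> C0 c' t x y"
    using HK unfolding hk_two_sided_def by blast
  show ?thesis
  proof (intro exI[of _ c] conjI allI impI ballI)
    fix u s :: real and x y assume u: "0 < u" "u \<le> s" and xy: "x \<in> D" "y \<in> D"
    have s0: "0 < s" using u by simp
    have th: "0 < gen_inv \<Phi> u" "gen_inv \<Phi> u \<le> gen_inv \<Phi> s" "0 < gen_inv \<Phi> s"
      by (rule gen_inv_pos[OF \<Phi> u(1)], rule gen_inv_mono[OF \<Phi> u(2)], rule gen_inv_pos[OF \<Phi> s0])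
    have "p s x y \<le> c * h s x y / measure m (ball x (gen_inv \<Phi> s))"
      by (rule hk_two_sided_imp_upper[OF bc radon supp \<Phi> order_refl h_nonneg ts c _ xy]) (use s0 in simp_all)
    also have "\<dots> \<le> c * h u x y / measure m (ball x (gen_inv \<Phi> u))"
    proof (rule frac_le)
      show "c * h s x y \<le> c * h u x y" using h_anti u xy c by (intro mult_left_mono) auto
      show "0 \<le> c * h u x y" using h_nonneg u xy c by simp
      show "0 < measure m (ball x (gen_inv \<Phi> u))" by (rule ball_measure(2)[OF bc radon supp th(1)])
      show "measure m (ball x (gen_inv \<Phi> u)) \<le> measure m (ball x (gen_inv \<Phi> s))"
        by (rule measure_ball_subset[OF bc radon supp th(3)]) (use th in \<open>simp_all add: subset_ball\<close>)
    qed
    finally show "p s x y \<le> c * h u x y / measure m (ball x (gen_inv \<Phi> u))" .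
  qed (rule c)
qed

text \<open>
  A ball around one point of \<open>D\<close> is contained in an enlarged ball around any other point of \<open>D\<close>, and volume
  growth compares the enlarged ball with the original one.
\<close>

lemma bounded_ball_measure_bounds:
  fixes m :: "'a::metric_space measure"
  assumes bc: "\<And>K :: 'a set. bounded K \<Longrightarrow> closed K \<Longrightarrow> compact K"
    and radon: "radon_measure m" and supp: "full_support m"
    and RE: "0 < R_E" and scal: "volume_scaling m R_E"
    and D: "bounded D" "D \<noteq> {}" and r: "0 < r"
  obtains v V where "0 < v" "0 < V" "\<forall>x\<in>D. v \<le> measure m (ball x r) \<and> measure m (ball x r) \<le> V"
proof -
  obtain x0 where x0: "x0 \<in> D" using D by blast
  define e where "e = diameter D"
  have e: "dist x x0 \<le> e" if "x \<in> D" for x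
    unfolding e_def by (rule diameter_bounded_bound[OF D(1) that x0])
  have e0: "0 \<le> e" using e[OF x0] by simp
  have re: "0 < r + e" using r e0 by simp
  have A: "R_E = \<infinity> \<or> (\<forall>s\<in>{r + e}. s \<le> r + e)" by simp
  obtain C d where C: "0 < C" "0 < d" and
    g: "\<And>x s R. 0 < s \<Longrightarrow> s \<le> R \<Longrightarrow> R \<in> {r + e} \<Longrightarrow>
      measure m (ball x R) \<le> C * (R / s) powr d * measure m (ball x s)"
    using volume_growth[OF bc radon supp RE scal A] by blast
  define k where "k = C * ((r + e) / r) powr d"
  have k: "0 < k" using C r re by (simp add: k_def)
  note m0 = ball_measure(2)[OF bc radon supp r, of x0]
  show ?thesis
  proof (rule that[of "measure m (ball x0 r) / k" "measure m (ball x0 (r + e))"])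
    show "0 < measure m (ball x0 r) / k" using m0 k by simp
    show "0 < measure m (ball x0 (r + e))" by (rule ball_measure(2)[OF bc radon supp re])
    show "\<forall>x\<in>D. measure m (ball x0 r) / k \<le> measure m (ball x r) \<and> measure m (ball x r) \<le> measure m (ball x0 (r + e))"
    proof (intro ballI conjI)
      fix x assume x: "x \<in> D"
      note dx = e[OF x]
      have "measure m (ball x0 r) \<le> measure m (ball x (r + e))"
      proof (rule measure_ball_subset[OF bc radon supp re])
        show "ball x0 r \<subseteq> ball x (r + e)"
        proof
          fix z assume "z \<in> ball x0 r"
          then show "z \<in> ball x (r + e)" using dx dist_triangle[of x z x0] by simp
        qed
      qed simp_all
      also have "\<dots> \<le> k * measure m (ball x r)" unfolding k_def using r e0 by (intro g) auto
      finally show "measure m (ball x0 r) / k \<le> measure m (ball x r)"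
        using k by (simp add: pos_divide_le_eq mult.commute)
      show "measure m (ball x r) \<le> measure m (ball x0 (r + e))"
      proof (rule measure_ball_subset[OF bc radon supp re])
        show "ball x r \<subseteq> ball x0 (r + e)"
        proof
          fix z assume "z \<in> ball x r"
          then show "z \<in> ball x0 (r + e)" using dx dist_triangle[of x0 z x] by (simp add: dist_commute)
        qed
      qed simp_all
    qed
  qed
qed

text \<open>
  For times between 1 and \<open>L\<close> everything except \<open>h\<close> is bounded above and below: the exponential
  factor, the volumes and the Gaussian factor. The kernel is there of order \<open>h 1\<close>, which is at least
  \<open>h s\<close> by monotonicity and is at most a multiple of \<open>h s\<close> by the power decay on \<open>{0<..L}\<close>. After time \<open>L\<close>
  the kernel is still at most a multiple of \<open>h 1\<close>.
\<close>

lemma HK_B_finite_horizon: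
  fixes m :: "'a::metric_space measure"
  assumes bc: "\<And>K :: 'a set. bounded K \<Longrightarrow> closed K \<Longrightarrow> compact K"
    and radon: "radon_measure m" and supp: "full_support m"
    and RE: "0 < R_E" and scal: "volume_scaling m R_E" and \<Phi>: "scale_function \<Phi>"
    and h_nonneg: "\<forall>s>0. \<forall>x\<in>D. \<forall>y\<in>D. 0 \<le> h s x y"
    and h_anti: "\<forall>x\<in>D. \<forall>y\<in>D. \<forall>s t. 0 < s \<and> s \<le> t \<longrightarrow> h t x y \<le> h s x y"
    and p_nonneg: "\<forall>s>0. \<forall>x\<in>D. \<forall>y\<in>D. 0 \<le> p s x y"
    and HK: "HK_B m D \<Phi> \<Psi> h C0 p" and D: "D \<noteq> {}" and dec: "power_decay_on {0<..L} D h"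
  shows "hk_two_sided {0<..L} m D \<Phi> \<Psi> h C0 p"
    "\<exists>C>0. \<forall>u\<in>{0<..L}. \<forall>s\<ge>u. \<forall>x\<in>D. \<forall>y\<in>D.
      p s x y \<le> C * h u x y / measure m (ball x (gen_inv \<Phi> u))"
proof -
  have bD: "bounded D" using HK by (simp add: HK_B_def)
  have C0: "C0 \<in> {0, 1}" using HK by (simp add: HK_B_def hk_two_sided_def)
  obtain c1 c2 c3 c4 where c: "0 < c1" "0 < c2" "0 < c3" "0 < c4" and
    ts: "\<forall>t\<in>{0<..1}. \<forall>x\<in>D. \<forall>y\<in>D.
      ennreal (c1 * h t x y) * hk_profile m \<Phi> \<Psi> C0 c2 t x y \<le> ennreal (p t x y) \<and>
      ennreal (p t x y) \<le> ennreal (c3 * h t x y) * hk_profile m \<Phi> \<Psi> C0 c4 t x y"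
    using HK unfolding HK_B_def hk_two_sided_def by blast
  obtain l e1 e2 where l: "0 < l" and e: "0 < e1" "0 < e2" and
    large': "\<forall>z\<in>{1..} \<times> D \<times> D. ennreal e1 * (\<lambda>(t, x, y). ennreal (exp (- l * t) * h 1 x y)) z \<le>
        (\<lambda>(t, x, y). ennreal (p t x y)) z \<and>
      (\<lambda>(t, x, y). ennreal (p t x y)) z \<le> ennreal e2 * (\<lambda>(t, x, y). ennreal (exp (- l * t) * h 1 x y)) z"
    using HK unfolding HK_B_def comparable_on_def by blast
  have large: "e1 * (exp (- l * t) * h 1 x y) \<le> p t x y" "p t x y \<le> e2 * (exp (- l * t) * h 1 x y)"
    if "1 \<le> t" "x \<in> D" "y \<in> D" for t x y
  proof -
    have h1: "0 \<le> exp (- l * t) * h 1 x y" using h_nonneg that by simp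
    have p0: "0 \<le> p t x y" using p_nonneg that by simp
    have "ennreal (e1 * (exp (- l * t) * h 1 x y)) \<le> ennreal (p t x y)"
      "ennreal (p t x y) \<le> ennreal (e2 * (exp (- l * t) * h 1 x y))"
      using bspec[OF large', of "(t, x, y)"] that e by (simp_all add: ennreal_mult')
    then show "e1 * (exp (- l * t) * h 1 x y) \<le> p t x y" "p t x y \<le> e2 * (exp (- l * t) * h 1 x y)"
      using p0 mult_nonneg_nonneg[OF less_imp_le[OF e(2)] h1] by (simp_all only: ennreal_le_iff)
  qed
  define L' where "L' = max L 1"
  define W where "W = (\<lambda>x s. measure m (ball x (gen_inv \<Phi> s)))"
  have th: "0 < gen_inv \<Phi> s" if "0 < s" for s by (rule gen_inv_pos[OF \<Phi> that])
  have Wpos: "0 < W x s" if "0 < s" for x s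
    unfolding W_def by (rule ball_measure(2)[OF bc radon supp th[OF that]])
  have Wmono: "W x s \<le> W x u" if "0 < s" "s \<le> u" for x s u
    unfolding W_def using that gen_inv_mono[OF \<Phi> that(2)]
    by (intro measure_ball_subset[OF bc radon supp th]) (simp_all add: subset_ball)
  have vol: "1 / vol m x (gen_inv \<Phi> s) = ennreal (1 / W x s)" if "0 < s" for x s
    unfolding W_def by (rule inverse_vol_eq[OF bc radon supp th[OF that]])
  have L'0: "0 < L'" by (simp add: L'_def)
  obtain v v' where v: "0 < v" "0 < v'" "\<forall>x\<in>D. v \<le> W x 1 \<and> W x 1 \<le> v'"
    unfolding W_def by (rule bounded_ball_measure_bounds[OF bc radon supp RE scal bD D th[OF zero_less_one]])
  obtain V' V where V: "0 < V'" "0 < V" "\<forall>x\<in>D. V' \<le> W x L' \<and> W x L' \<le> V"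
    unfolding W_def by (rule bounded_ball_measure_bounds[OF bc radon supp RE scal bD D th[OF L'0]])
  obtain cd \<gamma> where cd: "0 < cd" "0 \<le> \<gamma>" and dec': "\<forall>s\<in>{0<..L}. \<forall>t\<in>{0<..L}. s \<le> t \<longrightarrow> (\<forall>x\<in>D. \<forall>y\<in>D.
      s powr \<gamma> * h s x y \<le> cd * (t powr \<gamma> * h t x y))"
    using dec unfolding power_decay_on_def by blast
  define k where "k = max 1 (cd * L' powr \<gamma>)"
  have k: "1 \<le> k" by (simp add: k_def)
  have h1: "h 1 x y \<le> k * h s x y" if s: "s \<in> {0<..L}" and xy: "x \<in> D" "y \<in> D" for s x y
  proof (cases "s \<le> 1")
    case True
    then have "h 1 x y \<le> h s x y" using h_anti s xy by auto
    also have "\<dots> = 1 * h s x y" by simp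
    also have "\<dots> \<le> k * h s x y" using k h_nonneg s xy by (intro mult_right_mono) auto
    finally show ?thesis .
  next
    case False
    then have "1 powr \<gamma> * h 1 x y \<le> cd * (s powr \<gamma> * h s x y)"
      using s by (intro dec'[rule_format, OF _ s _ xy]) auto
    also have "\<dots> \<le> cd * (L' powr \<gamma> * h s x y)"
      using cd s False h_nonneg xy by (intro mult_left_mono mult_right_mono powr_mono2) (auto simp: L'_def)
    also have "\<dots> \<le> k * h s x y"
      using h_nonneg s xy by (simp add: k_def mult_right_mono flip: mult.assoc)
    finally show ?thesis by simp
  qed
  have up1: "p s x y \<le> e2 * h 1 x y" if "1 \<le> s" "x \<in> D" "y \<in> D" for s x y
  proof -
    have "exp (- l * s) * h 1 x y \<le> 1 * h 1 x y"
      using l that h_nonneg by (intro mult_right_mono) auto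
    then have "e2 * (exp (- l * s) * h 1 x y) \<le> e2 * h 1 x y" using e by (intro mult_left_mono) auto
    then show ?thesis using large(2)[OF that] by linarith
  qed
  \<comment> \<open>smallest value of the Gaussian factor over \<open>D\<close> at times after 1\<close>
  define \<epsilon> where "\<epsilon> = exp (- (c4 * (diameter D)\<^sup>2 / (gen_inv \<Phi> 1)\<^sup>2))"
  have \<epsilon>: "0 < \<epsilon>" "\<epsilon> \<le> 1" using c by (auto simp: \<epsilon>_def)
  define c1' where "c1' = min c1 (e1 * exp (- l * L) * v)"
  define c3' where "c3' = max c3 (e2 * k * V / \<epsilon>)"
  have c': "0 < c1'" "c1' \<le> c1" "c3 \<le> c3'" "0 < c3'" using c e v by (auto simp: c1'_def c3'_def)
  have two: "ennreal (c1' * h t x y) * hk_profile m \<Phi> \<Psi> C0 c2 t x y \<le> ennreal (p t x y) \<and>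
      ennreal (p t x y) \<le> ennreal (c3' * h t x y) * hk_profile m \<Phi> \<Psi> C0 c4 t x y"
    if t: "t \<in> {0<..L}" and xy: "x \<in> D" "y \<in> D" for t x y
  proof (cases "t \<le> 1")
    case True
    have ht: "0 \<le> h t x y" using h_nonneg t xy by simp
    have "ennreal (c1' * h t x y) * hk_profile m \<Phi> \<Psi> C0 c2 t x y \<le> ennreal (c1 * h t x y) * hk_profile m \<Phi> \<Psi> C0 c2 t x y"
      using c' ht by (intro mult_right_mono ennreal_leI) auto
    moreover have "ennreal (c3 * h t x y) * hk_profile m \<Phi> \<Psi> C0 c4 t x y \<le> ennreal (c3' * h t x y) * hk_profile m \<Phi> \<Psi> C0 c4 t x y"
      using c' ht by (intro mult_right_mono ennreal_leI) auto
    moreover have "t \<in> {0<..1}" using t True by simp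
    ultimately show ?thesis using ts xy by (meson order_trans)
  next
    case False
    then have t1: "1 \<le> t" "0 < t" "t \<le> L" using t by auto
    have ht: "0 \<le> h t x y" using h_nonneg t1 xy by simp
    have W: "v \<le> W x t" "W x t \<le> V"
    proof -
      have "v \<le> W x 1" "W x L' \<le> V" using v(3) V(3) xy by blast+
      moreover have "W x 1 \<le> W x t" by (rule Wmono) (use t1 in auto)
      moreover have "W x t \<le> W x L'" by (rule Wmono) (use t1 in \<open>auto simp: L'_def\<close>)
      ultimately show "v \<le> W x t" "W x t \<le> V" by linarith+
    qed
    have lower: "ennreal (c1' * h t x y) * hk_profile m \<Phi> \<Psi> C0 c2 t x y \<le> ennreal (p t x y)"
    proof -
      have "hk_profile m \<Phi> \<Psi> C0 c2 t x y \<le> 1 / vol m x (gen_inv \<Phi> t)"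
        unfolding hk_profile_def by (rule min.cobounded1)
      also have "\<dots> \<le> ennreal (1 / v)"
        unfolding vol[OF t1(2)] using W v by (intro ennreal_leI divide_left_mono mult_pos_pos) auto
      finally have "ennreal (c1' * h t x y) * hk_profile m \<Phi> \<Psi> C0 c2 t x y \<le> ennreal (c1' * h t x y) * ennreal (1 / v)"
        by (rule mult_left_mono) simp
      also have "\<dots> = ennreal (c1' * h t x y * (1 / v))" using c' ht by (intro ennreal_mult'[symmetric]) simp
      also have "\<dots> \<le> ennreal (p t x y)"
      proof (rule ennreal_leI)
        have "c1' * h t x y * (1 / v) \<le> (e1 * exp (- l * L) * v) * h t x y * (1 / v)"
          using ht v by (intro mult_right_mono) (auto simp: c1'_def)
        also have "\<dots> = e1 * (exp (- l * L) * h t x y)" using v by simp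
        also have "\<dots> \<le> e1 * (exp (- l * t) * h 1 x y)"
          using e l t1 h_anti xy ht by (intro mult_left_mono mult_mono) auto
        also have "\<dots> \<le> p t x y" by (rule large(1)[OF t1(1) xy])
        finally show "c1' * h t x y * (1 / v) \<le> p t x y" .
      qed
      finally show ?thesis .
    qed
    have upper: "ennreal (p t x y) \<le> ennreal (c3' * h t x y) * hk_profile m \<Phi> \<Psi> C0 c4 t x y"
    proof -
      have Wt: "0 < W x t" by (rule Wpos[OF t1(2)])
      have "\<epsilon> / V \<le> \<epsilon> / W x t" using W Wt V \<epsilon> by (intro divide_left_mono mult_pos_pos) auto
      also have "\<dots> \<le> 1 / W x t" using \<epsilon> Wt by (intro divide_right_mono) auto
      finally have 1: "ennreal (\<epsilon> / V) \<le> 1 / vol m x (gen_inv \<Phi> t)"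
        unfolding vol[OF t1(2)] by (rule ennreal_leI)
      have "\<epsilon> \<le> exp (- (c4 * (dist x y)\<^sup>2 / (gen_inv \<Phi> t)\<^sup>2))"
      proof -
        have "(dist x y)\<^sup>2 / (gen_inv \<Phi> t)\<^sup>2 \<le> (diameter D)\<^sup>2 / (gen_inv \<Phi> 1)\<^sup>2"
          using diameter_bounded_bound[OF bD xy] th[of 1] gen_inv_mono[OF \<Phi> t1(1)]
          by (intro frac_le power_mono zero_less_power) auto
        then have "c4 * ((dist x y)\<^sup>2 / (gen_inv \<Phi> t)\<^sup>2) \<le> c4 * ((diameter D)\<^sup>2 / (gen_inv \<Phi> 1)\<^sup>2)"
          using c by (intro mult_left_mono) auto
        then show ?thesis by (simp add: \<epsilon>_def)
      qed
      then have "\<epsilon> / V \<le> 1 / W x t * exp (- (c4 * (dist x y)\<^sup>2 / (gen_inv \<Phi> t)\<^sup>2))"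
        using W Wt V \<epsilon> by (simp add: frac_le)
      then have "ennreal (\<epsilon> / V) \<le> ennreal (1 / W x t * exp (- (c4 * (dist x y)\<^sup>2 / (gen_inv \<Phi> t)\<^sup>2)))"
        by (rule ennreal_leI)
      also have "\<dots> = 1 / vol m x (gen_inv \<Phi> t) * ennreal (exp (- (c4 * (dist x y)\<^sup>2 / (gen_inv \<Phi> t)\<^sup>2)))"
        unfolding vol[OF t1(2)] using Wt by (intro ennreal_mult') simp
      finally have 2: "ennreal (\<epsilon> / V) \<le> hk_profile m \<Phi> \<Psi> C0 c4 t x y"
        unfolding hk_profile_def using 1 by (simp add: add_increasing)
      have "p t x y \<le> e2 * h 1 x y" by (rule up1[OF t1(1) xy])
      also have "\<dots> \<le> e2 * (k * h t x y)" using h1[OF t xy] e by (intro mult_left_mono) auto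
      also have "\<dots> = (e2 * k * V / \<epsilon>) * h t x y * (\<epsilon> / V)" using \<epsilon> V by simp
      also have "\<dots> \<le> c3' * h t x y * (\<epsilon> / V)"
        using ht \<epsilon> V by (intro mult_right_mono) (auto simp: c3'_def)
      finally have "ennreal (p t x y) \<le> ennreal (c3' * h t x y * (\<epsilon> / V))" by (rule ennreal_leI)
      also have "\<dots> = ennreal (c3' * h t x y) * ennreal (\<epsilon> / V)"
        using c' ht by (intro ennreal_mult') simp
      also have "\<dots> \<le> ennreal (c3' * h t x y) * hk_profile m \<Phi> \<Psi> C0 c4 t x y"
        using 2 by (rule mult_left_mono) simp
      finally show ?thesis .
    qed
    show ?thesis using lower upper by blast
  qed
  show "hk_two_sided {0<..L} m D \<Phi> \<Psi> h C0 p"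
    unfolding hk_two_sided_def
    by (rule conjI, rule C0, rule exI[of _ c1'], rule conjI, rule c'(1), rule exI[of _ c2], rule conjI, rule c(2),
        rule exI[of _ c3'], rule conjI, rule c'(4), rule exI[of _ c4], rule conjI, rule c(4), intro ballI, rule two)
  have small: "p s x y \<le> c3 * h s x y / W x s" if "s \<in> {0<..1}" "x \<in> D" "y \<in> D" for s x y
    unfolding W_def
  proof (rule hk_two_sided_imp_upper[OF bc radon supp \<Phi> _ h_nonneg _ c(3) that])
    show "\<forall>t\<in>{0<..1}. \<forall>x\<in>D. \<forall>y\<in>D. ennreal (p t x y) \<le> ennreal (c3 * h t x y) * hk_profile m \<Phi> \<Psi> C0 c4 t x y"
      using ts by blast
  qed auto
  show "\<exists>C>0. \<forall>u\<in>{0<..L}. \<forall>s\<ge>u. \<forall>x\<in>D. \<forall>y\<in>D. p s x y \<le> C * h u x y / measure m (ball x (gen_inv \<Phi> u))"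
  proof (intro exI[of _ "c3 + e2 * k * V"] conjI ballI allI impI)
    show "0 < c3 + e2 * k * V" using c e k V by (simp add: add_pos_nonneg)
    fix u s x y assume u: "u \<in> {0<..L}" and s: "u \<le> s" and xy: "x \<in> D" "y \<in> D"
    have u0: "0 < u" "u \<le> L'" using u by (auto simp: L'_def)
    have hu: "0 \<le> h u x y" using h_nonneg u0 xy by simp
    have Wu: "0 < W x u" by (rule Wpos[OF u0(1)])
    have "p s x y \<le> (c3 + e2 * k * V) * h u x y / W x u"
    proof (cases "s \<le> 1")
      case True
      then have "p s x y \<le> c3 * h s x y / W x s" using u0 s xy by (intro small) auto
      also have "\<dots> \<le> (c3 + e2 * k * V) * h u x y / W x u"
      proof (intro frac_le mult_mono)
        show "h s x y \<le> h u x y" using h_anti u0 s xy by blast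
        show "0 \<le> h s x y" using h_nonneg u0 s xy by simp
        show "c3 \<le> c3 + e2 * k * V" "0 \<le> c3 + e2 * k * V" using c e k V by simp_all
        show "0 \<le> (c3 + e2 * k * V) * h u x y" using c e k V hu by simp
        show "0 < W x u" "W x u \<le> W x s" by (fact Wu, rule Wmono[OF u0(1) s])
      qed
      finally show ?thesis .
    next
      case False
      then have "p s x y \<le> e2 * h 1 x y" using xy by (intro up1) auto
      also have "\<dots> \<le> e2 * (k * h u x y)" using h1[OF u xy] e by (intro mult_left_mono) auto
      also have "\<dots> = e2 * k * W x u * h u x y / W x u" using Wu by simp
      also have "\<dots> \<le> (c3 + e2 * k * V) * h u x y / W x u"
      proof (intro divide_right_mono mult_right_mono)
        have "W x L' \<le> V" using V(3) xy by blast
        then have "W x u \<le> V" using Wmono[OF u0, of x] by linarith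
        then have "e2 * k * W x u \<le> e2 * k * V" using e k by (intro mult_left_mono) auto
        then show "e2 * k * W x u \<le> c3 + e2 * k * V" using c by simp
      qed (use hu Wu in auto)
      finally show ?thesis .
    qed
    then show "p s x y \<le> (c3 + e2 * k * V) * h u x y / measure m (ball x (gen_inv \<Phi> u))"
      by (simp only: W_def)
  qed
qed

section \<open>The estimates for the subordinate kernel\<close>

context
  fixes \<nu> :: "real measure" and R1 :: ereal and b1 b2 :: real
  assumes levy: "subordinator_levy_measure \<nu>" and poly: "poly_tail \<nu> R1 b1 b2" and b2: "b2 < 1"
    and R1: "0 < R1"
begin

lemma levy_tail_positive: "\<exists>r>0. 0 < levy_tail \<nu> r"
proof -
  obtain r0 where r0: "0 < r0" "ereal r0 < R1" using ereal_dense2[OF R1] by auto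
  obtain C where C: "0 < C" "\<And>r. 0 < r \<Longrightarrow> ereal r < R1 \<Longrightarrow>
    0 < levy_tail \<nu> r \<and> laplace_exponent \<nu> (1 / r) \<le> C * levy_tail \<nu> r"
    using laplace_exponent_le_levy_tail[OF levy poly b2] by blast
  show ?thesis using C(2)[OF r0] r0(1) by blast
qed

lemma sub_time_pos: "0 < t \<Longrightarrow> 0 < sub_time \<nu> t"
  by (rule sub_time(1)[OF levy levy_tail_positive laplace_exponent_unbounded[OF levy poly b2 R1]])

lemma sub_time_eq: "0 < t \<Longrightarrow> t * laplace_exponent \<nu> (1 / sub_time \<nu> t) = 1"
  by (rule sub_time(2)[OF levy levy_tail_positive laplace_exponent_unbounded[OF levy poly b2 R1]])

lemma sub_time_mono:
  assumes "0 < s" "s \<le> t"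
  shows "sub_time \<nu> s \<le> sub_time \<nu> t"
proof -
  have t: "0 < t" using assms by simp
  let ?f = "laplace_exponent \<nu>"
  have f: "?f (1 / sub_time \<nu> s) = 1 / s" "?f (1 / sub_time \<nu> t) = 1 / t"
    using sub_time_eq[OF assms(1)] sub_time_eq[OF t] assms(1) t by (simp_all add: field_simps)
  note p = sub_time_pos[OF assms(1)] sub_time_pos[OF t]
  have "\<not> ?f (1 / sub_time \<nu> s) < ?f (1 / sub_time \<nu> t)"
    unfolding f using assms by (simp add: frac_le not_less)
  then have "\<not> 1 / sub_time \<nu> s < 1 / sub_time \<nu> t"
    using p by (subst (asm) laplace_exponent_less_iff[OF levy levy_tail_positive]) auto
  then show ?thesis using p by (simp add: not_less field_simps)
qed

context
  fixes \<Phi> :: "real \<Rightarrow> real"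
  assumes \<Phi>: "scale_function \<Phi>"
begin

text \<open>
  The spatial scale \<open>\<psi>\<close> and the time \<open>\<tau>\<close> express the same comparison, because \<open>1/t = \<phi> (1/\<tau>)\<close> and \<open>\<phi>\<close> is strictly
  increasing. At \<open>r = 0\<close>, where \<open>\<psi>\<close> is set to 0 by convention, both sides are false since \<open>\<Phi> 0 = 0\<close>.
\<close>

lemma less_sub_scale_iff:
  assumes t: "0 < t" and r: "0 \<le> r"
  shows "t < sub_scale \<nu> \<Phi> r \<longleftrightarrow> sub_time \<nu> t < \<Phi> r"
proof (cases "r = 0")
  case True
  then show ?thesis using t sub_time_pos[OF t] scale_function_0[OF \<Phi>] by (simp add: sub_scale_def)
next
  case False
  let ?\<tau> = "sub_time \<nu> t" and ?f = "laplace_exponent \<nu>"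
  have p: "0 < \<Phi> r" "0 < ?\<tau>" using False r scale_function_pos[OF \<Phi>, of r] sub_time_pos[OF t] by auto
  have f: "0 < ?f (1 / \<Phi> r)" using laplace_exponent_pos[OF levy levy_tail_positive, of "1 / \<Phi> r"] p by simp
  have ft: "?f (1 / ?\<tau>) = 1 / t" using sub_time_eq[OF t] t by (simp add: field_simps)
  have "t < sub_scale \<nu> \<Phi> r \<longleftrightarrow> ?f (1 / \<Phi> r) < ?f (1 / ?\<tau>)"
    unfolding ft using False t f by (simp add: sub_scale_def field_simps)
  also have "\<dots> \<longleftrightarrow> 1 / \<Phi> r < 1 / ?\<tau>"
    using p by (intro laplace_exponent_less_iff[OF levy levy_tail_positive]) auto
  also have "\<dots> \<longleftrightarrow> ?\<tau> < \<Phi> r" using p by (simp add: field_simps)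
  finally show ?thesis .
qed

lemma le_sub_scale_iff:
  assumes t: "0 < t" and r: "0 \<le> r"
  shows "t \<le> sub_scale \<nu> \<Phi> r \<longleftrightarrow> sub_time \<nu> t \<le> \<Phi> r"
proof (cases "r = 0")
  case True
  then show ?thesis using t sub_time_pos[OF t] scale_function_0[OF \<Phi>] by (simp add: sub_scale_def)
next
  case False
  let ?\<tau> = "sub_time \<nu> t" and ?f = "laplace_exponent \<nu>"
  have p: "0 < \<Phi> r" "0 < ?\<tau>" using False r scale_function_pos[OF \<Phi>, of r] sub_time_pos[OF t] by auto
  have f: "0 < ?f (1 / \<Phi> r)" using laplace_exponent_pos[OF levy levy_tail_positive, of "1 / \<Phi> r"] p by simp
  have ft: "?f (1 / ?\<tau>) = 1 / t" using sub_time_eq[OF t] t by (simp add: field_simps)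
  have "t \<le> sub_scale \<nu> \<Phi> r \<longleftrightarrow> \<not> ?f (1 / ?\<tau>) < ?f (1 / \<Phi> r)"
    unfolding ft not_less using False t f by (simp add: sub_scale_def field_simps)
  also have "?f (1 / ?\<tau>) < ?f (1 / \<Phi> r) \<longleftrightarrow> 1 / ?\<tau> < 1 / \<Phi> r"
    using p by (intro laplace_exponent_less_iff[OF levy levy_tail_positive]) auto
  also have "\<dots> \<longleftrightarrow> \<Phi> r < ?\<tau>" using p by (simp add: field_simps)
  finally show ?thesis by (simp add: not_less)
qed

lemma gen_inv_sub_scale:
  assumes t: "0 < t"
  shows "gen_inv (sub_scale \<nu> \<Phi>) t = gen_inv \<Phi> (sub_time \<nu> t)"
proof -
  have "{s. 0 \<le> s \<and> t < sub_scale \<nu> \<Phi> s} = {s. 0 \<le> s \<and> sub_time \<nu> t < \<Phi> s}"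
    using less_sub_scale_iff[OF t] by blast
  then show ?thesis by (simp only: gen_inv_def)
qed

lemma le_sub_scale_imp:
  assumes t: "0 < t" and r: "0 < r" and le: "t \<le> sub_scale \<nu> \<Phi> r"
  shows "t * laplace_exponent \<nu> (1 / \<Phi> r) \<le> 1"
proof -
  have "0 < laplace_exponent \<nu> (1 / \<Phi> r)"
    using laplace_exponent_pos[OF levy levy_tail_positive, of "1 / \<Phi> r"] scale_function_pos[OF \<Phi> r] by simp
  then show ?thesis using le r by (simp add: sub_scale_def field_simps)
qed

end

end

context hk_setting
begin

lemma near_diagonal_estimate_subordinate:
  assumes \<phi>: "\<phi> = laplace_exponent \<nu>"
    and levy: "subordinator_levy_measure \<nu>" and poly: "poly_tail \<nu> R1 b1 b2" and b2: "b2 < 1" and R1: "0 < R1"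
    and laws: "\<forall>x\<in>D. subordinator_laws \<phi> (\<lambda>t. distr (P (Some x)) borel (S t))"
    and I: "\<And>t. t \<in> I \<Longrightarrow> 0 < t \<and> sub_time \<nu> t \<in> J"
  shows "near_diagonal_estimate I m D \<nu> \<Phi> h (subordinate_kernel P S p)"
proof -
  obtain c C where c: "0 < c" "0 < C" and est: "\<forall>\<mu> t u. subordinator_laws \<phi> \<mu> \<longrightarrow> 0 < t \<longrightarrow> u \<in> J \<longrightarrow> t * \<phi> (1 / u) = 1 \<longrightarrow>
    (\<forall>x\<in>D. \<forall>y\<in>D. \<Phi> (dist x y) \<le> u \<longrightarrow>
      ennreal c * (ennreal (h u x y) / vol m x (gen_inv \<Phi> u)) \<le> (\<integral>\<^sup>+ s\<in>{0<..}. ennreal (p s x y) \<partial>\<mu> t) \<and>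
      (\<integral>\<^sup>+ s\<in>{0<..}. ennreal (p s x y) \<partial>\<mu> t) \<le> ennreal C * (ennreal (h u x y) / vol m x (gen_inv \<Phi> u)))"
    by (rule near_diagonal)
  have main: "ennreal c * (ennreal (h (sub_time \<nu> t) x y) / vol m x (gen_inv (sub_scale \<nu> \<Phi>) t)) \<le> subordinate_kernel P S p t x y \<and>
      subordinate_kernel P S p t x y \<le> ennreal C * (ennreal (h (sub_time \<nu> t) x y) / vol m x (gen_inv (sub_scale \<nu> \<Phi>) t))"
    if t: "t \<in> I" and xy: "x \<in> D" "y \<in> D" and le: "sub_scale \<nu> \<Phi> (dist x y) \<le> t" for t x y
  proof -
    have t0: "0 < t" "sub_time \<nu> t \<in> J" using I[OF t] by auto
    have eq: "t * \<phi> (1 / sub_time \<nu> t) = 1" unfolding \<phi> by (rule sub_time_eq[OF levy poly b2 R1 t0(1)])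
    have "\<Phi> (dist x y) \<le> sub_time \<nu> t"
      using less_sub_scale_iff[OF levy poly b2 R1 \<Phi> t0(1), of "dist x y"] le by simp
    from est[rule_format, OF bspec[OF laws xy(1)] t0 eq xy this] show ?thesis
      unfolding subordinate_kernel_def gen_inv_sub_scale[OF levy poly b2 R1 \<Phi> t0(1)] .
  qed
  show ?thesis
    unfolding near_diagonal_estimate_def comparable_on_def
    by (rule exI[of _ c], rule conjI, rule c(1), rule exI[of _ C], rule conjI, rule c(2)) (use main in auto)
qed

lemma off_diagonal_estimate_subordinate:
  assumes \<phi>: "\<phi> = laplace_exponent \<nu>"
    and levy: "subordinator_levy_measure \<nu>" and poly: "poly_tail \<nu> R1 b1 b2" and b2: "b2 < 1" and R1: "0 < R1"
    and laws: "\<forall>x\<in>D. subordinator_laws \<phi> (\<lambda>t. distr (P (Some x)) borel (S t))"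
    and I: "\<And>t. t \<in> I \<Longrightarrow> 0 < t" and DJ: "\<And>x y. x \<in> D \<Longrightarrow> y \<in> D \<Longrightarrow> x \<noteq> y \<Longrightarrow> 4 * \<Phi> (dist x y) \<in> J"
    and JR: "\<And>u. u \<in> J \<Longrightarrow> ereal u < R1"
    and K: "0 < K" and \<Psi>_le: "\<And>x y. x \<in> D \<Longrightarrow> y \<in> D \<Longrightarrow> x \<noteq> y \<Longrightarrow> \<Psi> (dist x y) \<le> K * \<Phi> (dist x y)"
  shows "off_diagonal_estimate I m D \<nu> \<Phi> h C0 (subordinate_kernel P S p)"
proof -
  have C0: "C0 = 0 \<or> C0 = 1" using two_sided by (simp add: hk_two_sided_def)
  have ne: "x \<noteq> y" if "0 < t" "t \<le> sub_scale \<nu> \<Phi> (dist x y)" for t x y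
    using that by (auto simp: sub_scale_def)
  have RJ: "\<Phi> (dist x y) \<in> J" if "x \<in> D" "y \<in> D" "x \<noteq> y" for x y
    by (rule J_down[OF DJ[OF that]]) (use that scale_function_pos[OF \<Phi>, of "dist x y"] in auto)
  show ?thesis
  proof (cases "C0 = 0")
    case True
    obtain c C where c: "0 < c" "0 < C" and est: "\<forall>\<mu> t. subordinator_laws \<phi> \<mu> \<longrightarrow> 0 < t \<longrightarrow>
    (\<forall>x\<in>D. \<forall>y\<in>D. x \<noteq> y \<longrightarrow> \<Phi> (dist x y) \<in> J \<longrightarrow> t * \<phi> (1 / \<Phi> (dist x y)) \<le> 1 \<longrightarrow>
      ennreal c * (ennreal t / vol m x (dist x y) * (ennreal (h (\<Phi> (dist x y)) x y) / ennreal (1 / \<phi> (1 / \<Phi> (dist x y)))))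
        \<le> (\<integral>\<^sup>+ s\<in>{0<..}. ennreal (p s x y) \<partial>\<mu> t) \<and>
      (\<integral>\<^sup>+ s\<in>{0<..}. ennreal (p s x y) \<partial>\<mu> t) \<le>
        ennreal C * (ennreal t / vol m x (dist x y) * (ennreal (h (\<Phi> (dist x y)) x y) / ennreal (1 / \<phi> (1 / \<Phi> (dist x y))))))"
      by (rule off_diagonal_local[OF True])
    have main: "ennreal c * (ennreal t / vol m x (dist x y) * (ennreal (h (\<Phi> (dist x y)) x y) / ennreal (sub_scale \<nu> \<Phi> (dist x y))))
        \<le> subordinate_kernel P S p t x y \<and>
      subordinate_kernel P S p t x y \<le>
        ennreal C * (ennreal t / vol m x (dist x y) * (ennreal (h (\<Phi> (dist x y)) x y) / ennreal (sub_scale \<nu> \<Phi> (dist x y))))"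
      if t: "t \<in> I" and xy: "x \<in> D" "y \<in> D" and le: "t \<le> sub_scale \<nu> \<Phi> (dist x y)" for t x y
    proof -
      note t0 = I[OF t]
      note nxy = ne[OF t0 le]
      have d: "0 < dist x y" using nxy by simp
      have le1: "t * \<phi> (1 / \<Phi> (dist x y)) \<le> 1"
        unfolding \<phi> by (rule le_sub_scale_imp[OF levy poly b2 R1 \<Phi> t0 d le])
      have sc: "sub_scale \<nu> \<Phi> (dist x y) = 1 / \<phi> (1 / \<Phi> (dist x y))"
        using d by (simp add: sub_scale_def \<phi>)
      from est[rule_format, OF bspec[OF laws xy(1)] t0 xy nxy RJ[OF xy nxy] le1] show ?thesis
        unfolding subordinate_kernel_def sc .
    qed
    show ?thesis
      unfolding off_diagonal_estimate_def comparable_on_def if_P[OF True]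
      by (rule exI[of _ c], rule conjI, rule c(1), rule exI[of _ C], rule conjI, rule c(2)) (use main in auto)
  next
    case False
    then have C1: "C0 = 1" using C0 by simp
    obtain Kw where Kw: "0 < Kw" "\<And>r. 0 < r \<Longrightarrow> ereal r < R1 \<Longrightarrow>
        0 < levy_tail \<nu> r \<and> laplace_exponent \<nu> (1 / r) \<le> Kw * levy_tail \<nu> r"
      using laplace_exponent_le_levy_tail[OF levy poly b2] by blast
    obtain c C where c: "0 < c" "0 < C" and est: "\<forall>\<mu> t \<tau>. subordinator_laws \<phi> \<mu> \<longrightarrow> 0 < t \<longrightarrow> 0 < \<tau> \<longrightarrow> t * \<phi> (1 / \<tau>) = 1 \<longrightarrow>
    (\<forall>x\<in>D. \<forall>y\<in>D. x \<noteq> y \<longrightarrow> \<tau> \<le> \<Phi> (dist x y) \<longrightarrow> 4 * \<Phi> (dist x y) \<in> J \<longrightarrow>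
      ennreal c * (ennreal t / vol m x (dist x y) *
          ((\<integral>\<^sup>+ u\<in>{2 * \<tau>..4 * \<Phi> (dist x y)}. ennreal (h u x y * levy_tail \<nu> u) \<partial>lborel) / ennreal (\<Phi> (dist x y))))
        \<le> (\<integral>\<^sup>+ s\<in>{0<..}. ennreal (p s x y) \<partial>\<mu> t) \<and>
      (\<integral>\<^sup>+ s\<in>{0<..}. ennreal (p s x y) \<partial>\<mu> t) \<le>
        ennreal C * (ennreal t / vol m x (dist x y) *
          ((\<integral>\<^sup>+ u\<in>{2 * \<tau>..4 * \<Phi> (dist x y)}. ennreal (h u x y * levy_tail \<nu> u) \<partial>lborel) / ennreal (\<Phi> (dist x y)))))"
    proof (rule off_diagonal_jump[OF C1 K, where w = "levy_tail \<nu>" and Kw = Kw], goal_cases)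
      case 1 from 1(2-4) show ?case by (rule \<Psi>_le)
    next
      case 2 from 2(2,3) show ?case unfolding \<phi> by (intro laplace_exponent_mono[OF levy]) auto
    next
      case 3 show ?case by (rule levy_tail_nonneg[OF levy])
    next
      case 4 from 4(2,3) show ?case by (rule levy_tail_antimono[OF levy])
    next
      case 5 from 5(2) show ?case unfolding \<phi> by (rule levy_tail_le_laplace_exponent[OF levy])
    next
      case 6 show ?case by (rule Kw)
    next
      case (7 u) show ?case unfolding \<phi> using Kw(2)[OF J_pos[OF 7(2)] JR[OF 7(2)]] by blast
    next
      case (8 c C) from 8(2-4) show ?case by (rule that)
    qed
    have main: "ennreal c * (ennreal t / vol m x (dist x y) * (jump_integral \<nu> \<Phi> h t x y / ennreal (\<Phi> (dist x y))))
        \<le> subordinate_kernel P S p t x y \<and>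
      subordinate_kernel P S p t x y \<le>
        ennreal C * (ennreal t / vol m x (dist x y) * (jump_integral \<nu> \<Phi> h t x y / ennreal (\<Phi> (dist x y))))"
      if t: "t \<in> I" and xy: "x \<in> D" "y \<in> D" and le: "t \<le> sub_scale \<nu> \<Phi> (dist x y)" for t x y
    proof -
      note t0 = I[OF t]
      note nxy = ne[OF t0 le]
      have eq: "t * \<phi> (1 / sub_time \<nu> t) = 1" unfolding \<phi> by (rule sub_time_eq[OF levy poly b2 R1 t0])
      have \<tau>0: "0 < sub_time \<nu> t" by (rule sub_time_pos[OF levy poly b2 R1 t0])
      have "sub_time \<nu> t \<le> \<Phi> (dist x y)"
        using le_sub_scale_iff[OF levy poly b2 R1 \<Phi> t0, of "dist x y"] le by simp
      from est[rule_format, OF bspec[OF laws xy(1)] t0 \<tau>0 eq xy nxy this DJ[OF xy nxy]] show ?thesis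
        unfolding subordinate_kernel_def jump_integral_def .
    qed
    show ?thesis
      unfolding off_diagonal_estimate_def comparable_on_def if_not_P[OF False]
      by (rule exI[of _ c], rule conjI, rule c(1), rule exI[of _ C], rule conjI, rule c(2)) (use main in auto)
  qed
qed

end

text \<open>
  The comparison of \<open>\<Phi>\<close> and \<open>\<Psi>\<close> is given only below \<open>R1\<close>, but the diameter of \<open>D\<close> may be larger. Between a
  fixed point below \<open>R1\<close> and the diameter both functions are bounded and bounded away from 0.
\<close>

lemma scale_functions_comparable:
  assumes \<Phi>: "scale_function \<Phi>" and \<Psi>: "scale_function \<Psi>" and R1: "0 < R1"
    and comp: "comparable_on {r. 0 < r \<and> ereal r < R1} (\<lambda>r. ennreal (\<Phi> r)) (\<lambda>r. ennreal (\<Psi> r))"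
    and A: "R1 = \<infinity> \<or> (\<forall>r\<in>A. r \<le> b)"
  obtains K where "0 < K" "\<And>r. r \<in> A \<Longrightarrow> 0 < r \<Longrightarrow> \<Psi> r \<le> K * \<Phi> r"
proof -
  obtain c1 where c1: "0 < c1" and le: "\<forall>r\<in>{r. 0 < r \<and> ereal r < R1}. ennreal c1 * ennreal (\<Psi> r) \<le> ennreal (\<Phi> r)"
    using comp unfolding comparable_on_def by blast
  have small: "\<Psi> r \<le> 1 / c1 * \<Phi> r" if r: "0 < r" "ereal r < R1" for r
  proof -
    have "ennreal (c1 * \<Psi> r) \<le> ennreal (\<Phi> r)"
      using le r c1 by (simp add: ennreal_mult')
    then have "c1 * \<Psi> r \<le> \<Phi> r" using scale_function_pos[OF \<Phi> r(1)] by (simp add: ennreal_le_iff)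
    then show ?thesis using c1 by (simp add: field_simps)
  qed
  obtain r0 where r0: "0 < r0" "ereal r0 < R1" using ereal_dense2[OF R1] by auto
  define K where "K = max (1 / c1) (\<Psi> (max b r0) / \<Phi> r0)"
  have K: "0 < K" "1 / c1 \<le> K" "\<Psi> (max b r0) / \<Phi> r0 \<le> K" using c1 by (auto simp: K_def less_max_iff_disj)
  show ?thesis
  proof (rule that[OF K(1)])
    fix r assume r: "r \<in> A" "0 < r"
    note \<Phi>r = scale_function_pos[OF \<Phi> r(2)]
    show "\<Psi> r \<le> K * \<Phi> r"
    proof (cases "ereal r < R1")
      case True
      have "\<Psi> r \<le> 1 / c1 * \<Phi> r" by (rule small[OF r(2) True])
      also have "\<dots> \<le> K * \<Phi> r" using K \<Phi>r by (intro mult_right_mono) auto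
      finally show ?thesis .
    next
      case False
      then have "R1 \<noteq> \<infinity>" by auto
      then have rb: "r \<le> b" using A r(1) by blast
      have r0r: "r0 \<le> r" using r0(2) False by (cases R1) auto
      note \<Phi>0 = scale_function_pos[OF \<Phi> r0(1)]
      have "\<Psi> r \<le> \<Psi> (max b r0)" using rb r by (intro scale_function_mono[OF \<Psi>]) auto
      also have "\<dots> \<le> K * \<Phi> r0" using K(3) \<Phi>0 by (simp add: pos_divide_le_eq)
      also have "\<dots> \<le> K * \<Phi> r" using K r0 r0r by (intro mult_left_mono scale_function_mono[OF \<Phi>]) auto
      finally show ?thesis .
    qed
  qed
qed

theorem corollary4p4:
  fixes m :: "'a::{metric_space,second_countable_topology} measure"
    and D :: "'a set"
    and M :: "'w measure" and F :: "ennreal \<Rightarrow> 'w measure"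
    and P :: "'a option \<Rightarrow> 'w measure" and Y :: "ennreal \<Rightarrow> 'w \<Rightarrow> 'a option"
    and S :: "real \<Rightarrow> 'w \<Rightarrow> real" and \<nu> :: "real measure"
    and p h :: "real \<Rightarrow> 'a \<Rightarrow> 'a \<Rightarrow> real"
    and \<Phi> \<Psi> :: "real \<Rightarrow> real"
    and R_E R1 :: ereal and \<beta>1 \<beta>2 C0 :: real
  assumes "locally compact (UNIV :: 'a set)"
    and "\<And>K :: 'a set. bounded K \<Longrightarrow> closed K \<Longrightarrow> compact K"
    and "radon_measure m" and "full_support m"
    and "0 < R_E" and "volume_scaling m R_E"
    and "open D" and "D \<noteq> UNIV"
    and "hunt_process M F D P Y"
    and "heat_kernel M D P Y m p"
    and "independent_subordinator M D P Y \<nu> S"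
    and "scale_function \<Phi>" and "scale_function \<Psi>" and "\<And>r. 0 \<le> r \<Longrightarrow> \<Phi> r \<le> \<Psi> r"
    and "boundary_function D \<Phi> h"
    and "0 < R1" and "poly_tail \<nu> R1 \<beta>1 \<beta>2" and "\<beta>2 < 1"
    and "comparable_on {r. 0 < r \<and> ereal r < R1} (\<lambda>r. ennreal (\<Phi> r)) (\<lambda>r. ennreal (\<Psi> r))"
  shows "(HK_B m D \<Phi> \<Psi> h C0 p \<and> ereal (\<Phi> (diameter D)) < R1 / 8 \<longrightarrow>
      (\<forall>T>0. (power_decay_on {0<..sub_time \<nu> T} D h \<longrightarrow>
                near_diagonal_estimate {0<..T} m D \<nu> \<Phi> h (subordinate_kernel P S p)) \<and>
              off_diagonal_estimate {0<..T} m D \<nu> \<Phi> h C0 (subordinate_kernel P S p))) \<and>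
    (R1 = \<infinity> \<and> HK_U R_E m D \<Phi> \<Psi> h C0 p \<longrightarrow>
      (power_decay_on {0<..} D h \<longrightarrow> near_diagonal_estimate {0<..} m D \<nu> \<Phi> h (subordinate_kernel P S p)) \<and>
      off_diagonal_estimate {0<..} m D \<nu> \<Phi> h C0 (subordinate_kernel P S p))"
proof (cases "D = {}")
  case True
  have "near_diagonal_estimate I m D \<nu> \<Phi> h q" "off_diagonal_estimate I m D \<nu> \<Phi> h C0 q" for I q
    unfolding near_diagonal_estimate_def off_diagonal_estimate_def comparable_on_def True
    by (auto intro!: exI[of _ 1])
  then show ?thesis by blast
next
  case False
  note bc = assms(2) and radon = assms(3) and supp = assms(4) and RE = assms(5) and scal = assms(6)
    and \<Phi> = assms(12) and \<Psi> = assms(13) and \<Phi>\<Psi> = assms(14) and bd = assms(15) and R1 = assms(16)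
    and poly = assms(17) and b2 = assms(18) and comp = assms(19)
  let ?\<phi> = "laplace_exponent \<nu>"
  have drift: "driftless_subordinator (P (Some x)) \<nu> S" if "x \<in> D" for x
    using assms(11) that unfolding independent_subordinator_def by blast
  have levy: "subordinator_levy_measure \<nu>"
  proof -
    obtain x where "x \<in> D" using False by blast
    from drift[OF this] show ?thesis unfolding driftless_subordinator_def by (elim conjE)
  qed
  have laws: "\<forall>x\<in>D. subordinator_laws ?\<phi> (\<lambda>t. distr (P (Some x)) borel (S t))"
    by (intro ballI driftless_subordinator_laws drift)
  have h0: "\<forall>s>0. \<forall>x\<in>D. \<forall>y\<in>D. 0 \<le> h s x y"
    and h_anti: "\<forall>x\<in>D. \<forall>y\<in>D. \<forall>s t. 0 < s \<and> s \<le> t \<longrightarrow> h t x y \<le> h s x y"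
    and h_dec: "power_decay_on {t. 0 < t \<and> (bounded D \<longrightarrow> t < 4 * \<Phi> (diameter D) + 1)} D h"
    using bd unfolding boundary_function_def by blast+
  have p0: "\<forall>s>0. \<forall>x\<in>D. \<forall>y\<in>D. 0 \<le> p s x y" using assms(10) unfolding heat_kernel_def by blast
  have b1: "0 < \<beta>1" using poly by (simp add: poly_tail_def)
  have \<phi>_pos: "0 < ?\<phi> l" if "0 < l" for l
    by (rule laplace_exponent_pos[OF levy levy_tail_positive[OF levy poly b2 R1] that])
  \<comment> \<open>each of the four cases below supplies its own \<open>J\<close>\<close>
  have setting: "hk_setting m D \<Phi> \<Psi> h p C0 J ?\<phi> \<beta>1 \<beta>2"
    if J: "J = {0<..} \<and> R1 = \<infinity> \<and> R_E = \<infinity> \<or> (\<exists>L. J = {0<..L})"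
      and dec: "power_decay_on J D h"
      and up: "\<exists>C>0. \<forall>u\<in>J. \<forall>s\<ge>u. \<forall>x\<in>D. \<forall>y\<in>D. p s x y \<le> C * h u x y / measure m (ball x (gen_inv \<Phi> u))"
      and two: "hk_two_sided J m D \<Phi> \<Psi> h C0 p" for J
  proof
    show "weak_scaling J (\<lambda>u. ?\<phi> (1 / u)) \<beta>1 \<beta>2"
      using J weak_scaling_laplace_exponent[OF levy poly b2 R1] by metis
    have "R_E = \<infinity> \<or> (\<exists>b. \<forall>u\<in>J. u \<le> b)" using J by auto
    then obtain b where "R_E = \<infinity> \<or> (\<forall>u\<in>J. u \<le> b)" by blast
    from volume_growth_in_time[OF bc radon supp RE scal \<Phi> this]
    show "\<exists>C>0. \<exists>d\<ge>0. \<forall>S\<in>J. \<forall>s. 0 < s \<and> s \<le> S \<longrightarrow> (\<forall>x.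
      measure m (ball x (gen_inv \<Phi> S)) \<le> C * (S / s) powr d * measure m (ball x (gen_inv \<Phi> s)))" .
    show "0 < u" if "u \<in> J" for u using J that by auto
    show "v \<in> J" if "u \<in> J" "0 < v" "v \<le> u" for u v using J that by auto
    show "0 \<le> h s x y" if "0 < s" "x \<in> D" "y \<in> D" for s x y using h0 that by blast
    show "h t x y \<le> h s x y" if "0 < s" "s \<le> t" "x \<in> D" "y \<in> D" for s t x y using h_anti that by blast
    show "0 \<le> p s x y" if "0 < s" "x \<in> D" "y \<in> D" for s x y using p0 that by blast
  qed (fact bc radon supp \<Phi> \<Psi> \<Phi>\<Psi> \<phi>_pos b1 b2 dec up two)+
  have dist_le: "\<Phi> (dist x y) \<le> \<Phi> (diameter D)" if "bounded D" "x \<in> D" "y \<in> D" for x y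
    by (rule scale_function_mono[OF \<Phi> zero_le_dist diameter_bounded_bound[OF that]])
  have \<Phi>_dist: "0 < \<Phi> (dist x y)" if "x \<noteq> y" for x y :: 'a
    using that by (intro scale_function_pos[OF \<Phi>]) simp
  have dec_off: "power_decay_on {0<..4 * \<Phi> (diameter D)} D h"
    by (rule power_decay_on_subset[OF h_dec]) auto
  have B: "(power_decay_on {0<..sub_time \<nu> T} D h \<longrightarrow>
        near_diagonal_estimate {0<..T} m D \<nu> \<Phi> h (subordinate_kernel P S p)) \<and>
      off_diagonal_estimate {0<..T} m D \<nu> \<Phi> h C0 (subordinate_kernel P S p)"
    if HK: "HK_B m D \<Phi> \<Psi> h C0 p" and dR: "ereal (\<Phi> (diameter D)) < R1 / 8" and T: "0 < T" for T
  proof (intro conjI impI)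
    have bD: "bounded D" using HK by (simp add: HK_B_def)
    have fin1: "hk_two_sided {0<..L} m D \<Phi> \<Psi> h C0 p" if "power_decay_on {0<..L} D h" for L
      by (rule HK_B_finite_horizon(1)[OF bc radon supp RE scal \<Phi> h0 h_anti p0 HK False]) (use that in simp_all)
    have fin2: "\<exists>C>0. \<forall>u\<in>{0<..L}. \<forall>s\<ge>u. \<forall>x\<in>D. \<forall>y\<in>D.
        p s x y \<le> C * h u x y / measure m (ball x (gen_inv \<Phi> u))" if "power_decay_on {0<..L} D h" for L
      by (rule HK_B_finite_horizon(2)[OF bc radon supp RE scal \<Phi> h0 h_anti p0 HK False]) (use that in simp_all)
    show "near_diagonal_estimate {0<..T} m D \<nu> \<Phi> h (subordinate_kernel P S p)"
      if dec: "power_decay_on {0<..sub_time \<nu> T} D h"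
    proof -
      interpret hk_setting m D \<Phi> \<Psi> h p C0 "{0<..sub_time \<nu> T}" ?\<phi> \<beta>1 \<beta>2
        by (rule setting[OF _ dec fin2[OF dec] fin1[OF dec]]) blast
      show ?thesis
      proof (rule near_diagonal_estimate_subordinate[OF refl[of ?\<phi>] levy poly b2 R1 laws])
        fix t assume "t \<in> {0<..T}"
        then have t: "0 < t" "t \<le> T" by auto
        show "0 < t \<and> sub_time \<nu> t \<in> {0<..sub_time \<nu> T}"
          using t sub_time_pos[OF levy poly b2 R1 t(1)] sub_time_mono[OF levy poly b2 R1 t] by simp
      qed
    qed
    show "off_diagonal_estimate {0<..T} m D \<nu> \<Phi> h C0 (subordinate_kernel P S p)"
    proof -
      interpret hk_setting m D \<Phi> \<Psi> h p C0 "{0<..4 * \<Phi> (diameter D)}" ?\<phi> \<beta>1 \<beta>2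
        by (rule setting[OF _ dec_off fin2[OF dec_off] fin1[OF dec_off]]) blast
      have "R1 = \<infinity> \<or> (\<forall>r\<in>{..diameter D}. r \<le> diameter D)" by simp
      from scale_functions_comparable[OF \<Phi> \<Psi> R1 comp this] obtain K where
        K: "0 < K" "\<And>r. r \<in> {..diameter D} \<Longrightarrow> 0 < r \<Longrightarrow> \<Psi> r \<le> K * \<Phi> r" by blast
      show ?thesis
      proof (rule off_diagonal_estimate_subordinate[OF refl[of ?\<phi>] levy poly b2 R1 laws _ _ _ K(1)])
        show "0 < t" if "t \<in> {0<..T}" for t using that by simp
        show "4 * \<Phi> (dist x y) \<in> {0<..4 * \<Phi> (diameter D)}" if "x \<in> D" "y \<in> D" "x \<noteq> y" for x y
          using dist_le[OF bD that(1,2)] \<Phi>_dist[OF that(3)] by simp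
        show "ereal u < R1" if "u \<in> {0<..4 * \<Phi> (diameter D)}" for u
          using that dR by (cases R1) (auto simp: ereal_divide_eq)
        show "\<Psi> (dist x y) \<le> K * \<Phi> (dist x y)" if "x \<in> D" "y \<in> D" "x \<noteq> y" for x y
          using diameter_bounded_bound[OF bD that(1,2)] that(3) by (intro K(2)) auto
      qed
    qed
  qed
  have U: "(power_decay_on {0<..} D h \<longrightarrow> near_diagonal_estimate {0<..} m D \<nu> \<Phi> h (subordinate_kernel P S p)) \<and>
      off_diagonal_estimate {0<..} m D \<nu> \<Phi> h C0 (subordinate_kernel P S p)"
    if RI: "R1 = \<infinity>" and HK: "HK_U R_E m D \<Phi> \<Psi> h C0 p"
  proof (intro conjI impI)
    have REI: "R_E = \<infinity>" and two: "hk_two_sided {0<..} m D \<Phi> \<Psi> h C0 p" using HK by (auto simp: HK_U_def)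
    obtain C where C: "0 < C" "\<forall>u>0. \<forall>s\<ge>u. \<forall>x\<in>D. \<forall>y\<in>D.
        p s x y \<le> C * h u x y / measure m (ball x (gen_inv \<Phi> u))"
      using HK_U_upper[OF bc radon supp \<Phi> h0 h_anti two] by blast
    show "near_diagonal_estimate {0<..} m D \<nu> \<Phi> h (subordinate_kernel P S p)"
      if dec: "power_decay_on {0<..} D h"
    proof -
      interpret hk_setting m D \<Phi> \<Psi> h p C0 "{0<..}" ?\<phi> \<beta>1 \<beta>2
        by (rule setting[OF _ dec _ two]) (use RI REI C in auto)
      show ?thesis
        by (rule near_diagonal_estimate_subordinate[OF refl[of ?\<phi>] levy poly b2 R1 laws])
          (use sub_time_pos[OF levy poly b2 R1] in simp_all)
    qed
    \<comment> \<open>\<open>h\<close> has controlled decay only up to \<open>4 \<Phi> (diameter D)\<close> if \<open>D\<close> is bounded; later times are needed only in the upper bound\<close>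
    define J where "J = (if bounded D then {0<..4 * \<Phi> (diameter D)} else {0<..})"
    have J0: "J \<subseteq> {0<..}" by (auto simp: J_def)
    show "off_diagonal_estimate {0<..} m D \<nu> \<Phi> h C0 (subordinate_kernel P S p)"
    proof -
      have decJ: "power_decay_on J D h"
        by (rule power_decay_on_subset[OF h_dec]) (auto simp: J_def)
      have twoJ: "hk_two_sided J m D \<Phi> \<Psi> h C0 p"
        using two J0 unfolding hk_two_sided_def by (meson subsetD)
      have upJ: "\<exists>C>0. \<forall>u\<in>J. \<forall>s\<ge>u. \<forall>x\<in>D. \<forall>y\<in>D. p s x y \<le> C * h u x y / measure m (ball x (gen_inv \<Phi> u))"
        using C J0 by (intro exI[of _ C]) auto
      interpret hk_setting m D \<Phi> \<Psi> h p C0 J ?\<phi> \<beta>1 \<beta>2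
        by (rule setting[OF _ decJ upJ twoJ]) (use RI REI in \<open>auto simp: J_def\<close>)
      have "R1 = \<infinity> \<or> (\<forall>r\<in>UNIV. r \<le> (0::real))" using RI by simp
      from scale_functions_comparable[OF \<Phi> \<Psi> R1 comp this] obtain K where
        K: "0 < K" "\<And>r. r \<in> UNIV \<Longrightarrow> 0 < r \<Longrightarrow> \<Psi> r \<le> K * \<Phi> r" by blast
      show ?thesis
      proof (rule off_diagonal_estimate_subordinate[OF refl[of ?\<phi>] levy poly b2 R1 laws _ _ _ K(1)])
        show "0 < t" if "t \<in> {0<..}" for t :: real using that by simp
        show "4 * \<Phi> (dist x y) \<in> J" if "x \<in> D" "y \<in> D" "x \<noteq> y" for x y
          using dist_le[OF _ that(1,2)] \<Phi>_dist[OF that(3)] by (simp add: J_def)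
        show "ereal u < R1" for u using RI by simp
        show "\<Psi> (dist x y) \<le> K * \<Phi> (dist x y)" if "x \<in> D" "y \<in> D" "x \<noteq> y" for x y
          using that(3) by (intro K(2)) auto
      qed
    qed
  qed
  show ?thesis using B U by blast
qed

end
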